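(* Let $k$ be an infinite field, let $R=k[x_1,\ldots,x_n]$ be a polynomial ring with its standard grading, let $I\subseteq R$ be a homogeneous ideal, and let $\operatorname{Gin}(I)$ be the generic initial ideal of $I$ with respect to the reverse lexicographic order. Then for every integer $t\ge0$: (a) $\operatorname{reg}_t(I)=\operatorname{reg}_t(\operatorname{Gin}(I))$; (b) $a^*_t(I)=a^*_t(\operatorname{Gin}(I))$.
   Context: The order is the graded reverse lexicographic order with $x_1>\cdots>x_n$; $\operatorname{Gin}(I)$ is the common initial ideal of $g(I)$ for $g$ in a nonempty Zariski-open subset of $\mathrm{GL}(n,k)$ acting by linear changes of coordinates. With $R_+=(x_1,\ldots,x_n)$ and $M$ a finitely generated graded $R$-module, $a_i(M)=\sup\{r\mid H^i_{R_+}(M)_r\neq0\}$ (value $-\infty$ if $H^i_{R_+}(M)=0$), where $H^i_{R_+}(M)$ is the $i$-th (graded) local cohomology module; $\operatorname{reg}_t(M)=\max\{a_i(M)+i\mid 0\le i\le t\}$ and $a_t^*(M)=\max\{a_i(M)\mid 0\le i\le t\}$. Ideals are regarded as graded $R$-modules. *)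

theory Defs
  imports
    "HOL-Analysis.Analysis"
    "HOL-Algebra.Algebra"
    "HOL-Algebra.Algebraic_Closure_Type"
    "HOL-Library.Poly_Mapping"
begin

text \<open>
  The polynomial ring \<open>k[x\<^sub>1,\<dots>,x\<^sub>n]\<close> is the type \<open>('n, 'k) mpoly\<close>, whose variables are indexed
  by a finite linearly ordered type \<open>'n\<close>. As a ring in the sense of HOL-Algebra it is
  \<^term>\<open>ring_of_type_algebra\<close>.
\<close>

type_synonym ('n, 'k) mpoly = "('n \<Rightarrow>\<^sub>0 nat) \<Rightarrow>\<^sub>0 'k"

abbreviation poly_ring :: "('n::finite, 'k::field) mpoly ring" where
  "poly_ring \<equiv> ring_of_type_algebra"

definition mvar :: "'n \<Rightarrow> ('n::finite, 'k::field) mpoly" where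
  "mvar i = Poly_Mapping.single (Poly_Mapping.single i 1) 1"

definition mdeg :: "('n::finite \<Rightarrow>\<^sub>0 nat) \<Rightarrow> nat" where
  "mdeg m = (\<Sum>i\<in>UNIV. Poly_Mapping.lookup m i)"

definition homog_comp :: "nat \<Rightarrow> ('n::finite, 'k::field) mpoly \<Rightarrow> ('n, 'k) mpoly" where
  "homog_comp d f = (\<Sum>m\<in>{m \<in> Poly_Mapping.keys f. mdeg m = d}.
     Poly_Mapping.single m (Poly_Mapping.lookup f m))"

definition homogeneous_ideal :: "('n::finite, 'k::field) mpoly set \<Rightarrow> bool" where
  "homogeneous_ideal I \<longleftrightarrow> ideal I poly_ring \<and> (\<forall>f\<in>I. \<forall>d. homog_comp d f \<in> I)"


section \<open>The generic initial ideal\<close>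

text \<open>
  A smaller index is a larger variable. Among monomials of equal degree, \<open>a < b\<close> iff the last
  nonzero entry of the exponent difference \<open>a - b\<close> is positive.
\<close>

definition revlex_less :: "('n::{finite,linorder} \<Rightarrow>\<^sub>0 nat) \<Rightarrow> ('n \<Rightarrow>\<^sub>0 nat) \<Rightarrow> bool" where
  "revlex_less a b \<longleftrightarrow> mdeg a < mdeg b \<or>
     (mdeg a = mdeg b \<and>
      (\<exists>i. Poly_Mapping.lookup a i > Poly_Mapping.lookup b i \<and>
           (\<forall>j>i. Poly_Mapping.lookup a j = Poly_Mapping.lookup b j)))"

definition lead_mon :: "('n::{finite,linorder}, 'k::field) mpoly \<Rightarrow> ('n \<Rightarrow>\<^sub>0 nat)" where
  "lead_mon f = (THE m. m \<in> Poly_Mapping.keys f \<and>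
     (\<forall>m'\<in>Poly_Mapping.keys f. m' \<noteq> m \<longrightarrow> revlex_less m' m))"

definition initial_ideal ::
    "('n::{finite,linorder}, 'k::field) mpoly set \<Rightarrow> ('n, 'k) mpoly set" where
  "initial_ideal I =
     Idl\<^bsub>poly_ring\<^esub> {Poly_Mapping.single (lead_mon f) 1 | f. f \<in> I \<and> f \<noteq> 0}"

text \<open>
  Evaluation of a polynomial at \<open>v\<close>, where the coefficients are mapped into the target ring by \<open>h\<close>.
\<close>

definition mpoly_eval ::
    "('k::field \<Rightarrow> 'r::comm_ring_1) \<Rightarrow> ('n::finite \<Rightarrow> 'r) \<Rightarrow> ('n, 'k) mpoly \<Rightarrow> 'r" where
  "mpoly_eval h v f = (\<Sum>m\<in>Poly_Mapping.keys f.
     h (Poly_Mapping.lookup f m) * (\<Prod>i\<in>UNIV. v i ^ Poly_Mapping.lookup m i))"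

definition linear_change ::
    "'k::field ^ 'n::finite ^ 'n \<Rightarrow> ('n, 'k) mpoly \<Rightarrow> ('n, 'k) mpoly" where
  "linear_change g =
     mpoly_eval (Poly_Mapping.single 0)
       (\<lambda>j. \<Sum>i\<in>UNIV. Poly_Mapping.single 0 (g $ i $ j) * mvar i)"

text \<open>
  The Zariski topology on \<open>GL(n,k)\<close> is the one induced from the affine space of all matrices; a
  polynomial in the matrix entries has its variables indexed by \<open>'n \<times> 'n\<close>.
\<close>

definition zariski_open_GL :: "('k::field ^ 'n::finite ^ 'n) set \<Rightarrow> bool" where
  "zariski_open_GL U \<longleftrightarrow>
     (\<exists>P :: ('n \<times> 'n, 'k) mpoly set.
        U = {g. invertible g \<and> (\<exists>p\<in>P. mpoly_eval (\<lambda>c. c) (\<lambda>(i, j). g $ i $ j) p \<noteq> 0)})"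

definition Gin :: "('n::{finite,linorder}, 'k::field) mpoly set \<Rightarrow> ('n, 'k) mpoly set" where
  "Gin I = (THE J. \<exists>U :: ('k ^ 'n::{finite,linorder} ^ 'n::{finite,linorder}) set. zariski_open_GL U \<and> U \<noteq> {} \<and>
     (\<forall>g\<in>U. initial_ideal (linear_change g ` I) = J))"


section \<open>Graded modules\<close>

text \<open>
  \<open>hpart M d\<close> is the homogeneous component of degree \<open>d\<close>. The fields \<open>mult\<close> and \<open>one\<close>, inherited
  from the record type of modules, carry no meaning.
\<close>

record ('r, 'm) graded_module = "('r, 'm) module" +
  hpart :: "int \<Rightarrow> 'm set"

definition ideal_module ::
    "('n::finite, 'k::field) mpoly set \<Rightarrow> (('n, 'k) mpoly, ('n, 'k) mpoly) graded_module" where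
  "ideal_module I =
     \<lparr>carrier = I, mult = (*), one = 1, ring.zero = 0, add = (+), module.smult = (*),
      hpart = (\<lambda>d. {f \<in> I. \<forall>m\<in>Poly_Mapping.keys f. int (mdeg m) = d})\<rparr>"


section \<open>Graded local cohomology with support in the ideal of the variables\<close>

text \<open>
  Local cohomology is the cohomology of the Cech complex of \<open>M\<close> on the variables, whose term in
  cohomological degree \<open>p\<close> is the direct sum of the localizations \<open>M\<^sub>S\<close> of \<open>M\<close> at
  \<open>x\<^sub>S = (\<Prod>i\<in>S. x\<^sub>i)\<close>, over all sets \<open>S\<close> of \<open>p\<close> variables. The fraction \<open>m / x\<^sub>S\<^sup>a\<close> is the class of
  the pair \<open>(m, a)\<close>, and it has degree \<open>r\<close> if \<open>m\<close> has degree \<open>r + a |S|\<close>.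
\<close>

definition var_prod :: "'n set \<Rightarrow> ('n::finite, 'k::field) mpoly" where
  "var_prod S = (\<Prod>i\<in>S. mvar i)"

definition frac_rel ::
    "(('n::finite, 'k::field) mpoly, 'm) graded_module \<Rightarrow> 'n set \<Rightarrow>
     (('m \<times> nat) \<times> ('m \<times> nat)) set" where
  "frac_rel M S = {((m, a), (m', b)). m \<in> carrier M \<and> m' \<in> carrier M \<and>
     (\<exists>c. (var_prod S ^ (c + b)) \<odot>\<^bsub>M\<^esub> m = (var_prod S ^ (c + a)) \<odot>\<^bsub>M\<^esub> m')}"

definition loc_frac ::
    "(('n::finite, 'k::field) mpoly, 'm) graded_module \<Rightarrow> 'n set \<Rightarrow> 'm \<Rightarrow> nat \<Rightarrow>
     ('m \<times> nat) set" where
  "loc_frac M S m a = frac_rel M S `` {(m, a)}"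

definition localization ::
    "(('n::finite, 'k::field) mpoly, 'm) graded_module \<Rightarrow> 'n set \<Rightarrow>
     (('n, 'k) mpoly, ('m \<times> nat) set) graded_module" where
  "localization M S =
     \<lparr>carrier = {loc_frac M S m a | m a. m \<in> carrier M},
      mult = undefined, one = undefined,
      ring.zero = loc_frac M S \<zero>\<^bsub>M\<^esub> 0,
      add = (\<lambda>A B. \<Union>(m, a)\<in>A. \<Union>(m', b)\<in>B.
        loc_frac M S ((var_prod S ^ b) \<odot>\<^bsub>M\<^esub> m \<oplus>\<^bsub>M\<^esub> (var_prod S ^ a) \<odot>\<^bsub>M\<^esub> m') (a + b)),
      module.smult = (\<lambda>f A. \<Union>(m, a)\<in>A. loc_frac M S (f \<odot>\<^bsub>M\<^esub> m) a),
      hpart = (\<lambda>r. {loc_frac M S m a | m a. m \<in> hpart M (r + int a * int (card S))})\<rparr>"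

text \<open>The canonical map \<open>M\<^sub>S \<rightarrow> M\<^sub>T\<close> for \<open>S \<subseteq> T\<close>:\<close>

definition localization_map ::
    "(('n::finite, 'k::field) mpoly, 'm) graded_module \<Rightarrow> 'n set \<Rightarrow> 'n set \<Rightarrow>
     ('m \<times> nat) set \<Rightarrow> ('m \<times> nat) set" where
  "localization_map M S T A =
     (\<Union>(m, a)\<in>A. loc_frac M T ((var_prod (T - S) ^ a) \<odot>\<^bsub>M\<^esub> m) a)"

text \<open>
  The group of Cech cochains of cohomological degree \<open>p\<close> and internal degree \<open>r\<close>. Here and below,
  additive groups are written as monoid records, so \<open>mult\<close> is their addition and \<open>one\<close> their zero.
\<close>

definition cech_cochains ::
    "(('n::finite, 'k::field) mpoly, 'm) graded_module \<Rightarrow> nat \<Rightarrow> int \<Rightarrow>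
     ('n set \<Rightarrow> ('m \<times> nat) set) monoid" where
  "cech_cochains M p r =
     \<lparr>carrier = (\<Pi>\<^sub>E S\<in>{S. card S = p}. hpart (localization M S) r),
      mult = (\<lambda>u v. \<lambda>S\<in>{S. card S = p}. u S \<oplus>\<^bsub>localization M S\<^esub> v S),
      one = (\<lambda>S\<in>{S. card S = p}. \<zero>\<^bsub>localization M S\<^esub>)\<rparr>"

definition cech_diff ::
    "(('n::{finite,linorder}, 'k::field) mpoly, 'm) graded_module \<Rightarrow> nat \<Rightarrow>
     ('n set \<Rightarrow> ('m \<times> nat) set) \<Rightarrow> 'n set \<Rightarrow> ('m \<times> nat) set" where
  "cech_diff M p u = (\<lambda>T\<in>{T. card T = Suc p}.
     \<Oplus>\<^bsub>localization M T\<^esub>i\<in>T.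
       ((- 1) ^ card {j \<in> T. j < i}) \<odot>\<^bsub>localization M T\<^esub>
         localization_map M (T - {i}) T (u (T - {i})))"

definition cech_cocycles ::
    "(('n::{finite,linorder}, 'k::field) mpoly, 'm) graded_module \<Rightarrow> nat \<Rightarrow> int \<Rightarrow>
     ('n set \<Rightarrow> ('m \<times> nat) set) set" where
  "cech_cocycles M p r =
     kernel (cech_cochains M p r) (cech_cochains M (Suc p) r) (cech_diff M p)"

definition cech_coboundaries ::
    "(('n::{finite,linorder}, 'k::field) mpoly, 'm) graded_module \<Rightarrow> nat \<Rightarrow> int \<Rightarrow>
     ('n set \<Rightarrow> ('m \<times> nat) set) set" where
  "cech_coboundaries M p r =
     (case p of
        0 \<Rightarrow> {\<one>\<^bsub>cech_cochains M 0 r\<^esub>}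
      | Suc q \<Rightarrow> cech_diff M q ` carrier (cech_cochains M q r))"

definition local_cohomology ::
    "(('n::{finite,linorder}, 'k::field) mpoly, 'm) graded_module \<Rightarrow> nat \<Rightarrow> int \<Rightarrow>
     ('n set \<Rightarrow> ('m \<times> nat) set) set monoid" where
  "local_cohomology M p r =
     (cech_cochains M p r)\<lparr>carrier := cech_cocycles M p r\<rparr> Mod cech_coboundaries M p r"

text \<open>The supremum of the empty set is \<open>-\<infinity>\<close> in \<^typ>\<open>ereal\<close>.\<close>

definition a_inv ::
    "(('n::{finite,linorder}, 'k::field) mpoly, 'm) graded_module \<Rightarrow> nat \<Rightarrow> ereal" where
  "a_inv M i =
     (SUP r\<in>{r. carrier (local_cohomology M i r) \<noteq> {\<one>\<^bsub>local_cohomology M i r\<^esub>}}.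
        ereal (real_of_int r))"

definition reg_upto ::
    "nat \<Rightarrow> (('n::{finite,linorder}, 'k::field) mpoly, 'm) graded_module \<Rightarrow> ereal" where
  "reg_upto t M = Max {a_inv M i + ereal (real i) | i. i \<le> t}"

definition a_star ::
    "nat \<Rightarrow> (('n::{finite,linorder}, 'k::field) mpoly, 'm) graded_module \<Rightarrow> ereal" where
  "a_star t M = Max {a_inv M i | i. i \<le> t}"

end

theory Submission
  imports Defs "HOL-Library.Function_Algebras"
begin

text \<open>
  If \<open>z\<close> is a linear form that is filter-regular on \<open>R/J\<close>, the sequence
  \<open>H\<^sup>i(R/J) \<rightarrow> H\<^sup>i(R/(J,z)) \<rightarrow> H\<^sup>i\<^sup>+\<^sup>1(R/J)(-1) \<rightarrow> H\<^sup>i\<^sup>+\<^sup>1(R/J)\<close> and the \<open>z\<close>-torsion of local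
  cohomology show that \<open>reg\<^sub>t\<close> and \<open>a\<^sup>*\<^sub>t\<close> of \<open>R/J\<close> are determined by those of \<open>R/(J,z)\<close> for \<open>t - 1\<close> together with the
  degrees in which \<open>(J : z)/J\<close> does not vanish. Hence they depend only on these degrees along a
  filter-regular sequence of linear forms. For generic \<open>g\<close> the sequence \<open>x\<^sub>n, \<dots>, x\<^sub>1\<close> is filter-regular
  on \<open>R/gI\<close>, and for the reverse lexicographic order taking initial ideals commutes with adjoining
  and with dividing by the last variable, so the degrees are the same for \<open>gI\<close> and \<open>in(gI) = Gin(I)\<close>.
  Pulling the variables back along \<open>g\<close> avoids comparing Cech complexes in different coordinates.
  Finally \<open>H\<^sup>i(I) = H\<^sup>i\<^sup>-\<^sup>1(R/I)\<close> for \<open>i < n\<close>, with a correction from \<open>H\<^sup>n(R)\<close> for \<open>i = n\<close>. All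
  localizations of ideals are computed inside the ring of Laurent polynomials.
\<close>

unbundle no fps_syntax

text \<open>Single degrees do not survive the exact sequence. A class of \<open>R/J\<close> with
  cohomological degree \<open>i + 1\<close> and internal degree \<open>r\<close> yields one of
  \<open>R/(J,z)\<close> with indices \<open>i\<close> and \<open>r + k + 1\<close>, where
  \<open>z^k\<close> is the last power of \<open>z\<close> not killing it; going back from
  \<open>(i, r)\<close> ends in \<open>(i, r)\<close> or in \<open>(i + 1, r - 1)\<close>. What can
  be compared is the weight \<open>r + c * i\<close>, up to domination and for
  \<open>c \<le> 1\<close>; the values 1 and 0 of \<open>c\<close> are the two claims, so one
  induction settles both. The ideals in the two filter-regular sequences are never compared
  directly, only through the degrees of their colon quotients. For the existence of the generic
  initial ideal, families of polynomials depending polynomially on \<open>g\<close> stand in for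
  elements over the function field of the matrix entries; Dickson's lemma leaves finitely many
  leading coefficients that must not vanish. The correction in cohomological degree \<open>n\<close>
  is harmless: \<open>H^n(R)\<close> vanishes above degree \<open>-n\<close>, and \<open>H^n\<close>
  of every nonzero ideal is nonzero in degree \<open>-n\<close>.\<close>

abbreviation lookup :: "('a \<Rightarrow>\<^sub>0 'b::zero) \<Rightarrow> 'a \<Rightarrow> 'b" where "lookup \<equiv> Poly_Mapping.lookup"
abbreviation keys :: "('a \<Rightarrow>\<^sub>0 'b::zero) \<Rightarrow> 'a set" where "keys \<equiv> Poly_Mapping.keys"
abbreviation single :: "'a \<Rightarrow> 'b \<Rightarrow> ('a \<Rightarrow>\<^sub>0 'b::zero)" where "single \<equiv> Poly_Mapping.single"

section \<open>Polynomials as finitely supported functions\<close>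

lemma poly_mapping_sum_single:
  fixes f :: "'a \<Rightarrow>\<^sub>0 'b::comm_monoid_add"
  assumes "finite U" "keys f \<subseteq> U"
  shows "(\<Sum>m\<in>U. single m (lookup f m)) = f"
proof (rule poly_mapping_eqI)
  fix k
  have "lookup (\<Sum>m\<in>U. single m (lookup f m)) k = (\<Sum>m\<in>U. if m = k then lookup f k else 0)"
    by (auto simp: lookup_sum lookup_single when_def intro!: sum.cong)
  also have "\<dots> = lookup f k"
    using assms by (auto simp: sum.delta in_keys_iff)
  finally show "lookup (\<Sum>m\<in>U. single m (lookup f m)) k = lookup f k" .
qed

lemma poly_mapping_single_add_induct [case_names single add]:
  fixes f :: "'a \<Rightarrow>\<^sub>0 'b::comm_monoid_add"
  assumes "\<And>m c. P (single m c)" "\<And>f g. P f \<Longrightarrow> P g \<Longrightarrow> P (f + g)"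
  shows "P f"
proof -
  have "P (\<Sum>m\<in>U. single m (lookup f m))" if "finite U" for U
    using that
  proof (induction U)
    case empty
    show ?case using assms(1)[of undefined 0] by simp
  qed (auto intro: assms)
  from this[of "keys f"] show ?thesis
    by (simp add: poly_mapping_sum_single)
qed

lemma lookup_single_mult:
  fixes f :: "'a::cancel_comm_monoid_add \<Rightarrow>\<^sub>0 'b::comm_ring_1"
  shows "lookup (single e c * f) (e + m) = c * lookup f m"
proof (induction f rule: poly_mapping_single_add_induct)
  case (single m c)
  then show ?case by (simp add: mult_single lookup_single when_def)
next
  case (add f g)
  then show ?case by (simp add: algebra_simps lookup_add)
qed

lemma keys_single_mult:
  fixes f :: "'a::cancel_comm_monoid_add \<Rightarrow>\<^sub>0 'b::field"
  assumes "c \<noteq> 0"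
  shows "keys (single e c * f) = (+) e ` keys f"
proof
  show "keys (single e c * f) \<subseteq> (+) e ` keys f"
    using keys_mult[of "single e c" f] assms by auto
  show "(+) e ` keys f \<subseteq> keys (single e c * f)"
    using assms by (auto simp: in_keys_iff lookup_single_mult)
qed

lemma keys_sum_subset: "keys (\<Sum>x\<in>U. f x) \<subseteq> (\<Union>x\<in>U. keys (f x))"
  for f :: "'c \<Rightarrow> 'a \<Rightarrow>\<^sub>0 'b::comm_monoid_add"
proof (induction U rule: infinite_finite_induct)
  case (insert x U)
  then show ?case using keys_add[of "f x" "sum f U"] by auto
qed auto

section \<open>Ideals\<close>

text \<open>Stated with the operations of the type, so that no record selector of
  \<open>poly_ring\<close> appears in calculations; \<open>ideal_poly_ring_iff\<close> is the
  bridge.\<close>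

definition is_ideal :: "'r::comm_ring_1 set \<Rightarrow> bool" where
  "is_ideal J \<longleftrightarrow> 0 \<in> J \<and> (\<forall>f\<in>J. \<forall>g\<in>J. f + g \<in> J) \<and> (\<forall>f\<in>J. \<forall>h. h * f \<in> J)"

lemma is_idealD:
  assumes "is_ideal J"
  shows ideal_0: "0 \<in> J"
    and ideal_add: "f \<in> J \<Longrightarrow> g \<in> J \<Longrightarrow> f + g \<in> J"
    and ideal_mult: "f \<in> J \<Longrightarrow> h * f \<in> J"
    and ideal_mult': "f \<in> J \<Longrightarrow> f * h \<in> J"
    and ideal_uminus: "f \<in> J \<Longrightarrow> - f \<in> J"
    and ideal_diff: "f \<in> J \<Longrightarrow> g \<in> J \<Longrightarrow> f - g \<in> J"
    and ideal_sum: "(\<And>x. x \<in> U \<Longrightarrow> F x \<in> J) \<Longrightarrow> sum F U \<in> J"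
proof -
  note a = assms[unfolded is_ideal_def]
  show "0 \<in> J" using a by blast
  show add: "f + g \<in> J" if "f \<in> J" "g \<in> J" for f g using a that by blast
  show "h * f \<in> J" "f * h \<in> J" if "f \<in> J" for f h
    using a that by (auto simp: mult.commute)
  show um: "- f \<in> J" if "f \<in> J" for f
    using a that by (metis mult_minus1)
  show "f - g \<in> J" if "f \<in> J" "g \<in> J" for f g
    using add[OF that(1) um[OF that(2)]] by simp
  show "(\<And>x. x \<in> U \<Longrightarrow> F x \<in> J) \<Longrightarrow> sum F U \<in> J"
    by (induction U rule: infinite_finite_induct) (use a add in auto)
qed

lemma ideal_poly_ring_iff: "ideal J poly_ring \<longleftrightarrow> is_ideal J"
proof
  assume "ideal J poly_ring"
  then interpret ideal J poly_ring .
  show "is_ideal J"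
    unfolding is_ideal_def
    using additive_subgroup.zero_closed[OF is_additive_subgroup]
      additive_subgroup.a_closed[OF is_additive_subgroup] I_l_closed
    by (auto simp: ring_of_type_algebra_def)
next
  assume a: "is_ideal J"
  show "ideal J poly_ring"
  proof (rule idealI)
    show "ring (poly_ring :: ('a, 'b) mpoly ring)"
      by (rule ring_from_type_algebra)
    have inv: "\<ominus>\<^bsub>poly_ring\<^esub> f = - f" for f :: "('a, 'b) mpoly"
    proof -
      interpret ring "poly_ring :: ('a, 'b) mpoly ring"
        by (rule ring_from_type_algebra)
      show ?thesis
        by (rule minus_equality) (auto simp: ring_of_type_algebra_def)
    qed
    show "subgroup J (add_monoid poly_ring)"
      using inv a by (unfold_locales)
        (auto simp: ring_of_type_algebra_def Ring.a_inv_def is_idealD)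
  qed (use a in \<open>auto simp: ring_of_type_algebra_def is_idealD\<close>)
qed

lemma is_ideal_UNIV: "is_ideal UNIV"
  by (simp add: is_ideal_def)

lemma is_ideal_sing_0: "is_ideal {0}"
  by (simp add: is_ideal_def)

definition ideal_plus :: "'r::comm_ring_1 set \<Rightarrow> 'r \<Rightarrow> 'r set" where
  "ideal_plus J z = {f + z * h | f h. f \<in> J}"

definition colon :: "'r::comm_ring_1 set \<Rightarrow> 'r \<Rightarrow> 'r set" where
  "colon J z = {f. z * f \<in> J}"

lemma is_ideal_ideal_plus:
  assumes "is_ideal J" shows "is_ideal (ideal_plus J z)"
proof -
  have 1: "0 \<in> ideal_plus J z"
    using ideal_0[OF assms] by (force simp: ideal_plus_def intro: exI[of _ 0])
  have 2: "f + g \<in> ideal_plus J z" if fg: "f \<in> ideal_plus J z" "g \<in> ideal_plus J z" for f g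
  proof -
    obtain a h b k where "f = a + z * h" "g = b + z * k" "a \<in> J" "b \<in> J"
      using fg unfolding ideal_plus_def by blast
    then have "f + g = (a + b) + z * (h + k)" "a + b \<in> J"
      using ideal_add[OF assms] by (auto simp: algebra_simps)
    then show ?thesis unfolding ideal_plus_def by blast
  qed
  have 3: "h * f \<in> ideal_plus J z" if f: "f \<in> ideal_plus J z" for f h
  proof -
    obtain a k where "f = a + z * k" "a \<in> J"
      using f unfolding ideal_plus_def by blast
    then have "h * f = h * a + z * (h * k)" "h * a \<in> J"
      using ideal_mult[OF assms] by (auto simp: algebra_simps)
    then show ?thesis unfolding ideal_plus_def by blast
  qed
  show ?thesis using 1 2 3 by (auto simp: is_ideal_def)
qed

lemma ideal_plus_superset: "J \<subseteq> ideal_plus J z"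
  by (force simp: ideal_plus_def intro: exI[of _ 0])

lemma ideal_plus_gen: "is_ideal J \<Longrightarrow> z * h \<in> ideal_plus J z"
  using ideal_0[of J] by (force simp: ideal_plus_def)

lemma ideal_plus_least:
  assumes "is_ideal K" "J \<subseteq> K" "z \<in> K" shows "ideal_plus J z \<subseteq> K"
  using assms by (auto simp: ideal_plus_def intro!: ideal_add ideal_mult')

lemma is_ideal_colon: "is_ideal J \<Longrightarrow> is_ideal (colon J z)"
  by (auto simp: is_ideal_def colon_def algebra_simps)

lemma colon_superset: "is_ideal J \<Longrightarrow> J \<subseteq> colon J z"
  by (auto simp: colon_def ideal_mult)

section \<open>Evaluation homomorphisms\<close>

text \<open>One locale covers both uses of \<open>mpoly_eval\<close>: substitution into polynomials
  or Laurent polynomials, with coefficients embedded as constants, and evaluation at points of the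
  field.\<close>

locale coeff_hom =
  fixes h :: "'k::field \<Rightarrow> 'r::comm_ring_1"
  assumes h_add: "h (a + b) = h a + h b"
    and h_mult: "h (a * b) = h a * h b"
    and h_0: "h 0 = 0"
    and h_1: "h 1 = 1"
begin


lemma mpoly_eval_superset:
  assumes "finite U" "keys f \<subseteq> U"
  shows "mpoly_eval h v f = (\<Sum>m\<in>U. h (lookup f m) * (\<Prod>i\<in>UNIV. v i ^ lookup m i))"
  unfolding mpoly_eval_def
  by (rule sum.mono_neutral_left) (use assms in \<open>auto simp: in_keys_iff h_0\<close>)

lemma mpoly_eval_add: "mpoly_eval h v (f + g) = mpoly_eval h v f + mpoly_eval h v g"
  using keys_add[of f g]
  by (subst (1 2 3) mpoly_eval_superset[where U = "keys f \<union> keys g"])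
     (auto simp: lookup_add h_add algebra_simps sum.distrib)

lemma mpoly_eval_single: "mpoly_eval h v (single m c) = h c * (\<Prod>i\<in>UNIV. v i ^ lookup m i)"
  by (subst mpoly_eval_superset[where U = "{m}"]) auto

lemma mpoly_eval_0: "mpoly_eval h v 0 = 0"
  by (simp add: mpoly_eval_def)

lemma mpoly_eval_mult: "mpoly_eval h v (f * g) = mpoly_eval h v f * mpoly_eval h v g"
proof (induction f rule: poly_mapping_single_add_induct)
  case (single m c)
  show ?case
  proof (induction g rule: poly_mapping_single_add_induct)
    case (single m' c')
    then show ?case
      by (simp add: mult_single mpoly_eval_single h_mult lookup_add power_add prod.distrib algebra_simps)
  next
    case (add f g)
    then show ?case by (simp add: mpoly_eval_add algebra_simps)
  qed
next
  case (add f g)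
  then show ?case by (simp add: mpoly_eval_add algebra_simps)
qed

lemma mpoly_eval_1: "mpoly_eval h v 1 = 1"
  using mpoly_eval_single[of v 0 1] by (simp add: h_1)

lemma mpoly_eval_uminus: "mpoly_eval h v (- f) = - mpoly_eval h v f"
  using mpoly_eval_add[of v f "- f"] by (simp add: mpoly_eval_0 add_eq_0_iff2)

lemma mpoly_eval_power: "mpoly_eval h v (f ^ k) = mpoly_eval h v f ^ k"
  by (induction k) (simp_all add: mpoly_eval_1 mpoly_eval_mult)

lemma mpoly_eval_sum: "mpoly_eval h v (\<Sum>x\<in>U. F x) = (\<Sum>x\<in>U. mpoly_eval h v (F x))"
  by (induction U rule: infinite_finite_induct) (simp_all add: mpoly_eval_0 mpoly_eval_add)

lemma mpoly_eval_prod: "mpoly_eval h v (\<Prod>x\<in>U. F x) = (\<Prod>x\<in>U. mpoly_eval h v (F x))"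
  by (induction U rule: infinite_finite_induct) (simp_all add: mpoly_eval_1 mpoly_eval_mult)

lemma mpoly_eval_mvar: "mpoly_eval h v (mvar i) = v i"
proof -
  have "(\<Prod>j\<in>UNIV. v j ^ lookup (single i (1::nat)) j) = (\<Prod>j\<in>UNIV. if j = i then v i else 1)"
    by (rule prod.cong) (auto simp: lookup_single when_def)
  then show ?thesis
    by (simp add: mvar_def mpoly_eval_single h_1)
qed

lemma mpoly_eval_const: "mpoly_eval h v (single 0 c) = h c"
  by (simp add: mpoly_eval_single)

end

interpretation const_hom: coeff_hom "single 0 :: 'k::field \<Rightarrow> 'a::comm_monoid_add \<Rightarrow>\<^sub>0 'k"
  by unfold_locales (auto simp: single_add mult_single)

interpretation id_hom: coeff_hom "\<lambda>c::'k::field. c"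
  by unfold_locales auto

lemma mvar_power: "mvar i ^ k = (single (single i k) 1 :: ('n::finite, 'k::field) mpoly)"
proof (induction k)
  case (Suc k)
  then show ?case
    by (simp add: mvar_def mult_single flip: single_add)
qed auto

lemma sum_single_exponents: "(\<Sum>i\<in>UNIV. single i (lookup m i)) = m"
  for m :: "'n::finite \<Rightarrow>\<^sub>0 'b::comm_monoid_add"
  by (rule poly_mapping_sum_single) auto

lemma prod_single_one:
  "(\<Prod>i\<in>A. single (m i) 1) = (single (\<Sum>i\<in>A. m i) 1 :: 'a::comm_monoid_add \<Rightarrow>\<^sub>0 'k::comm_ring_1)"
  by (induction A rule: infinite_finite_induct) (auto simp: mult_single)

lemma single_eq_prod_mvar:
  "single m c = single 0 c * (\<Prod>i\<in>UNIV. mvar i ^ lookup m i)"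
  for m :: "'n::finite \<Rightarrow>\<^sub>0 nat" and c :: "'k::field"
  by (simp add: mvar_power prod_single_one sum_single_exponents mult_single)

lemma mpoly_induct [case_names const mvar add mult]:
  fixes f :: "('n::finite, 'k::field) mpoly"
  assumes const: "\<And>c. P (single 0 c)" and mvar: "\<And>i. P (mvar i)"
    and add: "\<And>f g. P f \<Longrightarrow> P g \<Longrightarrow> P (f + g)"
    and mult: "\<And>f g. P f \<Longrightarrow> P g \<Longrightarrow> P (f * g)"
  shows "P f"
proof -
  have 1: "P 1" using const[of 1] by simp
  have pow: "P (mvar i ^ k)" for i k
    by (induction k) (auto intro: 1 mvar mult)
  have "P (\<Prod>i\<in>A. mvar i ^ lookup m i)" for A m
    by (induction A rule: infinite_finite_induct) (auto intro: 1 pow mult)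
  then have "P (single m c)" for m c
    by (subst single_eq_prod_mvar) (intro mult const)
  then show ?thesis
    by (induction f rule: poly_mapping_single_add_induct) (auto intro: add)
qed

section \<open>Linear forms and linear changes of coordinates\<close>

definition lform :: "('n::finite \<Rightarrow> 'k::field) \<Rightarrow> ('n, 'k) mpoly" where
  "lform c = (\<Sum>i\<in>UNIV. single 0 (c i) * mvar i)"

lemma linear_change_eq: "linear_change g = mpoly_eval (single 0) (\<lambda>j. lform (\<lambda>i. g $ i $ j))"
  by (simp add: linear_change_def lform_def)

lemma linear_change_simps:
  shows linear_change_add: "linear_change g (p + q) = linear_change g p + linear_change g q"
    and linear_change_mult: "linear_change g (p * q) = linear_change g p * linear_change g q"
    and linear_change_0: "linear_change g 0 = 0"
    and linear_change_power: "linear_change g (p ^ k) = linear_change g p ^ k"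
    and linear_change_const: "linear_change g (single 0 c) = single 0 c"
    and linear_change_sum: "linear_change g (sum F U) = (\<Sum>x\<in>U. linear_change g (F x))"
    and linear_change_mvar: "linear_change g (mvar j) = lform (\<lambda>i. g $ i $ j)"
  unfolding linear_change_eq
  by (simp_all add: const_hom.mpoly_eval_add const_hom.mpoly_eval_mult const_hom.mpoly_eval_0
      const_hom.mpoly_eval_power
      const_hom.mpoly_eval_const const_hom.mpoly_eval_sum const_hom.mpoly_eval_mvar)

lemma linear_change_lform: "linear_change g (lform c) = lform (\<lambda>i. \<Sum>j\<in>UNIV. c j * g $ i $ j)"
proof -
  have "linear_change g (lform c) = (\<Sum>j\<in>UNIV. \<Sum>i\<in>UNIV. single 0 (c j * g $ i $ j) * mvar i)"
    by (simp add: lform_def[of c] linear_change_simps lform_def[of "\<lambda>i. g $ i $ _"] sum_distrib_left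
        mult.assoc[symmetric] mult_single)
  also have "\<dots> = (\<Sum>i\<in>UNIV. \<Sum>j\<in>UNIV. single 0 (c j * g $ i $ j) * mvar i)"
    by (rule sum.swap)
  also have "\<dots> = lform (\<lambda>i. \<Sum>j\<in>UNIV. c j * g $ i $ j)"
    unfolding lform_def sum_distrib_right[symmetric]
    by (intro sum.cong arg_cong2[where f = "(*)"] refl poly_mapping_eqI)
       (auto simp: lookup_sum lookup_single when_def)
  finally show ?thesis .
qed

text \<open>Column \<open>j\<close> of a matrix holds the image of variable \<open>j\<close>; hence
  substitutions compose in the order of the matrix product.\<close>

lemma linear_change_compose: "linear_change e (linear_change g f) = linear_change (e ** g) f"
proof (induction f rule: mpoly_induct)
  case (mvar j)
  show ?case
    by (simp add: linear_change_mvar linear_change_lform matrix_matrix_mult_def mult.commute)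
qed (simp_all add: linear_change_simps)

lemma mvar_eq_lform: "mvar i = lform (\<lambda>j. if j = i then 1 else 0)"
proof -
  have "lform (\<lambda>j. if j = i then 1 else 0) = (\<Sum>j\<in>UNIV. if j = i then mvar i else (0 :: ('a, 'b) mpoly))"
    unfolding lform_def by (intro sum.cong) auto
  then show ?thesis by simp
qed

lemma linear_change_id: "linear_change (mat 1) f = f"
proof (induction f rule: mpoly_induct)
  case (mvar j)
  show ?case
    by (simp add: linear_change_mvar mat_def) (simp add: mvar_eq_lform)
qed (simp_all add: linear_change_simps)

lemma linear_change_inverse:
  assumes "g ** g' = mat 1"
  shows "linear_change g (linear_change g' f) = f"
  by (simp add: linear_change_compose assms linear_change_id)

lemma is_ideal_linear_change:
  assumes "is_ideal I" "invertible g"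
  shows "is_ideal (linear_change g ` I)"
proof -
  obtain g' where g': "g ** g' = mat 1"
    using assms(2) by (auto simp: invertible_def)
  show ?thesis
    unfolding is_ideal_def
  proof (intro conjI ballI allI)
    show "0 \<in> linear_change g ` I"
      using ideal_0[OF assms(1)] linear_change_0 by (metis image_eqI)
    fix f assume "f \<in> linear_change g ` I"
    then obtain a where a: "f = linear_change g a" "a \<in> I" by blast
    show "f + k \<in> linear_change g ` I" if "k \<in> linear_change g ` I" for k
      using that a ideal_add[OF assms(1)] by (auto simp flip: linear_change_add)
    fix h
    have "h * f = linear_change g (linear_change g' h * a)"
      by (simp add: linear_change_mult linear_change_inverse[OF g'] a)
    then show "h * f \<in> linear_change g ` I"
      using a ideal_mult[OF assms(1)] by blast
  qed
qed

section \<open>Degrees\<close>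

lemma mdeg_0 [simp]: "mdeg 0 = 0"
  by (simp add: mdeg_def)

lemma mdeg_add: "mdeg (a + b) = mdeg a + mdeg b"
  by (simp add: mdeg_def lookup_add sum.distrib)

lemma mdeg_single [simp]: "mdeg (single i k) = k"
  by (simp add: mdeg_def lookup_single when_def)

lemma mdeg_ge_lookup: "lookup m i \<le> mdeg m"
  by (auto simp: mdeg_def intro: member_le_sum)

lemma finite_mdeg_le: "finite {m :: 'n::finite \<Rightarrow>\<^sub>0 nat. mdeg m \<le> d}"
proof (rule finite_imageD)
  have "lookup ` {m :: 'n \<Rightarrow>\<^sub>0 nat. mdeg m \<le> d} \<subseteq> (\<Pi>\<^sub>E i\<in>UNIV. {..d})"
    by (auto intro: order_trans[OF mdeg_ge_lookup])
  then show "finite (lookup ` {m :: 'n \<Rightarrow>\<^sub>0 nat. mdeg m \<le> d})"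
    by (rule finite_subset) (intro finite_PiE; simp)
  show "inj_on lookup {m :: 'n \<Rightarrow>\<^sub>0 nat. mdeg m \<le> d}"
    by (rule inj_onI) (simp add: poly_mapping_eqI)
qed

definition homog :: "nat \<Rightarrow> ('n::finite, 'k::field) mpoly \<Rightarrow> bool" where
  "homog d f \<longleftrightarrow> (\<forall>m\<in>keys f. mdeg m = d)"

lemma homog_0 [simp]: "homog d 0"
  by (simp add: homog_def)

lemma homog_single: "homog (mdeg m) (single m c)"
  by (auto simp: homog_def)

lemma homog_const: "homog 0 (single 0 c)"
  by (auto simp: homog_def)

lemma homog_1: "homog 0 1"
  by (auto simp: homog_def)

lemma homog_add: "homog d f \<Longrightarrow> homog d g \<Longrightarrow> homog d (f + g)"
  unfolding homog_def using keys_add by fastforce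

lemma homog_uminus: "homog d f \<Longrightarrow> homog d (- f)"
  by (simp add: homog_def)

lemma homog_diff: "homog d f \<Longrightarrow> homog d g \<Longrightarrow> homog d (f - g)"
  using homog_add[of d f "- g"] by (simp add: homog_uminus)

lemma homog_sum: "(\<And>x. x \<in> A \<Longrightarrow> homog d (F x)) \<Longrightarrow> homog d (sum F A)"
  by (induction A rule: infinite_finite_induct) (auto intro: homog_add)

lemma homog_mult: "homog d f \<Longrightarrow> homog e g \<Longrightarrow> homog (d + e) (f * g)"
  unfolding homog_def using keys_mult[of f g] by (force simp: mdeg_add)

lemma homog_power: "homog d f \<Longrightarrow> homog (k * d) (f ^ k)"
  by (induction k) (auto intro: homog_1 homog_mult)

lemma homog_prod: "(\<And>x. x \<in> A \<Longrightarrow> homog (e x) (F x)) \<Longrightarrow> homog (\<Sum>x\<in>A. e x) (\<Prod>x\<in>A. F x)"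
  by (induction A rule: infinite_finite_induct) (auto intro: homog_1 homog_mult)

lemma homog_mvar: "homog 1 (mvar i)"
  by (auto simp: homog_def mvar_def)

lemma homog_scale: "homog d f \<Longrightarrow> homog d (single 0 c * f)"
  using homog_mult[OF homog_const, of d f c] by simp

lemma homog_lform: "homog 1 (lform c)"
  unfolding lform_def by (intro homog_sum homog_scale homog_mvar)

lemma lookup_homog_comp: "lookup (homog_comp d f) m = (lookup f m when mdeg m = d)"
proof -
  have "lookup (homog_comp d f) m = (\<Sum>m'\<in>{m \<in> keys f. mdeg m = d}. if m' = m then lookup f m else 0)"
    by (auto simp: homog_comp_def lookup_sum lookup_single when_def intro!: sum.cong)
  also have "\<dots> = (lookup f m when mdeg m = d)"
    by (auto simp: sum.delta when_def in_keys_iff)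
  finally show ?thesis .
qed

lemma homog_comp_add: "homog_comp d (f + g) = homog_comp d f + homog_comp d g"
  by (rule poly_mapping_eqI) (simp add: lookup_homog_comp lookup_add when_def)

lemma homog_homog_comp: "homog d (homog_comp d f)"
  by (auto simp: homog_def in_keys_iff lookup_homog_comp when_def split: if_splits)

lemma homog_comp_homog: "homog e f \<Longrightarrow> homog_comp d f = (if d = e then f else 0)"
  by (rule poly_mapping_eqI) (auto simp: lookup_homog_comp homog_def when_def in_keys_iff)

lemma homog_comp_mult:
  assumes "homog e z"
  shows "homog_comp (e + d) (z * f) = z * homog_comp d f"
proof (induction f rule: poly_mapping_single_add_induct)
  case (single m c)
  show ?case
    by (simp add: homog_comp_homog[OF homog_mult[OF assms homog_single]] homog_comp_homog[OF homog_single])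
qed (simp add: homog_comp_add algebra_simps)

lemma homog_comp_mult_low:
  assumes "homog e z" "d < e"
  shows "homog_comp d (z * f) = 0"
proof (induction f rule: poly_mapping_single_add_induct)
  case (single m c)
  show ?case
    using assms(2) by (simp add: homog_comp_homog[OF homog_mult[OF assms(1) homog_single]])
qed (simp add: homog_comp_add algebra_simps)

lemma homogeneous_ideal_iff:
  "homogeneous_ideal J \<longleftrightarrow> is_ideal J \<and> (\<forall>f\<in>J. \<forall>d. homog_comp d f \<in> J)"
  by (simp add: homogeneous_ideal_def ideal_poly_ring_iff)

lemma homogeneous_imp_ideal: "homogeneous_ideal J \<Longrightarrow> is_ideal J"
  by (simp add: homogeneous_ideal_iff)

lemma homogeneous_ideal_plus:
  assumes J: "homogeneous_ideal J" and z: "homog 1 z"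
  shows "homogeneous_ideal (ideal_plus J z)"
proof -
  have J': "is_ideal J" using J by (rule homogeneous_imp_ideal)
  have "homog_comp d f \<in> ideal_plus J z" if f: "f \<in> ideal_plus J z" for f d
  proof -
    obtain a h where ah: "f = a + z * h" "a \<in> J"
      using f unfolding ideal_plus_def by blast
    have "homog_comp d a \<in> J" using J ah by (simp add: homogeneous_ideal_iff)
    moreover have "\<exists>k. homog_comp d (z * h) = z * k"
    proof (cases d)
      case 0
      then show ?thesis using homog_comp_mult_low[OF z, of d h] by (auto intro: exI[of _ 0])
    next
      case (Suc e)
      then show ?thesis using homog_comp_mult[OF z, of e h] by auto
    qed
    ultimately obtain k where "homog_comp d f = homog_comp d a + z * k" "homog_comp d a \<in> J"
      by (auto simp: ah(1) homog_comp_add)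
    then show ?thesis unfolding ideal_plus_def by blast
  qed
  then show ?thesis
    by (simp add: homogeneous_ideal_iff is_ideal_ideal_plus J')
qed

lemma homogeneous_colon:
  assumes J: "homogeneous_ideal J" and z: "homog e z"
  shows "homogeneous_ideal (colon J z)"
  using J by (auto simp: homogeneous_ideal_iff is_ideal_colon) (auto simp: colon_def simp flip: homog_comp_mult[OF z])

lemma linear_change_single:
  "linear_change g (single m c) =
     single 0 c * (\<Prod>i\<in>UNIV. lform (\<lambda>l. g $ l $ i) ^ lookup m i)"
  by (simp add: linear_change_eq const_hom.mpoly_eval_single)

lemma homog_linear_change_single: "homog (mdeg m) (linear_change g (single m c))"
proof -
  have "homog (\<Sum>i\<in>UNIV. lookup m i * 1) (\<Prod>i\<in>UNIV. lform (\<lambda>l. g $ l $ i) ^ lookup m i)"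
    by (intro homog_prod homog_power homog_lform)
  then show ?thesis
    by (auto simp: linear_change_single mdeg_def intro!: homog_scale)
qed

lemma homog_comp_linear_change: "homog_comp d (linear_change g f) = linear_change g (homog_comp d f)"
proof (induction f rule: poly_mapping_single_add_induct)
  case (single m c)
  show ?case
    by (simp add: homog_comp_homog[OF homog_linear_change_single] homog_comp_homog[OF homog_single]
        linear_change_0)
qed (simp add: homog_comp_add linear_change_add)

lemma homog_linear_change: "homog d f \<Longrightarrow> homog d (linear_change g f)"
  by (metis homog_comp_homog homog_comp_linear_change homog_homog_comp)

lemma homogeneous_ideal_linear_change:
  assumes "homogeneous_ideal I" "invertible g"
  shows "homogeneous_ideal (linear_change g ` I)"
  using assms by (auto simp: homogeneous_ideal_iff is_ideal_linear_change homog_comp_linear_change)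

section \<open>The reverse lexicographic order\<close>

lemma revlex_less_irrefl: "\<not> revlex_less a a"
  by (simp add: revlex_less_def)

lemma revlex_less_trans:
  assumes "revlex_less a b" "revlex_less b c" shows "revlex_less a c"
proof (cases "mdeg a < mdeg b \<or> mdeg b < mdeg c")
  case True
  then show ?thesis using assms by (auto simp: revlex_less_def)
next
  case False
  then obtain i j where i: "mdeg a = mdeg b" "lookup a i > lookup b i" "\<forall>k>i. lookup a k = lookup b k"
    and j: "mdeg b = mdeg c" "lookup b j > lookup c j" "\<forall>k>j. lookup b k = lookup c k"
    using assms by (auto simp: revlex_less_def)
  have "lookup a (max i j) > lookup c (max i j)" "\<forall>k>max i j. lookup a k = lookup c k"
    using i(2,3) j(2,3) by (cases i j rule: linorder_cases; auto simp: max_def)+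
  then show ?thesis using i(1) j(1) by (auto simp: revlex_less_def)
qed

lemma revlex_less_linear: "a = b \<or> revlex_less a b \<or> revlex_less b a"
proof (cases "mdeg a = mdeg b \<and> a \<noteq> b")
  case True
  define D where "D = {i. lookup a i \<noteq> lookup b i}"
  have D: "finite D" "D \<noteq> {}"
    using True poly_mapping_eqI[of a b] by (auto simp: D_def)
  have "lookup a (Max D) \<noteq> lookup b (Max D)"
    using Max_in[OF D] by (simp add: D_def)
  moreover have "k \<notin> D" if "k > Max D" for k
  proof
    assume "k \<in> D"
    then have "\<not> Max D < k" by (intro leD Max_ge[OF D(1)])
    then show False using that by (rule notE)
  qed
  then have "\<forall>k>Max D. lookup a k = lookup b k"
    unfolding D_def by blast
  ultimately have "if lookup a (Max D) < lookup b (Max D) then revlex_less b a else revlex_less a b"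
    using True by (auto simp: revlex_less_def intro: exI[of _ "Max D"])
  then show ?thesis by (auto split: if_splits)
qed (auto simp: revlex_less_def)

lemma revlex_less_asym: "revlex_less a b \<Longrightarrow> \<not> revlex_less b a"
  using revlex_less_trans revlex_less_irrefl by blast

lemma revlex_less_add: "revlex_less (c + a) (c + b) \<longleftrightarrow> revlex_less a b"
  by (simp add: revlex_less_def mdeg_add lookup_add)

text \<open>The order compares degrees before anything else, and each degree has finitely many
  monomials, so the number of smaller monomials is a measure.\<close>

lemma wf_revlex_less: "wf {(a, b :: 'n::{finite,linorder} \<Rightarrow>\<^sub>0 nat). revlex_less a b}"
proof (rule wf_subset[OF wf_measure[of "\<lambda>b. card {a. revlex_less a b}"]], clarsimp)
  fix a b :: "'n \<Rightarrow>\<^sub>0 nat"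
  assume ab: "revlex_less a b"
  show "card {c. revlex_less c a} < card {c. revlex_less c b}"
  proof (rule psubset_card_mono)
    show "finite {c. revlex_less c b}"
      by (rule finite_subset[OF _ finite_mdeg_le[of "mdeg b"]]) (auto simp: revlex_less_def)
    show "{c. revlex_less c a} \<subset> {c. revlex_less c b}"
      using ab revlex_less_trans revlex_less_irrefl by blast
  qed
qed

lemma finite_revlex_max:
  assumes "finite A" "A \<noteq> {}"
  shows "\<exists>m\<in>A. \<forall>m'\<in>A. m' \<noteq> m \<longrightarrow> revlex_less m' m"
  using assms
proof (induction A rule: finite_ne_induct)
  case (insert a A)
  then obtain m where m: "m \<in> A" "\<forall>m'\<in>A. m' \<noteq> m \<longrightarrow> revlex_less m' m" by blast
  show ?case
  proof (cases "revlex_less m a")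
    case True
    have "revlex_less m' a" if "m' \<in> A" for m'
      using that m True revlex_less_trans[of m' m a] by (cases "m' = m") auto
    then show ?thesis by auto
  next
    case False
    then show ?thesis
      using m revlex_less_linear[of m a] by (intro bexI[of _ m]) auto
  qed
qed auto

section \<open>Leading monomials, reduction, and initial ideals\<close>

lemma lead_mon_eqI:
  assumes "m \<in> keys f" "\<And>m'. m' \<in> keys f \<Longrightarrow> m' \<noteq> m \<Longrightarrow> revlex_less m' m"
  shows "lead_mon f = m"
  unfolding lead_mon_def
proof (rule the_equality)
  show "n = m" if n: "n \<in> keys f \<and> (\<forall>m'\<in>keys f. m' \<noteq> n \<longrightarrow> revlex_less m' n)" for n
    using assms(1) assms(2)[of n] n revlex_less_asym[of n m] by metis
qed (use assms in blast)

lemma lead_mon_props: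
  assumes "f \<noteq> 0"
  shows lead_mon_in_keys: "lead_mon f \<in> keys f"
    and lead_mon_greatest: "m \<in> keys f \<Longrightarrow> m \<noteq> lead_mon f \<Longrightarrow> revlex_less m (lead_mon f)"
proof -
  obtain m where m: "m \<in> keys f" "\<forall>m'\<in>keys f. m' \<noteq> m \<longrightarrow> revlex_less m' m"
    using finite_revlex_max[of "keys f"] assms by auto
  then have "lead_mon f = m" by (auto intro: lead_mon_eqI)
  with m show "lead_mon f \<in> keys f"
    "m' \<in> keys f \<Longrightarrow> m' \<noteq> lead_mon f \<Longrightarrow> revlex_less m' (lead_mon f)" for m'
    by auto
qed

lemma lead_mon_homog: "homog d f \<Longrightarrow> f \<noteq> 0 \<Longrightarrow> mdeg (lead_mon f) = d"
  using lead_mon_in_keys by (auto simp: homog_def)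

lemma single_mult_nonzero:
  fixes f :: "'a::cancel_comm_monoid_add \<Rightarrow>\<^sub>0 'b::field"
  shows "c \<noteq> 0 \<Longrightarrow> f \<noteq> 0 \<Longrightarrow> single e c * f \<noteq> 0"
  using keys_single_mult[of c e f] by (metis image_is_empty keys_eq_empty)

lemma lead_mon_single_mult:
  assumes "c \<noteq> 0" "f \<noteq> 0"
  shows "lead_mon (single e c * f) = e + lead_mon f"
  by (rule lead_mon_eqI)
     (use lead_mon_props[OF assms(2)] in \<open>auto simp: keys_single_mult[OF assms(1)] revlex_less_add\<close>)

lemma lead_mon_mvar_mult:
  "f \<noteq> 0 \<Longrightarrow> lead_mon (mvar i * f) = single i 1 + lead_mon f"
  unfolding mvar_def by (rule lead_mon_single_mult) auto

lemma mvar_mult_nonzero: "f \<noteq> 0 \<Longrightarrow> mvar i * f \<noteq> 0"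
  unfolding mvar_def by (rule single_mult_nonzero) auto

text \<open>Reduction of \<open>f\<close> by elements of \<open>W\<close> lowers the leading
  monomial until 0 is reached. The closure conditions are merely linear, so that the lemma applies
  to ideals and to single graded pieces of ideals.\<close>

lemma subspace_subset_of_lead_mon:
  assumes V: "\<And>f g c. f \<in> V \<Longrightarrow> g \<in> W \<Longrightarrow> f - single 0 c * g \<in> V"
    and W: "0 \<in> W" "\<And>f g. f \<in> W \<Longrightarrow> g \<in> W \<Longrightarrow> f + g \<in> W" "\<And>f c. f \<in> W \<Longrightarrow> single 0 c * f \<in> W"
    and lead: "\<And>f. f \<in> V \<Longrightarrow> f \<noteq> 0 \<Longrightarrow> \<exists>g\<in>W. g \<noteq> 0 \<and> lead_mon g = lead_mon f"
  shows "V \<subseteq> W"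
proof
  fix f assume "f \<in> V"
  then show "f \<in> W"
  proof (induction "lead_mon f" arbitrary: f rule: wf_induct_rule[OF wf_revlex_less])
    case (1 f)
    show ?case
    proof (cases "f = 0")
      case False
      obtain g where g: "g \<in> W" "g \<noteq> 0" "lead_mon g = lead_mon f"
        using lead[OF 1(2) False] by blast
      \<comment> \<open>The quotient of the leading coefficients, so that the leading terms cancel
        in \<open>h\<close>.\<close>
      define c where "c = lookup f (lead_mon f) / lookup g (lead_mon f)"
      define h where "h = f - single 0 c * g"
      have hV: "h \<in> V" unfolding h_def using 1(2) g(1) by (rule V)
      have c: "c \<noteq> 0"
        using lead_mon_in_keys[OF False] lead_mon_in_keys[OF g(2)] g(3) by (simp add: c_def in_keys_iff)
      have lk: "lookup h m = lookup f m - c * lookup g m" for m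
        using lookup_single_mult[of 0 c g m] by (simp add: h_def lookup_minus)
      have "h \<in> W"
      proof (cases "h = 0")
        case False
        note h0 = this
        have "lookup h (lead_mon f) = 0"
          using lead_mon_in_keys[OF g(2)] g(3) by (simp add: lk c_def in_keys_iff)
        moreover have lh: "lead_mon h \<in> keys h" using h0 by (rule lead_mon_in_keys)
        ultimately have ne: "lead_mon h \<noteq> lead_mon f" by (auto simp: in_keys_iff)
        have "lead_mon h \<in> keys f \<or> lead_mon h \<in> keys g"
          using lh lk[of "lead_mon h"] by (auto simp: in_keys_iff)
        then have "revlex_less (lead_mon h) (lead_mon f)"
          using lead_mon_greatest[OF \<open>f \<noteq> 0\<close>] lead_mon_greatest[OF g(2)] g(3) ne by auto
        then show ?thesis using 1(1) hV by blast
      qed (simp add: W)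
      moreover have "f = h + single 0 c * g" by (simp add: h_def)
      ultimately show ?thesis using W(2,3) g(1) by metis
    qed (simp add: W)
  qed
qed

definition leads :: "('n::{finite,linorder}, 'k::field) mpoly set \<Rightarrow> ('n \<Rightarrow>\<^sub>0 nat) set" where
  "leads I = {lead_mon f | f. f \<in> I \<and> f \<noteq> 0}"

text \<open>A linear span, which is an ideal as soon as \<open>M\<close> is closed under adding
  exponents. Initial ideals in this form have membership tests on \<open>keys\<close> alone.\<close>

definition monomial_span :: "('n \<Rightarrow>\<^sub>0 nat) set \<Rightarrow> ('n::finite, 'k::field) mpoly set" where
  "monomial_span M = {f. keys f \<subseteq> M}"

lemma leads_add: "is_ideal I \<Longrightarrow> m \<in> leads I \<Longrightarrow> e + m \<in> leads I"
  unfolding leads_def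
  using lead_mon_single_mult[of 1] single_mult_nonzero[of 1] ideal_mult[of I]
  by (smt (verit, best) mem_Collect_eq zero_neq_one)

lemma is_ideal_monomial_span:
  assumes "\<And>e m. m \<in> M \<Longrightarrow> e + m \<in> M"
  shows "is_ideal (monomial_span M)"
  unfolding is_ideal_def monomial_span_def
proof (intro conjI ballI allI)
  fix f h :: "('a, 'b) mpoly" assume f: "f \<in> {f. keys f \<subseteq> M}"
  show "f + g \<in> {f. keys f \<subseteq> M}" if "g \<in> {f. keys f \<subseteq> M}" for g
    using f that keys_add[of f g] by auto
  show "h * f \<in> {f. keys f \<subseteq> M}"
    using f keys_mult[of h f] assms by (auto simp: subset_iff)
qed auto

lemma homogeneous_monomial_span:
  assumes "\<And>e m. m \<in> M \<Longrightarrow> e + m \<in> M"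
  shows "homogeneous_ideal (monomial_span M)"
  using is_ideal_monomial_span[OF assms]
  by (auto simp: homogeneous_ideal_iff monomial_span_def in_keys_iff lookup_homog_comp when_def subset_iff
      split: if_splits)

lemma initial_ideal_eq:
  fixes I :: "('n::{finite,linorder}, 'k::field) mpoly set"
  assumes "is_ideal I"
  shows "initial_ideal I = monomial_span (leads I)"
proof -
  have id: "is_ideal (monomial_span (leads I) :: ('n, 'k) mpoly set)"
    by (intro is_ideal_monomial_span leads_add assms)
  define S :: "('n, 'k) mpoly set" where "S = {single (lead_mon f) 1 | f. f \<in> I \<and> f \<noteq> 0}"
  have 1: "S \<subseteq> monomial_span (leads I)"
    by (auto simp: S_def monomial_span_def leads_def)
  have 2: "monomial_span (leads I) \<subseteq> J" if J: "is_ideal J" "S \<subseteq> J" for J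
  proof
    fix f :: "('n, 'k) mpoly" assume f: "f \<in> monomial_span (leads I)"
    have "single m (lookup f m) \<in> J" if m: "m \<in> keys f" for m
    proof -
      have "single m 1 \<in> J"
        using f m J(2) by (auto simp: monomial_span_def leads_def S_def subset_iff)
      then have "single 0 (lookup f m) * single m 1 \<in> J" by (rule ideal_mult[OF J(1)])
      then show ?thesis by (simp add: mult_single)
    qed
    then have "(\<Sum>m\<in>keys f. single m (lookup f m)) \<in> J" by (rule ideal_sum[OF J(1)])
    then show "f \<in> J" by (simp add: poly_mapping_sum_single)
  qed
  show ?thesis
    unfolding initial_ideal_def genideal_def S_def[symmetric] ideal_poly_ring_iff
    using id 1 2 by blast
qed

lemma lead_mon_single: "c \<noteq> 0 \<Longrightarrow> lead_mon (single m c) = m"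
  by (rule lead_mon_eqI) auto

lemma leads_monomial_span: "leads (monomial_span M :: ('n::{finite,linorder}, 'k::field) mpoly set) = M"
proof
  show "leads (monomial_span M :: ('n, 'k) mpoly set) \<subseteq> M"
    using lead_mon_in_keys by (fastforce simp: leads_def monomial_span_def)
  show "M \<subseteq> leads (monomial_span M :: ('n, 'k) mpoly set)"
  proof
    fix m assume "m \<in> M"
    then have "single m 1 \<in> (monomial_span M :: ('n, 'k) mpoly set)" "single m 1 \<noteq> (0 :: ('n, 'k) mpoly)"
      "lead_mon (single m 1 :: ('n, 'k) mpoly) = m"
      by (auto simp: monomial_span_def lead_mon_single) (metis keys_single keys_zero insert_not_empty zero_neq_one)
    then show "m \<in> leads (monomial_span M :: ('n, 'k) mpoly set)"
      unfolding leads_def by (metis (mono_tags, lifting) mem_Collect_eq)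
  qed
qed

lemma leads_mono: "I \<subseteq> J \<Longrightarrow> leads I \<subseteq> leads J"
  by (auto simp: leads_def)

lemma homog_lead_ex:
  assumes J: "homogeneous_ideal J" and m: "m \<in> leads J"
  shows "\<exists>f\<in>J. homog (mdeg m) f \<and> f \<noteq> 0 \<and> lead_mon f = m"
proof -
  obtain f where f: "f \<in> J" "f \<noteq> 0" "lead_mon f = m"
    using m by (auto simp: leads_def)
  define h where "h = homog_comp (mdeg m) f"
  have "m \<in> keys h"
    using lead_mon_in_keys[OF f(2)] f(3) by (simp add: h_def in_keys_iff lookup_homog_comp)
  moreover have "keys h \<subseteq> keys f"
    by (auto simp: h_def in_keys_iff lookup_homog_comp when_def split: if_splits)
  ultimately have "lead_mon h = m" "h \<noteq> 0"
    using lead_mon_greatest[OF f(2)] f(3) by (auto intro!: lead_mon_eqI)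
  then show ?thesis
    using J f(1) by (auto simp: h_def homogeneous_ideal_iff homog_homog_comp intro!: bexI[of _ h])
qed

lemma ideal_subset_of_leads:
  assumes "is_ideal J" "is_ideal K" "J \<subseteq> K" "leads K \<subseteq> leads J"
  shows "K \<subseteq> J"
proof (rule subspace_subset_of_lead_mon)
  fix f assume "f \<in> K" "f \<noteq> 0"
  then show "\<exists>g\<in>J. g \<noteq> 0 \<and> lead_mon g = lead_mon f"
    using assms(4) by (force simp: leads_def)
qed (use assms in \<open>auto simp: is_idealD subset_iff\<close>)

text \<open>The reduction stays inside degree \<open>d\<close>. Read contrapositively: an element of
  degree \<open>d\<close> in \<open>K\<close> but not in \<open>J\<close> is witnessed by a leading
  monomial of degree \<open>d\<close>.\<close>

lemma homog_part_subset_of_leads: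
  assumes J: "homogeneous_ideal J" and K: "homogeneous_ideal K" and "J \<subseteq> K"
    and leads: "\<And>m. m \<in> leads K \<Longrightarrow> mdeg m = d \<Longrightarrow> m \<in> leads J"
    and f: "f \<in> K" "homog d f"
  shows "f \<in> J"
proof -
  have JK: "is_ideal J" "is_ideal K"
    using J K by (auto simp: homogeneous_ideal_iff)
  have "{f \<in> K. homog d f} \<subseteq> {f \<in> J. homog d f}"
  proof (rule subspace_subset_of_lead_mon)
    fix f assume f: "f \<in> {f \<in> K. homog d f}" "f \<noteq> 0"
    then have "lead_mon f \<in> leads K" "mdeg (lead_mon f) = d"
      by (auto simp: leads_def lead_mon_homog)
    then show "\<exists>g\<in>{f \<in> J. homog d f}. g \<noteq> 0 \<and> lead_mon g = lead_mon f"
      using homog_lead_ex[OF J] leads by fastforce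
  qed (use JK assms(3) in \<open>auto simp: is_idealD subset_iff homog_add homog_scale homog_diff\<close>)
  then show ?thesis using f by blast
qed

section \<open>The Noetherian property\<close>

text \<open>There is a monotone subsequence, and a decreasing sequence of naturals is constant from
  its minimum on.\<close>

lemma nat_incseq_subseq:
  fixes s :: "nat \<Rightarrow> nat"
  shows "\<exists>r :: nat \<Rightarrow> nat. strict_mono r \<and> (\<forall>i j. i \<le> j \<longrightarrow> s (r i) \<le> s (r j))"
proof -
  obtain r :: "nat \<Rightarrow> nat" where r: "strict_mono r" "monoseq (s \<circ> r)"
    using seq_monosub[of s] by (auto simp: comp_def)
  show ?thesis
  proof (cases "incseq (s \<circ> r)")
    case True
    then show ?thesis using r(1) by (intro exI[of _ r]) (auto simp: incseq_def)
  next
    case False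
    then have dec: "\<And>i j. i \<le> j \<Longrightarrow> s (r j) \<le> s (r i)"
      using r(2) by (auto simp: monoseq_def incseq_def)
    obtain N where N: "\<And>i. s (r N) \<le> s (r i)"
      using ex_has_least_nat[of "\<lambda>_. True" 0 "s \<circ> r"] by auto
    have "s (r (N + i)) = s (r N)" for i
      using dec[of N "N + i"] N[of "N + i"] by auto
    then show ?thesis
      using r(1) by (intro exI[of _ "\<lambda>i. r (N + i)"]) (auto simp: strict_mono_def)
  qed
qed

lemma dickson_sequence:
  fixes f :: "nat \<Rightarrow> 'a \<Rightarrow> nat"
  assumes "finite A"
  shows "\<exists>r :: nat \<Rightarrow> nat. strict_mono r \<and> (\<forall>a\<in>A. \<forall>i j. i \<le> j \<longrightarrow> f (r i) a \<le> f (r j) a)"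
  using assms
proof (induction A)
  case empty
  show ?case by (intro exI[of _ id]) (auto simp: strict_mono_def)
next
  case (insert a A)
  then obtain r :: "nat \<Rightarrow> nat" where r: "strict_mono r" "\<forall>a\<in>A. \<forall>i j. i \<le> j \<longrightarrow> f (r i) a \<le> f (r j) a" by blast
  obtain q :: "nat \<Rightarrow> nat" where q: "strict_mono q" "\<forall>i j. i \<le> j \<longrightarrow> f (r (q i)) a \<le> f (r (q j)) a"
    using nat_incseq_subseq[of "\<lambda>i. f (r i) a"] by auto
  show ?case
    using r q strict_mono_leD[OF q(1)] by (intro exI[of _ "\<lambda>i. r (q i)"]) (auto simp: strict_mono_def)
qed

lemma monomial_le_imp_add:
  fixes a b :: "'n::finite \<Rightarrow>\<^sub>0 nat"
  assumes "\<And>i. lookup a i \<le> lookup b i"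
  shows "(b - a) + a = b"
  by (rule poly_mapping_eqI) (simp add: lookup_add lookup_minus assms)

text \<open>The minimal elements of \<open>M\<close> generate. They form an antichain, and
  \<open>dickson_sequence\<close> finds two comparable members in any infinite sequence of
  them.\<close>

lemma dickson_finite_generators:
  fixes M :: "('n::finite \<Rightarrow>\<^sub>0 nat) set"
  shows "\<exists>G. finite G \<and> G \<subseteq> M \<and> (\<forall>m\<in>M. \<exists>g\<in>G. \<exists>e. m = e + g)"
proof -
  define G where "G = {m \<in> M. \<forall>g\<in>M. (\<forall>i. lookup g i \<le> lookup m i) \<longrightarrow> g = m}"
  have "finite G"
  proof (rule ccontr)
    assume "infinite G"
    then obtain s :: "nat \<Rightarrow> 'n \<Rightarrow>\<^sub>0 nat" where s: "inj s" "range s \<subseteq> G"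
      using infinite_countable_subset by blast
    obtain r :: "nat \<Rightarrow> nat" where r: "strict_mono r" "\<forall>a. \<forall>i j. i \<le> j \<longrightarrow> lookup (s (r i)) a \<le> lookup (s (r j)) a"
      using dickson_sequence[of UNIV "\<lambda>i. lookup (s i)"] by auto
    have "s (r 0) = s (r 1)"
      using s(2) r(2) by (auto simp: G_def image_subset_iff)
    then have "r 0 = r 1" using s(1) by (auto dest: injD)
    then show False using r(1) by (metis strict_mono_eq zero_neq_one)
  qed
  moreover have "\<exists>g\<in>G. \<exists>e. m = e + g" if "m \<in> M" for m
    using that
  proof (induction "mdeg m" arbitrary: m rule: less_induct)
    case less
    show ?case
    proof (cases "m \<in> G")
      case True
      then show ?thesis by (metis add_0)
    next
      case False
      then obtain g where g: "g \<in> M" "\<And>i. lookup g i \<le> lookup m i" "g \<noteq> m"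
        using less.prems by (auto simp: G_def)
      have eq: "(m - g) + g = m" using g(2) by (rule monomial_le_imp_add)
      have "m - g \<noteq> 0" using eq g(3) by auto
      then obtain i where "lookup (m - g) i \<noteq> 0"
        by (metis poly_mapping_eqI lookup_zero)
      then have "mdeg (m - g) \<noteq> 0"
        using mdeg_ge_lookup[of "m - g" i] by linarith
      then have "mdeg g < mdeg m" using mdeg_add[of "m - g" g] eq by simp
      then obtain g' e where "g' \<in> G" "g = e + g'" using less.hyps g(1) by blast
      then show ?thesis using eq by (metis add.assoc)
    qed
  qed
  ultimately show ?thesis by (intro exI[of _ G]) (auto simp: G_def)
qed

lemma is_ideal_Union_chain:
  assumes "\<And>k. is_ideal (J k)" "\<And>i j :: nat. i \<le> j \<Longrightarrow> J i \<subseteq> J j"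
  shows "is_ideal (\<Union>k. J k)"
  unfolding is_ideal_def
proof (intro conjI ballI allI)
  fix f h assume "f \<in> (\<Union>k. J k)"
  then obtain k where k: "f \<in> J k" by blast
  show "h * f \<in> (\<Union>k. J k)" using ideal_mult[OF assms(1) k] by blast
  show "f + g \<in> (\<Union>k. J k)" if g: "g \<in> (\<Union>k. J k)" for g
  proof -
    obtain l where l: "g \<in> J l" using g by blast
    have "f \<in> J (max k l)" "g \<in> J (max k l)"
      using k l assms(2)[of k "max k l"] assms(2)[of l "max k l"] by auto
    then show ?thesis using ideal_add[OF assms(1)] by blast
  qed
qed (use ideal_0[OF assms(1)] in blast)

text \<open>The ascending chain condition, oriented so that larger ideals come first in inductions.
  The leading monomials of the union of a chain have finitely many generators, all present at some
  stage \<open>k\<close>; from equal leading monomials it follows that the union is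
  \<open>J k\<close>.\<close>

lemma wf_ideals:
  "wf {(K, J :: ('n::{finite,linorder}, 'k::field) mpoly set). is_ideal J \<and> is_ideal K \<and> J \<subset> K}"
  unfolding wf_iff_no_infinite_down_chain
proof (intro notI, elim exE)
  fix J :: "nat \<Rightarrow> ('n, 'k) mpoly set"
  assume "\<forall>i. (J (Suc i), J i) \<in> {(K, J). is_ideal J \<and> is_ideal K \<and> J \<subset> K}"
  then have id: "\<And>i. is_ideal (J i)" and less: "\<And>i. J i \<subset> J (Suc i)" by auto
  have mono: "J i \<subseteq> J j" if "i \<le> j" for i j
    by (rule lift_Suc_mono_le[OF _ that]) (use less in blast)
  have U: "is_ideal (\<Union>k. J k)" by (rule is_ideal_Union_chain[OF id mono])
  obtain G where G: "finite G" "G \<subseteq> leads (\<Union>k. J k)" "\<forall>m\<in>leads (\<Union>k. J k). \<exists>g\<in>G. \<exists>e. m = e + g"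
    using dickson_finite_generators[of "leads (\<Union>k. J k)"] by blast
  have "\<exists>k. G \<subseteq> leads (J k)"
    using G(1,2)
  proof (induction G)
    case (insert g G)
    then obtain k l where "G \<subseteq> leads (J k)" "g \<in> leads (J l)"
      by (auto simp: leads_def)
    then show ?case
      using leads_mono[OF mono[of k "max k l"]] leads_mono[OF mono[of l "max k l"]]
      by (intro exI[of _ "max k l"]) auto
  qed auto
  then obtain k where k: "G \<subseteq> leads (J k)" by blast
  have "leads (\<Union>k. J k) \<subseteq> leads (J k)"
  proof
    fix m assume "m \<in> leads (\<Union>k. J k)"
    then obtain g e where "g \<in> G" "m = e + g" using G(3) by meson
    then show "m \<in> leads (J k)" using k leads_add[OF id] by (metis subsetD)
  qed
  then have "(\<Union>k. J k) \<subseteq> J k"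
    by (intro ideal_subset_of_leads[OF id U]) auto
  then show False using less[of k] by blast
qed

section \<open>Filter-regular elements\<close>

text \<open>The kernel of multiplication by \<open>z\<close> on \<open>R/J\<close> is torsion with
  respect to the ideal of the variables; the exponent may depend on \<open>f\<close> and on the
  variable.\<close>

definition filter_regular :: "('n::finite, 'k::field) mpoly \<Rightarrow> ('n, 'k) mpoly set \<Rightarrow> bool" where
  "filter_regular z J \<longleftrightarrow> (\<forall>f. z * f \<in> J \<longrightarrow> (\<forall>j. \<exists>N. mvar j ^ N * f \<in> J))"

text \<open>
  The ideals in \<open>P\<close> are the primes other than the irrelevant ideal in a prime filtration of \<open>R/J\<close>,
  constructed by Noetherian induction on \<open>J\<close>.
\<close>

lemma filter_regular_if_avoids:
  fixes J :: "('n::{finite,linorder}, 'k::field) mpoly set"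
  assumes "is_ideal J"
  shows "\<exists>P. finite P \<and> (\<forall>Q\<in>P. is_ideal Q \<and> J \<subseteq> Q \<and> \<not> range mvar \<subseteq> Q) \<and>
    (\<forall>z. z \<notin> \<Union>P \<longrightarrow> filter_regular z J)"
  using assms
proof (induction J rule: wf_induct_rule[OF wf_ideals])
  case (1 J)
  note J = 1(2)
  show ?case
  proof (cases "J = UNIV")
    case True
    then show ?thesis by (intro exI[of _ "{}"]) (auto simp: filter_regular_def)
  next
    case False
    then obtain f0 where "f0 \<notin> J" by auto
    \<comment> \<open>A maximal member among the colon ideals of elements outside \<open>J\<close>,
      that is, an associated prime of \<open>R/J\<close>.\<close>
    then obtain Q where Q: "Q \<in> {colon J f | f. f \<notin> J}"
      and max: "\<And>K. (K, Q) \<in> {(K, J). is_ideal J \<and> is_ideal K \<and> J \<subset> K} \<Longrightarrow> K \<notin> {colon J f | f. f \<notin> J}"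
      using wfE_min[OF wf_ideals, of "colon J f0" "{colon J f | f. f \<notin> J}"] by blast
    obtain f where f: "f \<notin> J" "Q = colon J f" using Q by blast
    have Qid: "is_ideal Q" by (simp add: f(2) is_ideal_colon J)
    \<comment> \<open>For \<open>b\<close> outside \<open>Q\<close>, the colon ideal of
      \<open>f * b\<close> is again a candidate and contains \<open>Q\<close>, so by maximality it
      equals \<open>Q\<close>.\<close>
    have prime: "a \<in> Q" if "a * b \<in> Q" "b \<notin> Q" for a b
    proof -
      have "Q \<subseteq> colon J (f * b)"
        using J by (auto simp: f(2) colon_def ideal_mult' simp flip: mult.assoc)
          (metis ideal_mult' mult.assoc mult.commute)
      moreover have "f * b \<notin> J" using that(2) by (simp add: f(2) colon_def)
      ultimately have "colon J (f * b) = Q"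
        using max[of "colon J (f * b)"] Qid is_ideal_colon[OF J] by blast
      moreover have "a \<in> colon J (f * b)"
        using that(1) by (simp add: f(2) colon_def algebra_simps)
      ultimately show ?thesis by simp
    qed
    \<comment> \<open>\<open>J1/J\<close> is isomorphic to \<open>R/Q\<close>: this is the lowest
      layer of the filtration, and the induction hypothesis handles \<open>R/J1\<close>.\<close>
    define J1 where "J1 = ideal_plus J f"
    have J1: "is_ideal J1" "J \<subset> J1"
      using J f(1) ideal_plus_superset[of J f] ideal_plus_gen[OF J, of f 1]
      by (auto simp: J1_def is_ideal_ideal_plus)
    obtain P1 where P1: "finite P1" "\<forall>Q\<in>P1. is_ideal Q \<and> J1 \<subseteq> Q \<and> \<not> range mvar \<subseteq> Q"
      "\<forall>z. z \<notin> \<Union>P1 \<longrightarrow> filter_regular z J1"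
      using 1(1)[of J1] J J1 by blast
    define P where "P = (if range mvar \<subseteq> Q then P1 else insert Q P1)"
    have "filter_regular z J" if z: "z \<notin> \<Union>P" for z
      unfolding filter_regular_def
    proof (intro allI impI)
      fix h j assume zh: "z * h \<in> J"
      have "z \<notin> \<Union>P1" using z by (auto simp: P_def split: if_splits)
      then have "filter_regular z J1" using P1(3) by blast
      moreover have "z * h \<in> J1" using zh J1(2) by blast
      ultimately obtain N where "mvar j ^ N * h \<in> J1"
        unfolding filter_regular_def by blast
      then obtain a c where y: "mvar j ^ N * h = a + f * c" "a \<in> J"
        unfolding J1_def ideal_plus_def by blast
      have "z * (f * c) = mvar j ^ N * (z * h) - z * a"
        using arg_cong[OF y(1), of "(*) z"] by (simp add: algebra_simps)
      then have "z * (f * c) \<in> J"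
        using ideal_diff[OF J ideal_mult[OF J zh] ideal_mult[OF J y(2)]] by metis
      then have zc: "z * c \<in> Q"
        by (simp add: f(2) colon_def mult.left_commute)
      show "\<exists>N. mvar j ^ N * h \<in> J"
      \<comment> \<open>If \<open>Q\<close> contains all variables, then \<open>mvar j\<close> kills
        the layer \<open>J1/J\<close> and one further factor suffices. Otherwise \<open>z\<close>
        avoids the prime \<open>Q\<close>, so \<open>c\<close> lies in \<open>Q\<close> and
        \<open>f * c\<close> in \<open>J\<close>.\<close>
      proof (cases "range mvar \<subseteq> Q")
        case True
        then have fx: "f * mvar j \<in> J" by (auto simp: f(2) colon_def)
        have "mvar j * a + c * (f * mvar j) \<in> J"
          by (rule ideal_add[OF J ideal_mult[OF J y(2)] ideal_mult[OF J fx]])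
        moreover have "mvar j ^ Suc N * h = mvar j * a + c * (f * mvar j)"
          using arg_cong[OF y(1), of "(*) (mvar j)"] by (simp add: algebra_simps)
        ultimately show ?thesis by metis
      next
        case False
        then have "z \<notin> Q" using z by (auto simp: P_def)
        then have "c \<in> Q" using prime[of c z] zc by (auto simp: mult.commute)
        then have "a + f * c \<in> J" using y(2) J by (auto simp: f(2) colon_def intro: ideal_add)
        then show ?thesis using y(1) by metis
      qed
    qed
    moreover have "finite P" "\<forall>Q\<in>P. is_ideal Q \<and> J \<subseteq> Q \<and> \<not> range mvar \<subseteq> Q"
      using P1(1,2) J1 Qid colon_superset[OF J, of f] psubset_imp_subset[OF J1(2)]
      by (auto simp: P_def f(2) simp del: psubset_eq)
    ultimately show ?thesis by blast
  qed
qed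

lemma homog_of_nat: "homog 0 (of_nat k :: ('n::finite, 'k::field) mpoly)"
  by (metis homog_const single_of_nat)

text \<open>In the expansion of \<open>(a + b) ^ (M + N)\<close> every term contains
  \<open>a ^ M\<close> or \<open>b ^ N\<close>. The family \<open>T\<close> is indexed by degree
  because for cohomology classes the condition to be a boundary involves the internal degree; an
  ideal is the case of a constant family.\<close>

lemma lform_power_in_graded:
  fixes T :: "nat \<Rightarrow> ('n::finite, 'k::field) mpoly set"
  assumes add: "\<And>d f g. f \<in> T d \<Longrightarrow> g \<in> T d \<Longrightarrow> f + g \<in> T d"
    and mult: "\<And>d e f h. f \<in> T d \<Longrightarrow> homog e h \<Longrightarrow> h * f \<in> T (e + d)"
    and zero: "\<And>d. 0 \<in> T d"
    and vars: "\<And>j. \<exists>N. mvar j ^ N \<in> T N"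
  shows "\<exists>M. lform c ^ M \<in> T M"
proof -
  have scale: "single 0 (a :: 'k) ^ n = single 0 (a ^ n)" for a :: 'k and n
    by (induction n) (auto simp: mult_single)
  have "\<exists>M. (\<Sum>i\<in>A. single 0 (c i) * mvar i) ^ M \<in> T M" if "finite A" for A
    using that
  proof (induction A)
    case empty
    show ?case using zero by (intro exI[of _ 1]) simp
  next
    case (insert i A)
    define a where "a = (\<Sum>i\<in>A. single 0 (c i) * mvar i)"
    define b where "b = single 0 (c i) * mvar i"
    obtain M where M: "a ^ M \<in> T M" using insert by (auto simp: a_def)
    obtain N0 where N0: "mvar i ^ N0 \<in> T N0" using vars by blast
    define N where "N = N0"
    have homs: "homog 1 a" "homog 1 b"
      unfolding a_def b_def by (intro homog_sum homog_scale homog_mvar)+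
    have N: "b ^ N \<in> T N"
      using mult[OF N0 homog_const, of "c i ^ N"]
      by (simp add: b_def N_def power_mult_distrib scale)
    have 1: "of_nat k * a ^ p * b ^ q \<in> T (M + N)" if pq: "p + q = M + N" for k p q
    proof (cases "p \<ge> M")
      case True
      then have "homog (p - M + q) (of_nat k * a ^ (p - M) * b ^ q)"
        using homog_mult[OF homog_mult[OF homog_of_nat[of k] homog_power[OF homs(1), of "p - M"]]
            homog_power[OF homs(2), of q]]
        by simp
      from mult[OF M this] have "of_nat k * a ^ (p - M) * b ^ q * a ^ M \<in> T (M + N)"
        using pq True by (simp add: algebra_simps)
      moreover have "of_nat k * a ^ (p - M) * b ^ q * a ^ M = of_nat k * a ^ p * b ^ q"
        using True power_add[of a "p - M" M] by (simp add: mult.commute mult.left_commute)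
      ultimately show ?thesis by simp
    next
      case False
      then have qN: "q \<ge> N" using pq by simp
      then have "homog (p + (q - N)) (of_nat k * a ^ p * b ^ (q - N))"
        using homog_mult[OF homog_mult[OF homog_of_nat[of k] homog_power[OF homs(1), of p]]
            homog_power[OF homs(2), of "q - N"]]
        by simp
      from mult[OF N this] have "of_nat k * a ^ p * b ^ (q - N) * b ^ N \<in> T (M + N)"
        using pq qN by (simp add: algebra_simps)
      moreover have "of_nat k * a ^ p * b ^ (q - N) * b ^ N = of_nat k * a ^ p * b ^ q"
        using qN by (simp add: algebra_simps flip: power_add)
      ultimately show ?thesis by simp
    qed
    have 2: "(\<Sum>x\<in>B. F x) \<in> T d" if "\<And>x. x \<in> B \<Longrightarrow> F x \<in> T d" for B :: "nat set" and F d
      using that by (induction B rule: infinite_finite_induct) (auto intro: zero add)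
    have "(a + b) ^ (M + N) \<in> T (M + N)"
      unfolding binomial_ring by (intro 2 1) auto
    moreover have "(\<Sum>i\<in>insert i A. single 0 (c i) * mvar i) = a + b"
      using insert by (simp add: a_def b_def add.commute)
    ultimately show ?case by metis
  qed
  from this[of UNIV] show ?thesis by (simp add: lform_def)
qed

text \<open>The definition tests torsion with the variables, which are not preserved by
  \<open>g\<close>. Pulled back, \<open>mvar j\<close> becomes a linear form, and a power of any
  linear form annihilates once powers of all variables do.\<close>

lemma filter_regular_linear_change:
  assumes J: "is_ideal J" and g: "invertible g" and z: "filter_regular z J"
  shows "filter_regular (linear_change g z) (linear_change g ` J)"
  unfolding filter_regular_def
proof (intro allI impI)
  fix f j assume f: "linear_change g z * f \<in> linear_change g ` J"
  obtain g' where g': "g ** g' = mat 1" "g' ** g = mat 1"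
    using g by (auto simp: invertible_def)
  define f' where "f' = linear_change g' f"
  have ff': "f = linear_change g f'"
    by (simp add: f'_def linear_change_inverse[OF g'(1)])
  have "linear_change g' (linear_change g z * f) \<in> J"
    using f by (auto simp: linear_change_inverse[OF g'(2)])
  then have "z * f' \<in> J"
    by (simp add: linear_change_mult linear_change_inverse[OF g'(2)] f'_def)
  then have N: "\<exists>N. mvar i ^ N \<in> colon J f'" for i
    using z by (auto simp: filter_regular_def colon_def mult.commute)
  have col: "is_ideal (colon J f')" by (rule is_ideal_colon[OF J])
  have "\<exists>M. lform (\<lambda>i. g' $ i $ j) ^ M \<in> colon J f'"
    by (rule lform_power_in_graded[where T = "\<lambda>_. colon J f'"]) (use N col is_idealD[OF col] in auto)
  then obtain M where "linear_change g' (mvar j) ^ M * f' \<in> J"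
    by (auto simp: colon_def linear_change_mvar mult.commute)
  then have "linear_change g (linear_change g' (mvar j) ^ M * f') \<in> linear_change g ` J" by blast
  then show "\<exists>N. mvar j ^ N * f \<in> linear_change g ` J"
    by (auto simp: linear_change_mult linear_change_power linear_change_inverse[OF g'(1)] ff')
qed

section \<open>Polynomial functions on matrices\<close>

text \<open>The regular functions on the affine space of matrices.\<close>

definition polyfun :: "('k::field ^ 'n::finite ^ 'n \<Rightarrow> 'k) \<Rightarrow> bool" where
  "polyfun F \<longleftrightarrow> (\<exists>p :: ('n \<times> 'n, 'k) mpoly. F = (\<lambda>g. mpoly_eval (\<lambda>c. c) (\<lambda>(i, j). g $ i $ j) p))"

lemma polyfun_const: "polyfun (\<lambda>_. c)"
  unfolding polyfun_def by (rule exI[of _ "single 0 c"]) (simp add: id_hom.mpoly_eval_const)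

lemma polyfun_entry: "polyfun (\<lambda>g. g $ i $ j)"
  unfolding polyfun_def by (rule exI[of _ "mvar (i, j)"]) (simp add: id_hom.mpoly_eval_mvar)

lemma polyfun_add: "polyfun F \<Longrightarrow> polyfun G \<Longrightarrow> polyfun (\<lambda>g. F g + G g)"
  unfolding polyfun_def by (elim exE) (simp flip: id_hom.mpoly_eval_add, blast)

lemma polyfun_mult: "polyfun F \<Longrightarrow> polyfun G \<Longrightarrow> polyfun (\<lambda>g. F g * G g)"
  unfolding polyfun_def by (elim exE) (simp flip: id_hom.mpoly_eval_mult, blast)

lemma polyfun_sum: "(\<And>x. x \<in> A \<Longrightarrow> polyfun (F x)) \<Longrightarrow> polyfun (\<lambda>g. \<Sum>x\<in>A. F x g)"
  by (induction A rule: infinite_finite_induct) (auto intro: polyfun_const polyfun_add)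

lemma polyfun_prod: "(\<And>x. x \<in> A \<Longrightarrow> polyfun (F x)) \<Longrightarrow> polyfun (\<lambda>g. \<Prod>x\<in>A. F x g)"
  by (induction A rule: infinite_finite_induct) (auto intro: polyfun_const polyfun_mult)

lemma polyfun_det: "polyfun det"
proof -
  have "polyfun (\<lambda>g :: 'a ^ 'b ^ 'b. \<Sum>p\<in>{p. p permutes UNIV}. of_int (sign p) * (\<Prod>i\<in>UNIV. g $ i $ p i))"
    by (intro polyfun_sum polyfun_mult polyfun_const polyfun_prod polyfun_entry)
  then show ?thesis by (simp add: det_def[abs_def])
qed

lemma polyfun_line:
  assumes "polyfun F"
  shows "\<exists>q. \<forall>t. F (\<chi> i j. a $ i $ j + t * b $ i $ j) = poly q t"
proof -
  obtain p where p: "F = (\<lambda>g. mpoly_eval (\<lambda>c. c) (\<lambda>(i, j). g $ i $ j) p)"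
    using assms unfolding polyfun_def by blast
  have "\<exists>q. \<forall>t. mpoly_eval (\<lambda>c. c) (\<lambda>(i, j). a $ i $ j + t * b $ i $ j) p = poly q t"
  proof (induction p rule: mpoly_induct)
    case (const c)
    show ?case by (intro exI[of _ "[:c:]"]) (simp add: id_hom.mpoly_eval_const)
  next
    case (mvar ij)
    show ?case by (intro exI[of _ "[:a $ fst ij $ snd ij, b $ fst ij $ snd ij:]"])
        (simp add: id_hom.mpoly_eval_mvar case_prod_beta)
  next
    case (add f g)
    then show ?case by (elim exE) (simp add: id_hom.mpoly_eval_add flip: poly_add, blast)
  next
    case (mult f g)
    then show ?case by (elim exE) (simp add: id_hom.mpoly_eval_mult flip: poly_mult, blast)
  qed
  then show ?thesis by (simp add: p case_prod_unfold)
qed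

text \<open>Irreducibility of affine space over an infinite field: on the line through
  \<open>a\<close> and \<open>b\<close>, \<open>F\<close> is nonzero at \<open>t = 0\<close> and
  \<open>G\<close> at \<open>t = 1\<close>, and each restricts to a univariate polynomial with
  finitely many roots.\<close>

lemma polyfun_common_nonzero:
  fixes F G :: "'k::field ^ 'n::finite ^ 'n \<Rightarrow> 'k"
  assumes inf: "infinite (UNIV :: 'k set)"
    and F: "polyfun F" "F a \<noteq> 0" and G: "polyfun G" "G b \<noteq> 0"
  shows "\<exists>g. F g \<noteq> 0 \<and> G g \<noteq> 0"
proof -
  define c where "c = (\<chi> i j. b $ i $ j - a $ i $ j)"
  obtain p q where p: "\<forall>t. F (\<chi> i j. a $ i $ j + t * c $ i $ j) = poly p t"
    and q: "\<forall>t. G (\<chi> i j. a $ i $ j + t * c $ i $ j) = poly q t"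
    using polyfun_line[OF F(1)] polyfun_line[OF G(1)] by metis
  have ab: "(\<chi> i j. a $ i $ j + 0 * c $ i $ j) = a" "(\<chi> i j. a $ i $ j + 1 * c $ i $ j) = b"
    by (simp_all add: vec_eq_iff c_def)
  have "poly p 0 \<noteq> 0" "poly q 1 \<noteq> 0"
    using p[rule_format, of 0] q[rule_format, of 1] F G unfolding ab by auto
  then have "p \<noteq> 0" "q \<noteq> 0" by auto
  then have "finite ({t. poly p t = 0} \<union> {t. poly q t = 0})"
    by (simp add: poly_roots_finite)
  then obtain t where "t \<notin> {t. poly p t = 0} \<union> {t. poly q t = 0}"
    using inf ex_new_if_finite by blast
  then show ?thesis using p q by (metis (mono_tags, lifting) UnI1 UnI2 mem_Collect_eq)
qed

lemma polyfun_prod_nonzero: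
  fixes F :: "'a \<Rightarrow> 'k::field ^ 'n::finite ^ 'n \<Rightarrow> 'k"
  assumes inf: "infinite (UNIV :: 'k set)" and "finite A"
    and "\<And>x. x \<in> A \<Longrightarrow> polyfun (F x) \<and> (\<exists>g. F x g \<noteq> 0)"
  shows "\<exists>g. (\<Prod>x\<in>A. F x g) \<noteq> 0"
  using assms(2,3)
proof (induction A)
  case (insert x A)
  then obtain a b where "(\<Prod>x\<in>A. F x a) \<noteq> 0" "F x b \<noteq> 0" "polyfun (F x)" by blast
  moreover have "polyfun (\<lambda>g. \<Prod>x\<in>A. F x g)" using insert by (auto intro: polyfun_prod)
  ultimately obtain g where "(\<Prod>x\<in>A. F x g) \<noteq> 0" "F x g \<noteq> 0"
    using polyfun_common_nonzero[OF inf, of "\<lambda>g. \<Prod>x\<in>A. F x g" a "F x" b] by blast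
  then show ?case using insert by auto
qed auto

lemma zariski_open_GL_polyfun:
  assumes "polyfun F"
  shows "zariski_open_GL {g. invertible g \<and> F g \<noteq> 0}"
proof -
  obtain p where p: "F = (\<lambda>g. mpoly_eval (\<lambda>c. c) (\<lambda>(i, j). g $ i $ j) p)"
    using assms unfolding polyfun_def by blast
  show ?thesis unfolding zariski_open_GL_def by (rule exI[of _ "{p}"]) (simp add: p)
qed

lemma zariski_open_GL_basic:
  assumes "zariski_open_GL U" "g \<in> U"
  shows "\<exists>F. polyfun F \<and> F g \<noteq> 0 \<and> (\<forall>h. invertible h \<and> F h \<noteq> 0 \<longrightarrow> h \<in> U)"
proof -
  obtain P :: "('b \<times> 'b, 'a) mpoly set" where P:
    "U = {g. invertible g \<and> (\<exists>p\<in>P. mpoly_eval (\<lambda>c. c) (\<lambda>(i, j). g $ i $ j) p \<noteq> 0)}"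
    using assms(1) unfolding zariski_open_GL_def by blast
  then obtain p where p: "p \<in> P" "mpoly_eval (\<lambda>c. c) (\<lambda>(i, j). g $ i $ j) p \<noteq> 0"
    using assms(2) by blast
  then show ?thesis
    unfolding P by (intro exI[of _ "\<lambda>g. mpoly_eval (\<lambda>c. c) (\<lambda>(i, j). g $ i $ j) p"])
      (auto simp: polyfun_def)
qed

section \<open>Existence of the generic initial ideal\<close>

text \<open>The inductive form ensures that the coefficients are polynomial in \<open>g\<close> and
  also that one finite set of monomials carries the whole family.\<close>

inductive polyfam :: "('k::field ^ 'n::finite ^ 'n \<Rightarrow> ('n, 'k) mpoly) \<Rightarrow> bool" where
  single: "polyfun c \<Longrightarrow> polyfam (\<lambda>g. single m (c g))"
| add: "polyfam \<phi> \<Longrightarrow> polyfam \<psi> \<Longrightarrow> polyfam (\<lambda>g. \<phi> g + \<psi> g)"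

lemma polyfam_const: "polyfam (\<lambda>_. f)"
  by (induction f rule: poly_mapping_single_add_induct) (auto intro: polyfam.intros polyfun_const)

lemma polyfam_mult:
  assumes "polyfam \<phi>" "polyfam \<psi>"
  shows "polyfam (\<lambda>g. \<phi> g * \<psi> g)"
  using assms(1)
proof induction
  case (single c m)
  show ?case
    using assms(2)
  proof induction
    case (single c' m')
    then show ?case
      using \<open>polyfun c\<close> by (simp add: mult_single polyfam.single polyfun_mult)
  qed (auto simp: algebra_simps intro: polyfam.add)
qed (auto simp: algebra_simps intro: polyfam.add)

lemma polyfam_sum: "(\<And>x. x \<in> A \<Longrightarrow> polyfam (\<phi> x)) \<Longrightarrow> polyfam (\<lambda>g. \<Sum>x\<in>A. \<phi> x g)"
  by (induction A rule: infinite_finite_induct) (auto intro: polyfam_const polyfam.add)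

lemma polyfam_uminus: "polyfam \<phi> \<Longrightarrow> polyfam (\<lambda>g. - \<phi> g)"
  using polyfam_mult[OF polyfam_const[of "-1"], of \<phi>] by simp

lemma polyfam_diff: "polyfam \<phi> \<Longrightarrow> polyfam \<psi> \<Longrightarrow> polyfam (\<lambda>g. \<phi> g - \<psi> g)"
  using polyfam.add[OF _ polyfam_uminus, of \<phi> \<psi>] by simp

lemma polyfam_linear_change: "polyfam (\<lambda>g. linear_change g f)"
proof (induction f rule: mpoly_induct)
  case (mvar j)
  show ?case
    unfolding linear_change_mvar lform_def
    by (intro polyfam_sum polyfam_mult polyfam.single polyfun_entry polyfam_const)
qed (simp_all add: linear_change_simps polyfam_const polyfam.add polyfam_mult)

lemma polyfun_lookup: "polyfam \<phi> \<Longrightarrow> polyfun (\<lambda>g. lookup (\<phi> g) m)"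
proof (induction rule: polyfam.induct)
  case (single c m')
  then show ?case by (cases "m' = m") (auto simp: lookup_single polyfun_const)
qed (auto simp: lookup_add intro: polyfun_add)

lemma polyfam_finite_keys: "polyfam \<phi> \<Longrightarrow> \<exists>A. finite A \<and> (\<forall>g. keys (\<phi> g) \<subseteq> A)"
proof (induction rule: polyfam.induct)
  case (single c m)
  show ?case by (intro exI[of _ "{m}"]) auto
next
  case (add \<phi> \<psi>)
  then obtain A B where "finite A" "\<forall>g. keys (\<phi> g) \<subseteq> A" "finite B" "\<forall>g. keys (\<psi> g) \<subseteq> B" by blast
  then show ?case
    using keys_add[of "\<phi> _" "\<psi> _"] by (intro exI[of _ "A \<union> B"]) blast
qed

text \<open>These families play the role of the elements of the transformed ideal over the field of
  rational functions in the matrix entries, with denominators cleared.\<close>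

definition ideal_fam where
  "ideal_fam I \<phi> \<longleftrightarrow> polyfam \<phi> \<and> (\<forall>g. invertible g \<longrightarrow> \<phi> g \<in> linear_change g ` I)"

text \<open>The quantifiers range over all matrices, singular ones included, so that the statement
  is about the coefficients as functions.\<close>

definition generic_lead where
  "generic_lead \<phi> m \<longleftrightarrow> (\<exists>g. lookup (\<phi> g) m \<noteq> 0) \<and> (\<forall>m' g. revlex_less m m' \<longrightarrow> lookup (\<phi> g) m' = 0)"

definition generic_leads :: "('n::{finite,linorder}, 'k::field) mpoly set \<Rightarrow> ('n \<Rightarrow>\<^sub>0 nat) set" where
  "generic_leads I = {m. \<exists>\<phi>. ideal_fam I \<phi> \<and> generic_lead \<phi> m}"

lemma generic_lead_ex:
  assumes "polyfam \<phi>" "\<phi> g \<noteq> 0"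
  shows "\<exists>m. generic_lead \<phi> m"
proof -
  obtain A where A: "finite A" "\<forall>g. keys (\<phi> g) \<subseteq> A"
    using polyfam_finite_keys[OF assms(1)] by blast
  define K where "K = (\<Union>g. keys (\<phi> g))"
  have "finite K" using A by (auto simp: K_def intro: finite_subset)
  moreover have "K \<noteq> {}" using assms(2) by (auto simp: K_def)
  ultimately obtain m where m: "m \<in> K" "\<forall>m'\<in>K. m' \<noteq> m \<longrightarrow> revlex_less m' m"
    using finite_revlex_max by blast
  have "lookup (\<phi> h) m' = 0" if "revlex_less m m'" for h m'
  proof (rule ccontr)
    assume "lookup (\<phi> h) m' \<noteq> 0"
    then have "m' \<in> K" by (auto simp: K_def in_keys_iff)
    then show False using m(2) that revlex_less_asym revlex_less_irrefl by metis
  qed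
  then have "generic_lead \<phi> m"
    using m(1) by (auto simp: generic_lead_def K_def in_keys_iff)
  then show ?thesis ..
qed

lemma ideal_fam_mult:
  assumes "is_ideal I" "ideal_fam I \<phi>" "polyfam c"
  shows "ideal_fam I (\<lambda>g. c g * \<phi> g)"
  using assms is_ideal_linear_change[OF assms(1)]
  by (auto simp: ideal_fam_def polyfam_mult ideal_mult)

lemma ideal_fam_diff:
  assumes "is_ideal I" "ideal_fam I \<phi>" "ideal_fam I \<psi>"
  shows "ideal_fam I (\<lambda>g. \<phi> g - \<psi> g)"
  using assms is_ideal_linear_change[OF assms(1)]
  by (auto simp: ideal_fam_def polyfam_diff ideal_diff)

lemma lookup_scale: "lookup (single 0 c * f) m = c * lookup f m"
  for f :: "'a::cancel_comm_monoid_add \<Rightarrow>\<^sub>0 'b::comm_ring_1"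
  using lookup_single_mult[of 0 c f m] by simp

text \<open>
  Where the generic leading coefficient of a family \<open>\<phi>\<close> vanishes at \<open>g\<close>, pseudo-division by the family
  \<open>\<psi> m\<close> with the same generic leading monomial \<open>m\<close> lowers the latter and only rescales \<open>\<phi> g\<close>.
\<close>

lemma leads_eq_generic_leads:
  fixes I :: "('n::{finite,linorder}, 'k::field) mpoly set"
  assumes I: "is_ideal I" and g: "invertible g"
    and \<psi>: "\<And>m. m \<in> generic_leads I \<Longrightarrow> ideal_fam I (\<psi> m) \<and> generic_lead (\<psi> m) m \<and> lookup (\<psi> m g) m \<noteq> 0"
  shows "leads (linear_change g ` I) = generic_leads I"
proof
  show "generic_leads I \<subseteq> leads (linear_change g ` I)"
  proof
    fix m assume "m \<in> generic_leads I"
    note m = \<psi>[OF this]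
    have "\<psi> m g \<noteq> 0" using m by auto
    moreover have "lead_mon (\<psi> m g) = m"
    proof (rule lead_mon_eqI)
      show "m \<in> keys (\<psi> m g)" using m by (simp add: in_keys_iff)
      show "revlex_less m' m" if "m' \<in> keys (\<psi> m g)" "m' \<noteq> m" for m'
        using m that revlex_less_linear[of m m'] by (auto simp: generic_lead_def in_keys_iff)
    qed
    moreover have "\<psi> m g \<in> linear_change g ` I"
      using m g by (auto simp: ideal_fam_def)
    ultimately show "m \<in> leads (linear_change g ` I)"
      unfolding leads_def by force
  qed
  have *: "lead_mon (\<phi> g) \<in> generic_leads I" if "ideal_fam I \<phi>" "generic_lead \<phi> m" "\<phi> g \<noteq> 0" for \<phi> m
    using that
  proof (induction m arbitrary: \<phi> rule: wf_induct_rule[OF wf_revlex_less])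
    case (1 m)
    have m: "m \<in> generic_leads I" using 1 by (auto simp: generic_leads_def)
    note \<psi>m = \<psi>[OF m]
    show ?case
    proof (cases "lookup (\<phi> g) m = 0")
      case False
      have "lead_mon (\<phi> g) = m"
      proof (rule lead_mon_eqI)
        show "m \<in> keys (\<phi> g)" using False by (simp add: in_keys_iff)
        show "revlex_less m' m" if "m' \<in> keys (\<phi> g)" "m' \<noteq> m" for m'
          using 1(3) that revlex_less_linear[of m m'] by (auto simp: generic_lead_def in_keys_iff)
      qed
      then show ?thesis using m by simp
    next
      case True
      define \<theta> where "\<theta> = (\<lambda>g. single 0 (lookup (\<psi> m g) m) * \<phi> g - single 0 (lookup (\<phi> g) m) * \<psi> m g)"
      have \<theta>: "ideal_fam I \<theta>"
        unfolding \<theta>_def using 1(2) \<psi>m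
        by (intro ideal_fam_diff ideal_fam_mult I polyfam.single polyfun_lookup) (auto simp: ideal_fam_def)
      have \<theta>g: "\<theta> g = single 0 (lookup (\<psi> m g) m) * \<phi> g"
        using True by (simp add: \<theta>_def)
      have nz: "\<theta> g \<noteq> 0"
        unfolding \<theta>g by (rule single_mult_nonzero) (use \<psi>m 1(4) in auto)
      obtain m' where m': "generic_lead \<theta> m'"
        using generic_lead_ex[of \<theta> g] \<theta> nz by (auto simp: ideal_fam_def)
      have 0: "lookup (\<theta> h) w = 0" if "w = m \<or> revlex_less m w" for h w
        using that 1(3) \<psi>m by (auto simp: \<theta>_def lookup_minus lookup_scale generic_lead_def)
      have "revlex_less m' m"
        using m' 0[of m'] revlex_less_linear[of m m'] by (auto simp: generic_lead_def)
      then have "lead_mon (\<theta> g) \<in> generic_leads I"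
        using 1(1) \<theta> m' nz by blast
      moreover have "lead_mon (\<theta> g) = lead_mon (\<phi> g)"
        unfolding \<theta>g using \<psi>m 1(4) by (subst lead_mon_single_mult) auto
      ultimately show ?thesis by simp
    qed
  qed
  show "leads (linear_change g ` I) \<subseteq> generic_leads I"
  proof
    fix m assume "m \<in> leads (linear_change g ` I)"
    then obtain f where f: "f \<in> I" "linear_change g f \<noteq> 0" "m = lead_mon (linear_change g f)"
      by (auto simp: leads_def)
    have fam: "ideal_fam I (\<lambda>g. linear_change g f)"
      using f(1) by (auto simp: ideal_fam_def polyfam_linear_change)
    obtain w where "generic_lead (\<lambda>g. linear_change g f) w"
      using generic_lead_ex[OF polyfam_linear_change f(2)] by blast
    from *[OF fam this f(2)] show "m \<in> generic_leads I" by (simp add: f(3))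
  qed
qed

text \<open>Monomial multiples of a family keep its leading coefficient. Finitely many nonvanishing
  conditions thus control infinitely many monomials.\<close>

lemma generic_leads_add:
  assumes I: "is_ideal I" and \<phi>: "ideal_fam I \<phi>" "generic_lead \<phi> m"
  shows "ideal_fam I (\<lambda>g. single e 1 * \<phi> g)" "generic_lead (\<lambda>g. single e 1 * \<phi> g) (e + m)"
proof -
  show "ideal_fam I (\<lambda>g. single e 1 * \<phi> g)"
    by (intro ideal_fam_mult I \<phi> polyfam_const)
  show "generic_lead (\<lambda>g. single e 1 * \<phi> g) (e + m)"
    unfolding generic_lead_def
  proof (intro conjI allI impI)
    show "\<exists>g. lookup (single e 1 * \<phi> g) (e + m) \<noteq> 0"
      using \<phi>(2) by (simp add: generic_lead_def lookup_single_mult)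
    fix m' g assume less: "revlex_less (e + m) m'"
    show "lookup (single e 1 * \<phi> g) m' = 0"
    proof (rule ccontr)
      assume "lookup (single e 1 * \<phi> g) m' \<noteq> 0"
      then have "m' \<in> (+) e ` keys (\<phi> g)"
        by (subst keys_single_mult[symmetric, of 1]) (simp_all add: in_keys_iff)
      then show False
        using less \<phi>(2) by (auto simp: revlex_less_add generic_lead_def in_keys_iff)
    qed
  qed
qed

text \<open>\<open>F\<close> is the product of the leading coefficients of families chosen for
  finitely many generating monomials; where it is nonzero, monomial multiples of these families
  supply the \<open>\<psi>\<close> of \<open>leads_eq_generic_leads\<close>.\<close>

lemma generic_leads_open:
  fixes I :: "('n::{finite,linorder}, 'k::field) mpoly set"
  assumes inf: "infinite (UNIV :: 'k set)" and I: "is_ideal I"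
  shows "\<exists>F. polyfun F \<and> (\<exists>g. F g \<noteq> 0) \<and>
    (\<forall>g. invertible g \<and> F g \<noteq> 0 \<longrightarrow> leads (linear_change g ` I) = generic_leads I)"
proof -
  obtain G where G: "finite G" "G \<subseteq> generic_leads I" "\<forall>m\<in>generic_leads I. \<exists>w\<in>G. \<exists>e. m = e + w"
    using dickson_finite_generators[of "generic_leads I"] by blast
  have "\<forall>m\<in>G. \<exists>\<phi>. ideal_fam I \<phi> \<and> generic_lead \<phi> m"
    using G(2) by (auto simp: generic_leads_def)
  then obtain \<phi> where \<phi>: "\<And>m. m \<in> G \<Longrightarrow> ideal_fam I (\<phi> m) \<and> generic_lead (\<phi> m) m"
    by metis
  obtain w e where we: "\<And>m. m \<in> generic_leads I \<Longrightarrow> w m \<in> G \<and> m = e m + w m"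
    using G(3) by metis
  define \<psi> where "\<psi> m g = single (e m) 1 * \<phi> (w m) g" for m g
  define F where "F g = (\<Prod>m\<in>G. lookup (\<phi> m g) m)" for g
  have pf: "polyfun (\<lambda>g. lookup (\<phi> m g) m)" "\<exists>g. lookup (\<phi> m g) m \<noteq> 0" if "m \<in> G" for m
    using \<phi>[OF that] by (auto simp: ideal_fam_def generic_lead_def intro: polyfun_lookup)
  have "polyfun F" unfolding F_def[abs_def] by (rule polyfun_prod) (rule pf)
  moreover have "\<exists>g. F g \<noteq> 0"
    unfolding F_def by (rule polyfun_prod_nonzero[OF inf G(1)]) (use pf in auto)
  moreover have "leads (linear_change g ` I) = generic_leads I" if g: "invertible g" "F g \<noteq> 0" for g
  proof (rule leads_eq_generic_leads[OF I g(1), of \<psi>])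
    fix m assume "m \<in> generic_leads I"
    then have m: "w m \<in> G" "m = e m + w m" using we by blast+
    have "ideal_fam I (\<psi> m)" "generic_lead (\<psi> m) (e m + w m)"
      unfolding \<psi>_def using \<phi>[OF m(1)] generic_leads_add[OF I] by blast+
    moreover have "lookup (\<psi> m g) (e m + w m) \<noteq> 0"
      using g(2) m(1) G(1) by (simp add: \<psi>_def lookup_single_mult F_def)
    ultimately show "ideal_fam I (\<psi> m) \<and> generic_lead (\<psi> m) m \<and> lookup (\<psi> m g) m \<noteq> 0"
      using m(2) by simp
  qed
  ultimately show ?thesis by blast
qed

lemma polyfun_invertible_nonzero:
  fixes F G :: "'k::field ^ 'n::finite ^ 'n \<Rightarrow> 'k"
  assumes inf: "infinite (UNIV :: 'k set)" and F: "polyfun F" "F a \<noteq> 0" and G: "polyfun G" "G b \<noteq> 0"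
  shows "\<exists>g. invertible g \<and> F g \<noteq> 0 \<and> G g \<noteq> 0"
proof -
  obtain c where "F c * G c \<noteq> 0"
    using polyfun_common_nonzero[OF inf F G] by auto
  moreover have "det (mat 1 :: 'k ^ 'n ^ 'n) \<noteq> 0" by simp
  ultimately obtain g where "F g * G g \<noteq> 0" "det g \<noteq> 0"
    using polyfun_common_nonzero[OF inf polyfun_mult[OF F(1) G(1)] _ polyfun_det] by blast
  then show ?thesis by (auto simp: invertible_det_nz)
qed

text \<open>Over an infinite field two nonempty open subsets of the general linear group meet, so
  every open set on which the initial ideal is constant gives the same value and the definite
  description denotes.\<close>

lemma Gin_eq:
  fixes I :: "('n::{finite,linorder}, 'k::field) mpoly set"
  assumes inf: "infinite (UNIV :: 'k set)" and I: "is_ideal I"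
  shows "Gin I = monomial_span (generic_leads I)"
  unfolding Gin_def
proof (rule the_equality)
  obtain F a where F: "polyfun F" "F a \<noteq> 0"
    and eq: "\<And>g. invertible g \<Longrightarrow> F g \<noteq> 0 \<Longrightarrow> leads (linear_change g ` I) = generic_leads I"
    using generic_leads_open[OF inf I] by blast
  have ini: "initial_ideal (linear_change g ` I) = monomial_span (generic_leads I)"
    if "invertible g" "F g \<noteq> 0" for g
    using that eq by (simp add: initial_ideal_eq is_ideal_linear_change I)
  show "\<exists>U :: ('k ^ 'n::{finite,linorder} ^ 'n::{finite,linorder}) set. zariski_open_GL U \<and> U \<noteq> {} \<and>
      (\<forall>g\<in>U. initial_ideal (linear_change g ` I) = monomial_span (generic_leads I))"
    using zariski_open_GL_polyfun[OF F(1)] ini polyfun_invertible_nonzero[OF inf F F]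
    by (intro exI[of _ "{g. invertible g \<and> F g \<noteq> 0}"]) auto
  fix J :: "('n, 'k) mpoly set"
  assume "\<exists>U :: ('k ^ 'n::{finite,linorder} ^ 'n::{finite,linorder}) set. zariski_open_GL U \<and> U \<noteq> {} \<and>
      (\<forall>g\<in>U. initial_ideal (linear_change g ` I) = J)"
  then obtain U :: "('k ^ 'n::{finite,linorder} ^ 'n::{finite,linorder}) set" and h where U: "zariski_open_GL U" "h \<in> U"
    "\<forall>g\<in>U. initial_ideal (linear_change g ` I) = J" by blast
  obtain F' where F': "polyfun F'" "F' h \<noteq> 0" "\<forall>h. invertible h \<and> F' h \<noteq> 0 \<longrightarrow> h \<in> U"
    using zariski_open_GL_basic[OF U(1,2)] by blast
  obtain g where "invertible g" "F g \<noteq> 0" "F' g \<noteq> 0"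
    using polyfun_invertible_nonzero[OF inf F F'(1,2)] by blast
  then show "J = monomial_span (generic_leads I)"
    using U(3) F'(3) ini by metis
qed

section \<open>Generic coordinates are filter-regular\<close>

text \<open>The sum of \<open>J\<close> and the ideal generated by \<open>S\<close>. As an
  intersection it does not refer to an order of the generators, unlike iterated
  \<open>ideal_plus\<close>.\<close>

definition adjoin :: "'r::comm_ring_1 set \<Rightarrow> 'r set \<Rightarrow> 'r set" where
  "adjoin J S = \<Inter>{K. is_ideal K \<and> J \<subseteq> K \<and> S \<subseteq> K}"

lemma is_ideal_adjoin: "is_ideal (adjoin J S)"
  unfolding adjoin_def is_ideal_def by blast

lemma adjoin_superset: "J \<subseteq> adjoin J S" "S \<subseteq> adjoin J S"
  unfolding adjoin_def by blast+

lemma adjoin_least: "is_ideal K \<Longrightarrow> J \<subseteq> K \<Longrightarrow> S \<subseteq> K \<Longrightarrow> adjoin J S \<subseteq> K"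
  unfolding adjoin_def by blast

lemma adjoin_empty: "is_ideal J \<Longrightarrow> adjoin J {} = J"
  using adjoin_least[of J J "{}"] adjoin_superset(1)[of J "{}"] by blast

lemma ideal_plus_adjoin: "ideal_plus (adjoin J S) z = adjoin J (insert z S)"
proof
  show "ideal_plus (adjoin J S) z \<subseteq> adjoin J (insert z S)"
    using adjoin_superset[of "insert z S" J] adjoin_superset[of J "insert z S"]
    by (intro ideal_plus_least is_ideal_adjoin adjoin_least) auto
  have "z \<in> ideal_plus (adjoin J S) z"
    using ideal_plus_gen[OF is_ideal_adjoin, of z 1 J S] by simp
  then show "adjoin J (insert z S) \<subseteq> ideal_plus (adjoin J S) z"
    using adjoin_superset[of S J] adjoin_superset[of J S] ideal_plus_superset[of "adjoin J S" z]
    by (intro adjoin_least is_ideal_ideal_plus is_ideal_adjoin) auto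
qed

lemma linear_change_adjoin_subset:
  assumes "invertible g"
  shows "adjoin (linear_change g ` J) (linear_change g ` S) \<subseteq> linear_change g ` adjoin J S"
  using adjoin_superset[of S J] adjoin_superset[of J S]
  by (intro adjoin_least is_ideal_linear_change is_ideal_adjoin assms) blast+

lemma invertible_inverse_obtain:
  fixes g :: "'k::field ^ 'n::finite ^ 'n"
  assumes "invertible g"
  obtains g' where "invertible g'" "g ** g' = mat 1" "g' ** g = mat 1"
  using assms unfolding invertible_def by blast

lemma linear_change_adjoin:
  assumes g: "invertible g"
  shows "linear_change g ` adjoin J S = adjoin (linear_change g ` J) (linear_change g ` S)"
proof
  obtain g' where g': "invertible g'" "g ** g' = mat 1" "g' ** g = mat 1"
    using g by (rule invertible_inverse_obtain)
  have inv: "linear_change g' ` linear_change g ` A = A" "linear_change g ` linear_change g' ` A = A" for A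
    using g'(2,3) by (simp_all add: image_image linear_change_inverse)
  have "adjoin J S \<subseteq> linear_change g' ` adjoin (linear_change g ` J) (linear_change g ` S)"
    using linear_change_adjoin_subset[OF g'(1), of "linear_change g ` J" "linear_change g ` S"]
    by (simp add: inv)
  then show "linear_change g ` adjoin J S \<subseteq> adjoin (linear_change g ` J) (linear_change g ` S)"
    using inv(2) by (metis image_mono)
qed (rule linear_change_adjoin_subset[OF g])

section \<open>Linear forms outside finitely many ideals, and transvections\<close>

lemma lform_add: "lform (\<lambda>i. a i + b i) = lform a + lform b"
  by (simp add: lform_def single_add algebra_simps sum.distrib)

lemma lform_scale: "lform (\<lambda>i. s * a i) = single 0 s * lform a"
  by (simp add: lform_def sum_distrib_left mult_single flip: mult.assoc)

lemma single_0_inverse: "s \<noteq> 0 \<Longrightarrow> single 0 (inverse s) * (single 0 s * f) = f"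
  for f :: "('n::finite, 'k::field) mpoly"
  by (simp add: mult_single flip: mult.assoc)

lemma ideal_scale_cancel:
  assumes "is_ideal Q" "s \<noteq> 0" "single 0 s * f \<in> Q"
  shows "f \<in> (Q :: ('n::finite, 'k::field) mpoly set)"
  using ideal_mult[OF assms(1,3), of "single 0 (inverse s)"] by (simp add: single_0_inverse assms(2))

text \<open>Two members of the pencil in \<open>Q\<close> would put \<open>b\<close>, by
  subtraction, and then \<open>a\<close> into \<open>Q\<close>. So at most one parameter is
  hit.\<close>

lemma finite_pencil_hits:
  fixes Q :: "('n::finite, 'k::field) mpoly set"
  assumes Q: "is_ideal Q" and not: "\<not> (a \<in> Q \<and> b \<in> Q)"
  shows "finite {s. a + single 0 s * b \<in> Q}"
proof -
  have "s = t" if st: "a + single 0 s * b \<in> Q" "a + single 0 t * b \<in> Q" for s t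
  proof (rule ccontr)
    assume ne: "s \<noteq> t"
    have "(a + single 0 s * b) - (a + single 0 t * b) \<in> Q" by (rule ideal_diff[OF Q st])
    moreover have "(a + single 0 s * b) - (a + single 0 t * b) = single 0 (s - t) * b"
      by (simp add: single_diff left_diff_distrib)
    ultimately have "single 0 (s - t) * b \<in> Q" by simp
    then have b: "b \<in> Q" by (rule ideal_scale_cancel[OF Q, rotated]) (use ne in simp)
    have "(a + single 0 s * b) - single 0 s * b \<in> Q"
      by (intro ideal_diff[OF Q] st ideal_mult[OF Q b])
    then show False using b not by simp
  qed
  then have "{s. a + single 0 s * b \<in> Q} \<subseteq> {t}" if "a + single 0 t * b \<in> Q" for t
    using that by blast
  then show ?thesis
    by (cases "\<exists>t. a + single 0 t * b \<in> Q") (auto intro: finite_subset)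
qed

text \<open>An avoidance argument for ideals over an infinite field: a form good for
  \<open>P\<close> is moved along a variable outside the next ideal, and each ideal excludes at most
  one parameter. The condition \<open>c i = 0\<close> makes \<open>c\<close> usable for a
  transvection of variable \<open>i\<close>.\<close>

lemma lform_avoids_ideals:
  fixes P :: "('n::finite, 'k::field) mpoly set set"
  assumes inf: "infinite (UNIV :: 'k set)" and "finite P"
    and "\<And>Q. Q \<in> P \<Longrightarrow> is_ideal Q \<and> (\<exists>j. j \<noteq> i \<and> mvar j \<notin> Q)"
  shows "\<exists>c. c i = 0 \<and> (\<forall>Q\<in>P. lform c \<notin> Q)"
  using assms(2,3)
proof (induction P)
  case empty
  show ?case by (intro exI[of _ "\<lambda>_. 0"]) auto
next
  case (insert Q P)
  then obtain c where c: "c i = 0" "\<forall>Q\<in>P. lform c \<notin> Q" by blast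
  obtain j where j: "j \<noteq> i" "mvar j \<notin> Q" using insert.prems[of Q] by blast
  have "finite {s. lform c + single 0 s * mvar j \<in> K}" if "K \<in> insert Q P" for K
    using that c j insert.prems by (intro finite_pencil_hits) auto
  then have "finite (\<Union>K\<in>insert Q P. {s. lform c + single 0 s * mvar j \<in> K})"
    using insert.hyps(1) by blast
  then obtain s where "s \<notin> (\<Union>K\<in>insert Q P. {s. lform c + single 0 s * mvar j \<in> K})"
    using inf ex_new_if_finite by blast
  moreover have "lform (\<lambda>l. c l + s * (if l = j then 1 else 0)) = lform c + single 0 s * mvar j"
    by (simp only: lform_add lform_scale mvar_eq_lform)
  ultimately show ?case
    using c(1) j(1) by (intro exI[of _ "\<lambda>l. c l + s * (if l = j then 1 else 0)"]) auto
qed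

text \<open>The substitution that sends variable \<open>i\<close> to itself minus \<open>s\<close>
  times the form \<open>lform c\<close> and fixes the other variables. For \<open>c i = 0\<close>
  the parameter \<open>s\<close> is additive under composition.\<close>

definition transvection :: "'n::finite \<Rightarrow> ('n \<Rightarrow> 'k::field) \<Rightarrow> 'k \<Rightarrow> 'k ^ 'n ^ 'n" where
  "transvection i c s = (\<chi> l j. (if l = j then 1 else 0) - (if j = i then s * c l else 0))"

lemma transvection_mult: "c i = 0 \<Longrightarrow> transvection i c s ** transvection i c t = transvection i c (s + t)"
proof -
  assume c: "c i = 0"
  have "(\<Sum>m\<in>UNIV. ((if l = m then 1 else 0) - (if m = i then s * c l else 0)) *
      ((if m = j then 1 else 0) - (if j = i then t * c m else 0))) =
    (if l = j then 1 else 0) - (if j = i then (s + t) * c l else 0)" for l j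
  proof -
    have "(\<Sum>m\<in>UNIV. ((if l = m then 1 else 0) - (if m = i then s * c l else 0)) *
      ((if m = j then 1 else 0) - (if j = i then t * c m else 0))) =
      (\<Sum>m\<in>UNIV. (if m = l then (if l = j then 1 else 0) - (if j = i then t * c l else 0) else 0)
        - (if m = i then (if i = j then s * c l else 0) else 0))"
      using c by (intro sum.cong) auto
    also have "\<dots> = (if l = j then 1 else 0) - (if j = i then (s + t) * c l else 0)"
      by (simp add: sum_subtractf algebra_simps)
    finally show ?thesis .
  qed
  then show ?thesis by (simp add: transvection_def matrix_matrix_mult_def vec_eq_iff)
qed

lemma transvection_0: "transvection i c 0 = mat 1"
  by (simp add: transvection_def mat_def vec_eq_iff)

lemma invertible_transvection: "c i = 0 \<Longrightarrow> invertible (transvection i c s)"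
  unfolding invertible_def
  by (rule exI[of _ "transvection i c (- s)"]) (simp add: transvection_mult transvection_0)

lemma transvection_mvar_other: "j \<noteq> i \<Longrightarrow> linear_change (transvection i c s) (mvar j) = mvar j"
  unfolding linear_change_mvar by (simp add: transvection_def mvar_eq_lform)

text \<open>A member of the pencil is carried to \<open>mvar i\<close>; a good choice in the pencil
  is therefore a coordinate change that makes the variable itself good.\<close>

lemma transvection_pencil:
  assumes "c i = 0"
  shows "linear_change (transvection i c s) (mvar i + single 0 s * lform c) = mvar i"
proof -
  have 1: "linear_change (transvection i c s) (lform c) = lform c"
  proof -
    have "(\<Sum>j\<in>UNIV. c j * transvection i c s $ l $ j) = (\<Sum>j\<in>UNIV. if j = l then c l else 0)" for l
      using assms by (intro sum.cong) (auto simp: transvection_def)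
    then show ?thesis by (simp add: linear_change_lform)
  qed
  have "linear_change (transvection i c s) (mvar i) = lform (\<lambda>l. (if l = i then 1 else 0) + (- s) * c l)"
    by (simp add: linear_change_mvar transvection_def)
  also have "\<dots> = mvar i + single 0 (- s) * lform c"
    by (simp only: lform_add lform_scale mvar_eq_lform)
  finally show ?thesis
    by (simp add: linear_change_simps 1 single_uminus)
qed

text \<open>The entries of the product are affine in \<open>s\<close>, so the matrix moves along a
  line.\<close>

lemma polyfun_transvection:
  assumes "polyfun F"
  shows "\<exists>q. \<forall>s. F (transvection i c s ** g) = poly q s"
proof -
  have "transvection i c s ** g = (\<chi> l j. g $ l $ j + s * (\<chi> l j. - c l * g $ i $ j) $ l $ j)" for s
  proof -
    have "(\<Sum>m\<in>UNIV. ((if l = m then 1 else 0) - (if m = i then s * c l else 0)) * g $ m $ j) =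
        g $ l $ j + s * (- c l * g $ i $ j)" for l j
    proof -
      have "(\<Sum>m\<in>UNIV. ((if l = m then 1 else 0) - (if m = i then s * c l else 0)) * g $ m $ j) =
        (\<Sum>m\<in>UNIV. (if m = l then g $ l $ j else 0) - (if m = i then s * c l * g $ i $ j else 0))"
        by (intro sum.cong) (auto simp: algebra_simps)
      then show ?thesis by (simp add: sum_subtractf)
    qed
    then show ?thesis by (simp add: transvection_def matrix_matrix_mult_def vec_eq_iff)
  qed
  then show ?thesis using polyfun_line[OF assms, of g "\<chi> l j. - c l * g $ i $ j"] by simp
qed

text \<open>
  Starting from a generic \<open>g\<close>, the variables are treated by decreasing index; the variable \<open>x\<^sub>i\<close> is
  made filter-regular by a transvection that moves only \<open>x\<^sub>i\<close>, so nothing achieved before is lost.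
\<close>

lemma generic_filter_regular:
  fixes I :: "('n::{finite,linorder}, 'k::field) mpoly set"
  assumes inf: "infinite (UNIV :: 'k set)" and I: "is_ideal I"
    and F: "polyfun F" and g0: "invertible g0" "F g0 \<noteq> 0"
  shows "\<exists>g. invertible g \<and> F g \<noteq> 0 \<and>
    (\<forall>l. filter_regular (mvar l) (adjoin (linear_change g ` I) (mvar ` {l<..})))"
proof -
  have "\<exists>g. invertible g \<and> F g \<noteq> 0 \<and>
    (\<forall>l\<in>A. filter_regular (mvar l) (adjoin (linear_change g ` I) (mvar ` {l<..})))" if "finite A" for A :: "'n set"
    using that
  proof (induction A rule: finite_linorder_min_induct)
    case empty
    then show ?case using g0 by auto
  next
    case (insert i A)
    then obtain g where g: "invertible g" "F g \<noteq> 0"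
      "\<And>l. l \<in> A \<Longrightarrow> filter_regular (mvar l) (adjoin (linear_change g ` I) (mvar ` {l<..}))"
      by blast
    define J where "J l = adjoin (linear_change g ` I) (mvar ` {l<..})" for l
    obtain P where P: "finite P" "\<forall>Q\<in>P. is_ideal Q \<and> J i \<subseteq> Q \<and> \<not> range mvar \<subseteq> Q"
      "\<forall>z. z \<notin> \<Union>P \<longrightarrow> filter_regular z (J i)"
      using filter_regular_if_avoids[of "J i"] by (auto simp: J_def is_ideal_adjoin)
    \<comment> \<open>If \<open>Q\<close> does not contain \<open>mvar i\<close>, the pencil has the
      member \<open>s = 0\<close> outside \<open>Q\<close>. So the direction only has to leave the
      \<open>Q\<close> that contain \<open>mvar i\<close>, and each of these misses some other
      variable.\<close>
    have "\<exists>c. c i = 0 \<and> (\<forall>Q\<in>{Q\<in>P. mvar i \<in> Q}. lform c \<notin> Q)"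
    proof (rule lform_avoids_ideals[OF inf])
      fix Q assume Q: "Q \<in> {Q\<in>P. mvar i \<in> Q}"
      then have "is_ideal Q \<and> \<not> range mvar \<subseteq> Q" using P(2) by blast
      moreover from this obtain j where "mvar j \<notin> Q" by blast
      ultimately show "is_ideal Q \<and> (\<exists>j. j \<noteq> i \<and> mvar j \<notin> Q)" using Q by (metis (mono_tags, lifting) mem_Collect_eq)
    qed (use P in auto)
    then obtain c where c: "c i = 0" "\<And>Q. Q \<in> P \<Longrightarrow> mvar i \<in> Q \<Longrightarrow> lform c \<notin> Q" by blast
    obtain q where q: "\<And>s. F (transvection i c s ** g) = poly q s"
      using polyfun_transvection[OF F] by metis
    have "poly q 0 \<noteq> 0" using q[of 0] g(2) by (simp add: transvection_0)
    then have "finite {s. poly q s = 0}" by (intro poly_roots_finite) auto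
    moreover have "finite (\<Union>Q\<in>P. {s. mvar i + single 0 s * lform c \<in> Q})"
      using P(1,2) c(2) by (intro finite_UN_I finite_pencil_hits) auto
    ultimately have "finite ({s. poly q s = 0} \<union> (\<Union>Q\<in>P. {s. mvar i + single 0 s * lform c \<in> Q}))"
      by (rule finite_UnI)
    \<comment> \<open>The value \<open>s\<close> does two things: off the roots of \<open>q\<close>
      the open condition \<open>F\<close> persists, and off the other finite set the member of the
      pencil lies in no \<open>Q\<close>.\<close>
    from ex_new_if_finite[OF inf this]
    obtain s where s: "s \<notin> {s. poly q s = 0} \<union> (\<Union>Q\<in>P. {s. mvar i + single 0 s * lform c \<in> Q})"
      by blast
    define e where "e = transvection i c s"
    define g' where "g' = e ** g"
    have e: "invertible e" unfolding e_def using c(1) by (rule invertible_transvection)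
    \<comment> \<open>For \<open>i \<le> l\<close> the transvection fixes all variables after
      \<open>l\<close>, so the ideals belonging to \<open>l\<close> are merely transported.\<close>
    have adj: "adjoin (linear_change g' ` I) (mvar ` {l<..}) = linear_change e ` J l" if "i \<le> l" for l
    proof -
      have "linear_change e ` mvar ` {l<..} = mvar ` {l<..}"
        using that by (force simp: e_def transvection_mvar_other image_image intro!: image_cong)
      then show ?thesis
        by (simp add: J_def linear_change_adjoin[OF e] image_image g'_def linear_change_compose)
    qed
    have "invertible g'" unfolding g'_def using e g(1) by (rule invertible_mult)
    moreover have "F g' \<noteq> 0" using s q by (simp add: g'_def e_def)
    moreover have "filter_regular (mvar l) (adjoin (linear_change g' ` I) (mvar ` {l<..}))"
      if l: "l \<in> insert i A" for l
    proof (cases "l = i")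
      case True
      have "filter_regular (mvar i + single 0 s * lform c) (J i)" using P(3) s by blast
      then have "filter_regular (linear_change e (mvar i + single 0 s * lform c)) (linear_change e ` J i)"
        by (intro filter_regular_linear_change e) (auto simp: J_def is_ideal_adjoin)
      then show ?thesis using True adj[of i] by (simp add: e_def transvection_pencil c(1))
    next
      case False
      then have il: "l \<in> A" "i < l" using l insert by auto
      then have "filter_regular (linear_change e (mvar l)) (linear_change e ` J l)"
        using g(3) by (intro filter_regular_linear_change e) (auto simp: J_def is_ideal_adjoin)
      then show ?thesis using il adj[of l] by (simp add: e_def transvection_mvar_other)
    qed
    ultimately show ?case by blast
  qed
  from this[of UNIV] show ?thesis by simp
qed

section \<open>Colon ideals and sums in the reverse lexicographic order\<close>

definition degs :: "('n::finite, 'k::field) mpoly set \<Rightarrow> ('n, 'k) mpoly \<Rightarrow> nat set" where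
  "degs J z = {d. \<exists>f. homog d f \<and> z * f \<in> J \<and> f \<notin> J}"

definition restrict_keys :: "('a \<Rightarrow> bool) \<Rightarrow> ('a \<Rightarrow>\<^sub>0 'b) \<Rightarrow> 'a \<Rightarrow>\<^sub>0 'b::comm_monoid_add" where
  "restrict_keys P f = (\<Sum>m\<in>{m \<in> keys f. P m}. single m (lookup f m))"

lemma lookup_restrict_keys: "lookup (restrict_keys P f) m = (lookup f m when P m)"
proof -
  have "lookup (restrict_keys P f) m = (\<Sum>m'\<in>{m \<in> keys f. P m}. if m' = m then lookup f m else 0)"
    by (auto simp: restrict_keys_def lookup_sum lookup_single when_def intro!: sum.cong)
  also have "\<dots> = (lookup f m when P m)"
    by (auto simp: sum.delta when_def in_keys_iff)
  finally show ?thesis .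
qed

lemma keys_restrict_keys: "keys (restrict_keys P f) = {m \<in> keys f. P m}"
  by (auto simp: in_keys_iff lookup_restrict_keys)

lemma restrict_keys_split: "f = restrict_keys P f + restrict_keys (\<lambda>m. \<not> P m) f"
  by (rule poly_mapping_eqI) (auto simp: lookup_add lookup_restrict_keys when_def)

lemma single_dvd_exponent: "lookup m i \<noteq> 0 \<Longrightarrow> single i 1 + (m - single i 1) = m"
  for m :: "'n::finite \<Rightarrow>\<^sub>0 nat"
  by (rule poly_mapping_eqI) (auto simp: lookup_add lookup_minus lookup_single when_def)

lemma mvar_dvd_single:
  assumes "lookup m i \<noteq> 0"
  shows "single m c = mvar i * single (m - single i 1) c"
  using single_dvd_exponent[OF assms] by (simp add: mvar_def mult_single)

lemma single_in_ideal:
  assumes "is_ideal J" "mvar i \<in> J" "lookup m i \<noteq> 0"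
  shows "single m c \<in> J"
  using mvar_dvd_single[OF assms(3)] ideal_mult'[OF assms(1,2)] by metis

lemma in_ideal_if_keys:
  assumes "is_ideal J" "\<And>m. m \<in> keys f \<Longrightarrow> \<exists>i. mvar i \<in> J \<and> lookup m i \<noteq> 0"
  shows "f \<in> J"
proof -
  have "(\<Sum>m\<in>keys f. single m (lookup f m)) \<in> J"
    using assms single_in_ideal by (intro ideal_sum[OF assms(1)]) blast
  then show ?thesis by (simp add: poly_mapping_sum_single)
qed

lemma mvar_dvd_if_keys:
  assumes "\<And>m. m \<in> keys f \<Longrightarrow> lookup m i \<noteq> 0"
  shows "\<exists>h. f = mvar i * h"
proof -
  have "(\<Sum>m\<in>keys f. single m (lookup f m)) = (\<Sum>m\<in>keys f. mvar i * single (m - single i 1) (lookup f m))"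
    using assms by (intro sum.cong refl mvar_dvd_single)
  then have "f = mvar i * (\<Sum>m\<in>keys f. single (m - single i 1) (lookup f m))"
    by (simp add: poly_mapping_sum_single sum_distrib_left)
  then show ?thesis ..
qed

lemma keys_mvar_mult: "keys (mvar i * f) = (+) (single i 1) ` keys f"
  by (simp add: mvar_def keys_single_mult)

text \<open>The property that singles out the reverse lexicographic order. A smaller monomial
  \<open>m\<close> of equal degree exceeds the leading one at the last place \<open>p\<close> where
  they differ: either \<open>p\<close> is at least \<open>i\<close>, or both agree at
  \<open>l\<close>.\<close>

lemma revlex_last_variable:
  assumes "homog d f" "f \<noteq> 0" "lookup (lead_mon f) l \<noteq> 0" "i \<le> l" "m \<in> keys f"
  shows "\<exists>j\<ge>i. lookup m j \<noteq> 0"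
proof (cases "m = lead_mon f")
  case False
  then have "revlex_less m (lead_mon f)" using lead_mon_greatest assms by blast
  moreover have "mdeg m = mdeg (lead_mon f)"
    using assms lead_mon_homog by (auto simp: homog_def)
  ultimately obtain p where p: "lookup m p > lookup (lead_mon f) p"
    "\<forall>j>p. lookup m j = lookup (lead_mon f) j"
    by (auto simp: revlex_less_def)
  show ?thesis
  proof (cases "p \<ge> i")
    case True
    then show ?thesis using p(1) by auto
  next
    case False
    then have "lookup m l = lookup (lead_mon f) l" using p(2) assms(4) by auto
    then show ?thesis using assms by auto
  qed
qed (use assms in auto)

text \<open>The variables after \<open>i\<close> have been adjoined already, so modulo
  \<open>J\<close> the variable \<open>mvar i\<close> behaves like the last one.\<close>

context
  fixes J :: "('n::{finite,linorder}, 'k::field) mpoly set" and i :: 'n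
  assumes J: "homogeneous_ideal J" and later: "\<And>j. i < j \<Longrightarrow> mvar j \<in> J"
begin

lemma ideal_J: "is_ideal J"
  using J by (rule homogeneous_imp_ideal)

lemma lead_of_later: "i < l \<Longrightarrow> lookup m l \<noteq> 0 \<Longrightarrow> m \<in> leads J"
proof -
  assume "i < l" "lookup m l \<noteq> 0"
  then have "single m 1 \<in> J" using single_in_ideal[OF ideal_J later] by blast
  moreover have "single m 1 \<noteq> (0 :: ('n, 'k) mpoly)"
    using keys_single[of m "1 :: 'k"] by force
  ultimately show "m \<in> leads J"
    using lead_mon_single[of "1::'k" m] unfolding leads_def by force
qed

text \<open>If \<open>mvar i\<close> divides the leading monomial of a homogeneous \<open>f\<close>
  in \<open>J\<close>, it divides all of \<open>f\<close> modulo the later variables, and the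
  quotient lies in the colon ideal.\<close>

lemma leads_colon: "leads (colon J (mvar i)) = {m. single i 1 + m \<in> leads J}"
proof (intro equalityI subsetI)
  fix m assume "m \<in> leads (colon J (mvar i))"
  then obtain f where f: "mvar i * f \<in> J" "f \<noteq> 0" "m = lead_mon f"
    by (auto simp: leads_def colon_def)
  then show "m \<in> {m. single i 1 + m \<in> leads J}"
    using lead_mon_mvar_mult[OF f(2), of i] mvar_mult_nonzero[OF f(2), of i] by (force simp: leads_def)
next
  fix m assume "m \<in> {m. single i 1 + m \<in> leads J}"
  then have m: "single i 1 + m \<in> leads J" by simp
  show "m \<in> leads (colon J (mvar i))"
  proof (cases "\<exists>l>i. lookup m l \<noteq> 0")
    case True
    then show ?thesis
      using lead_of_later leads_mono[OF colon_superset[OF ideal_J, of "mvar i"]] by blast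
  next
    case False
    obtain f where f: "f \<in> J" "homog (mdeg (single i 1 + m)) f" "f \<noteq> 0" "lead_mon f = single i 1 + m"
      using homog_lead_ex[OF J m] by blast
    define P where "P w = (\<forall>l>i. lookup w l = 0)" for w :: "'n \<Rightarrow>\<^sub>0 nat"
    define f1 where "f1 = restrict_keys P f"
    have "restrict_keys (\<lambda>m. \<not> P m) f \<in> J"
      by (rule in_ideal_if_keys[OF ideal_J]) (auto simp: keys_restrict_keys P_def intro: later)
    then have "f - restrict_keys (\<lambda>m. \<not> P m) f \<in> J" using f(1) by (intro ideal_diff[OF ideal_J])
    moreover have "f - restrict_keys (\<lambda>m. \<not> P m) f = f1"
      using restrict_keys_split[of f P] by (simp add: f1_def diff_eq_eq)
    ultimately have f1J: "f1 \<in> J" by simp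
    have "P (single i 1 + m)"
      using False by (auto simp: P_def lookup_add lookup_single when_def)
    then have key: "single i 1 + m \<in> keys f1"
      using lead_mon_in_keys[OF f(3)] f(4) by (simp add: f1_def keys_restrict_keys)
    then have lead1: "lead_mon f1 = single i 1 + m"
      using lead_mon_greatest[OF f(3)] f(4) by (intro lead_mon_eqI) (auto simp: f1_def keys_restrict_keys)
    have "lookup w i \<noteq> 0" if w: "w \<in> keys f1" for w
    proof -
      have "lookup (lead_mon f) i \<noteq> 0" by (simp add: f(4) lookup_add)
      then obtain j where "j \<ge> i" "lookup w j \<noteq> 0"
        using revlex_last_variable[OF f(2,3), of i i w] w by (auto simp: f1_def keys_restrict_keys)
      moreover have "P w" using w by (simp add: f1_def keys_restrict_keys)
      ultimately show ?thesis by (cases "j = i") (auto simp: P_def)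
    qed
    then obtain h where h: "f1 = mvar i * h" using mvar_dvd_if_keys by blast
    have "h \<noteq> 0" using h key by auto
    moreover from this have "lead_mon h = m"
      using lead1 lead_mon_mvar_mult[of h i] h by simp
    moreover have "h \<in> colon J (mvar i)" using f1J h by (simp add: colon_def)
    ultimately show ?thesis unfolding leads_def by blast
  qed
qed

text \<open>A leading monomial without variables of index at least \<open>i\<close> cannot come from
  the multiple of \<open>mvar i\<close>; it must be shown to lead the summand from \<open>J\<close>
  as well.\<close>

lemma leads_ideal_plus: "leads (ideal_plus J (mvar i)) = leads J \<union> {m. lookup m i \<noteq> 0}"
proof (intro equalityI subsetI)
  fix m assume "m \<in> leads J \<union> {m. lookup m i \<noteq> 0}"
  then show "m \<in> leads (ideal_plus J (mvar i))"
  proof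
    assume "m \<in> leads J"
    then show ?thesis using leads_mono[OF ideal_plus_superset[of J "mvar i"]] by blast
  next
    assume "m \<in> {m. lookup m i \<noteq> 0}"
    then have "single m 1 \<in> ideal_plus J (mvar i)"
      using ideal_plus_gen[OF ideal_J, of "mvar i" 1]
      by (intro single_in_ideal[of _ i] is_ideal_ideal_plus ideal_J) auto
    moreover have "single m 1 \<noteq> (0 :: ('n, 'k) mpoly)"
      using keys_single[of m "1 :: 'k"] by force
    ultimately show ?thesis
      using lead_mon_single[of "1::'k" m] unfolding leads_def by force
  qed
next
  fix m assume m: "m \<in> leads (ideal_plus J (mvar i))"
  show "m \<in> leads J \<union> {m. lookup m i \<noteq> 0}"
  proof (cases "\<exists>l\<ge>i. lookup m l \<noteq> 0")
    case True
    then obtain l where "l \<ge> i" "lookup m l \<noteq> 0" by blast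
    then show ?thesis using lead_of_later[of l m] by (cases "l = i") auto
  next
    case False
    obtain f where f: "f \<in> ideal_plus J (mvar i)" "homog (mdeg m) f" "f \<noteq> 0" "lead_mon f = m"
      using homog_lead_ex[OF homogeneous_ideal_plus[OF J homog_mvar] m] by blast
    obtain a0 h where ah: "f = a0 + mvar i * h" "a0 \<in> J"
      using f(1) unfolding ideal_plus_def by blast
    define a where "a = homog_comp (mdeg m) a0"
    define b where "b = homog_comp (mdeg m) (mvar i * h)"
    have aJ: "a \<in> J" using ah(2) J by (simp add: a_def homogeneous_ideal_iff)
    have hom: "homog (mdeg m) a" by (simp add: a_def homog_homog_comp)
    have fab: "f = a + b"
      using arg_cong[OF ah(1), of "homog_comp (mdeg m)"] homog_comp_homog[OF f(2)]
      by (simp add: a_def b_def homog_comp_add)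
    have b: "lookup b w = 0" if "lookup w i = 0" for w
    proof -
      have "w \<notin> keys (mvar i * h)" using that by (auto simp: keys_mvar_mult lookup_add)
      then show ?thesis by (simp add: b_def lookup_homog_comp in_keys_iff)
    qed
    have ma: "m \<in> keys a"
      using lead_mon_in_keys[OF f(3)] f(4) b[of m] False by (auto simp: fab in_keys_iff lookup_add)
    then have a0: "a \<noteq> 0" by auto
    \<comment> \<open>Otherwise every monomial of \<open>a\<close>, and \<open>m\<close> among them,
      would involve a variable of index at least \<open>i\<close>.\<close>
    have "lookup (lead_mon a) i = 0"
      using revlex_last_variable[OF hom a0, of i i m] ma False by blast
    then have "lead_mon a \<in> keys f"
      using b lead_mon_in_keys[OF a0] by (simp add: fab in_keys_iff lookup_add)
    then have "lead_mon a = m"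
      using lead_mon_greatest[OF f(3)] lead_mon_greatest[OF a0 ma] f(4) revlex_less_asym by metis
    then show ?thesis using aJ a0 unfolding leads_def by blast
  qed
qed

lemma colon_monomial_span:
  "colon (monomial_span (leads J) :: ('n, 'k) mpoly set) (mvar i) = monomial_span (leads (colon J (mvar i)))"
  by (simp only: leads_colon monomial_span_def) (auto simp: colon_def keys_mvar_mult)

lemma ideal_plus_monomial_span:
  "ideal_plus (monomial_span (leads J) :: ('n, 'k) mpoly set) (mvar i) =
    monomial_span (leads (ideal_plus J (mvar i)))"
proof
  have id: "is_ideal (monomial_span (leads (ideal_plus J (mvar i))) :: ('n, 'k) mpoly set)"
    by (intro is_ideal_monomial_span leads_add is_ideal_ideal_plus ideal_J)
  show "ideal_plus (monomial_span (leads J) :: ('n, 'k) mpoly set) (mvar i) \<subseteq>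
    monomial_span (leads (ideal_plus J (mvar i)))"
    by (intro ideal_plus_least id; simp only: leads_ideal_plus monomial_span_def)
      (auto simp: mvar_def)
  show "monomial_span (leads (ideal_plus J (mvar i))) \<subseteq>
    ideal_plus (monomial_span (leads J) :: ('n, 'k) mpoly set) (mvar i)"
  proof
    fix f :: "('n, 'k) mpoly" assume f: "f \<in> monomial_span (leads (ideal_plus J (mvar i)))"
    define P where "P m = (m \<in> leads J)" for m
    have "restrict_keys P f \<in> monomial_span (leads J)"
      by (auto simp: monomial_span_def keys_restrict_keys P_def)
    moreover obtain h where "restrict_keys (\<lambda>m. \<not> P m) f = mvar i * h"
      using mvar_dvd_if_keys[of "restrict_keys (\<lambda>m. \<not> P m) f" i] f
      by (auto simp: monomial_span_def keys_restrict_keys P_def leads_ideal_plus)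
    ultimately show "f \<in> ideal_plus (monomial_span (leads J)) (mvar i)"
      using restrict_keys_split[of f P] unfolding ideal_plus_def by force
  qed
qed

text \<open>On both sides a degree occurs exactly if some monomial of that degree leads the colon
  ideal but not \<open>J\<close>.\<close>

lemma degs_monomial_span: "degs (monomial_span (leads J) :: ('n, 'k) mpoly set) (mvar i) = degs J (mvar i)"
proof (intro equalityI subsetI)
  fix d assume "d \<in> degs (monomial_span (leads J) :: ('n, 'k) mpoly set) (mvar i)"
  then obtain f :: "('n, 'k) mpoly" where f: "homog d f" "f \<in> colon (monomial_span (leads J)) (mvar i)"
    "f \<notin> monomial_span (leads J)"
    by (auto simp: degs_def colon_def)
  then obtain m where m: "m \<in> keys f" "m \<notin> leads J" "m \<in> leads (colon J (mvar i))"
    unfolding colon_monomial_span by (auto simp: monomial_span_def)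
  then have "mdeg m = d" using f(1) by (auto simp: homog_def)
  then obtain h where "h \<in> colon J (mvar i)" "homog d h" "h \<noteq> 0" "lead_mon h = m"
    using homog_lead_ex[OF homogeneous_colon[OF J homog_mvar] m(3)] by auto
  moreover from this have "h \<notin> J" using m(2) by (auto simp: leads_def)
  ultimately show "d \<in> degs J (mvar i)" by (auto simp: degs_def colon_def)
next
  fix d assume d: "d \<in> degs J (mvar i)"
  then obtain f where f: "homog d f" "f \<in> colon J (mvar i)" "f \<notin> J"
    by (auto simp: degs_def colon_def)
  have "\<exists>m. m \<in> leads (colon J (mvar i)) \<and> mdeg m = d \<and> m \<notin> leads J"
    using homog_part_subset_of_leads[OF J homogeneous_colon[OF J homog_mvar] colon_superset[OF ideal_J], of i d f] f
    by blast
  then obtain m where m: "m \<in> leads (colon J (mvar i))" "mdeg m = d" "m \<notin> leads J" by blast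
  have "single m 1 \<in> colon (monomial_span (leads J) :: ('n, 'k) mpoly set) (mvar i)"
    unfolding colon_monomial_span using m by (auto simp: monomial_span_def)
  moreover have "single m 1 \<notin> (monomial_span (leads J) :: ('n, 'k) mpoly set)"
    using m(3) by (auto simp: monomial_span_def)
  ultimately show "d \<in> degs (monomial_span (leads J) :: ('n, 'k) mpoly set) (mvar i)"
    using m(2) homog_single unfolding degs_def colon_def by blast
qed

lemma filter_regular_monomial_span:
  assumes "filter_regular (mvar i) J"
  shows "filter_regular (mvar i) (monomial_span (leads J) :: ('n, 'k) mpoly set)"
  unfolding filter_regular_def
proof (intro allI impI)
  fix f :: "('n, 'k) mpoly" and j assume "mvar i * f \<in> monomial_span (leads J)"
  then have f: "f \<in> monomial_span (leads (colon J (mvar i)))"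
    unfolding colon_monomial_span[symmetric] by (simp add: colon_def)
  have ex: "\<exists>N. single j N + m \<in> leads J" if "m \<in> keys f" for m
  proof -
    have "m \<in> leads (colon J (mvar i))" using f that by (auto simp: monomial_span_def)
    then obtain h where h: "mvar i * h \<in> J" "h \<noteq> 0" "lead_mon h = m"
      by (auto simp: leads_def colon_def)
    obtain N where "mvar j ^ N * h \<in> J" using assms h(1) by (auto simp: filter_regular_def)
    then have "single (single j N) 1 * h \<in> J" by (simp add: mvar_power)
    moreover have "lead_mon (single (single j N) 1 * h) = single j N + m"
      using h by (subst lead_mon_single_mult) auto
    moreover have "single (single j N) 1 * h \<noteq> 0" using h by (intro single_mult_nonzero) auto
    ultimately have "single j N + m \<in> leads J" unfolding leads_def by (metis (mono_tags, lifting) mem_Collect_eq)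
    then show ?thesis ..
  qed
  then obtain N where N: "\<And>m. m \<in> keys f \<Longrightarrow> single j (N m) + m \<in> leads J" by metis
  define N' where "N' = (\<Sum>m\<in>keys f. N m)"
  have "single j N' + m \<in> leads J" if m: "m \<in> keys f" for m
  proof -
    have "N m \<le> N'" unfolding N'_def using m by (intro member_le_sum) auto
    then have "single j N' + m = single j (N' - N m) + (single j (N m) + m)"
      by (simp add: add.assoc[symmetric] flip: single_add)
    then show ?thesis using leads_add[OF ideal_J N[OF m]] by metis
  qed
  then have "mvar j ^ N' * f \<in> monomial_span (leads J)"
    by (auto simp: mvar_power monomial_span_def keys_single_mult)
  then show "\<exists>N. mvar j ^ N * f \<in> monomial_span (leads J)" ..
qed

end

section \<open>Localizations inside the Laurent polynomials\<close>

type_synonym ('n, 'k) laurent = "('n \<Rightarrow>\<^sub>0 int) \<Rightarrow>\<^sub>0 'k"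

definition lvar :: "'n \<Rightarrow> ('n::finite, 'k::field) laurent" where
  "lvar i = single (single i 1) 1"

text \<open>In this common overring the products of variables are units, so fractions are elements
  and equality of fractions is equality.\<close>

definition emb :: "('n::finite, 'k::field) mpoly \<Rightarrow> ('n, 'k) laurent" where
  "emb = mpoly_eval (single 0) lvar"

lemma emb_simps:
  shows emb_add: "emb (p + q) = emb p + emb q"
    and emb_mult: "emb (p * q) = emb p * emb q"
    and emb_0: "emb 0 = 0"
    and emb_1: "emb 1 = 1"
    and emb_uminus: "emb (- p) = - emb p"
    and emb_power: "emb (p ^ k) = emb p ^ k"
    and emb_sum: "emb (sum F A) = (\<Sum>x\<in>A. emb (F x))"
    and emb_prod: "emb (prod F A) = (\<Prod>x\<in>A. emb (F x))"
    and emb_mvar: "emb (mvar j) = lvar j"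
  unfolding emb_def
  by (simp_all add: const_hom.mpoly_eval_add const_hom.mpoly_eval_mult const_hom.mpoly_eval_0
      const_hom.mpoly_eval_1 const_hom.mpoly_eval_uminus const_hom.mpoly_eval_power
      const_hom.mpoly_eval_prod const_hom.mpoly_eval_sum const_hom.mpoly_eval_mvar)

definition iexp :: "('n \<Rightarrow>\<^sub>0 nat) \<Rightarrow> ('n \<Rightarrow>\<^sub>0 int)" where
  "iexp m = Poly_Mapping.map int m"

lemma lookup_iexp [simp]: "lookup (iexp m) i = int (lookup m i)"
  by (simp add: iexp_def map.rep_eq when_def)

lemma iexp_inject [simp]: "iexp a = iexp b \<longleftrightarrow> a = b"
  by (metis lookup_iexp of_nat_eq_iff poly_mapping_eqI)

lemma lvar_power: "lvar i ^ k = (single (single i (int k)) 1 :: ('n::finite, 'k::field) laurent)"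
  by (induction k) (auto simp: lvar_def mult_single simp flip: single_add)

lemma emb_single: "emb (single m c) = single (iexp m) c"
proof -
  have "(\<Sum>i\<in>UNIV. single i (int (lookup m i))) = iexp m"
    using sum_single_exponents[of "iexp m"] by simp
  then show ?thesis
    by (simp add: emb_def const_hom.mpoly_eval_single lvar_power prod_single_one mult_single)
qed

lemma lookup_emb: "lookup (emb f) (iexp m) = lookup f m"
proof (induction f rule: poly_mapping_single_add_induct)
  case (single m' c)
  then show ?case by (simp add: emb_single lookup_single when_def)
qed (simp add: emb_add lookup_add)

lemma emb_inject [simp]: "emb f = emb g \<longleftrightarrow> f = g"
  by (metis lookup_emb poly_mapping_eqI)

lemma keys_emb: "keys (emb f) = iexp ` keys f"
proof
  show "keys (emb f) \<subseteq> iexp ` keys f"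
  proof -
    have "emb f = (\<Sum>m\<in>keys f. single (iexp m) (lookup f m))"
      using arg_cong[OF poly_mapping_sum_single[of "keys f" f], of emb] by (simp add: emb_sum emb_single)
    then show ?thesis
      using keys_sum_subset[of "\<lambda>m. single (iexp m) (lookup f m)" "keys f"] by auto
  qed
  show "iexp ` keys f \<subseteq> keys (emb f)" by (auto simp: in_keys_iff lookup_emb)
qed

lemma emb_surj_nonneg:
  assumes "\<And>e i. e \<in> keys u \<Longrightarrow> lookup e i \<ge> 0"
  shows "u \<in> range (emb :: ('n::finite, 'k::field) mpoly \<Rightarrow> _)"
proof -
  have "single e (lookup u e) \<in> range (emb :: ('n, 'k) mpoly \<Rightarrow> _)" if "e \<in> keys u" for e
  proof -
    have "e = iexp (Poly_Mapping.map nat e)"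
      using assms[OF that] by (intro poly_mapping_eqI) (auto simp: map.rep_eq when_def)
    then have "single e (lookup u e) = emb (single (Poly_Mapping.map nat e) (lookup u e))"
      by (simp add: emb_single)
    then show ?thesis by blast
  qed
  then have "\<forall>e\<in>keys u. \<exists>f :: ('n, 'k) mpoly. single e (lookup u e) = emb f" by blast
  then obtain F where "\<forall>e\<in>keys u. single e (lookup u e) = emb (F e :: ('n, 'k) mpoly)"
    by (rule bchoice[THEN exE])
  then have "(\<Sum>e\<in>keys u. single e (lookup u e)) = emb (\<Sum>e\<in>keys u. F e)"
    by (simp add: emb_sum)
  then show ?thesis by (simp add: poly_mapping_sum_single)
qed

definition ldeg :: "('n::finite \<Rightarrow>\<^sub>0 int) \<Rightarrow> int" where
  "ldeg e = (\<Sum>i\<in>UNIV. lookup e i)"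

lemma ldeg_iexp [simp]: "ldeg (iexp m) = int (mdeg m)"
  by (simp add: ldeg_def mdeg_def)

lemma ldeg_add: "ldeg (a + b) = ldeg a + ldeg b"
  by (simp add: ldeg_def lookup_add sum.distrib)

lemma ldeg_uminus: "ldeg (- a) = - ldeg a"
  by (simp add: ldeg_def sum_negf)

lemma ldeg_0 [simp]: "ldeg 0 = 0"
  by (simp add: ldeg_def)

lemma ldeg_single [simp]: "ldeg (single i k) = k"
  by (simp add: ldeg_def lookup_single when_def)

definition lhomog :: "int \<Rightarrow> ('n::finite, 'k::field) laurent \<Rightarrow> bool" where
  "lhomog r u \<longleftrightarrow> (\<forall>e\<in>keys u. ldeg e = r)"

lemma lhomog_0 [simp]: "lhomog r 0"
  by (simp add: lhomog_def)

lemma lhomog_add: "lhomog r f \<Longrightarrow> lhomog r g \<Longrightarrow> lhomog r (f + g)"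
  unfolding lhomog_def using keys_add[of f g] by blast

lemma lhomog_uminus: "lhomog r f \<Longrightarrow> lhomog r (- f)"
  by (simp add: lhomog_def)

lemma lhomog_mult:
  assumes "lhomog r f" "lhomog s g" shows "lhomog (r + s) (f * g)"
  unfolding lhomog_def
proof
  fix e assume "e \<in> keys (f * g)"
  then obtain a b where "e = a + b" "a \<in> keys f" "b \<in> keys g"
    using keys_mult[of f g] by blast
  then show "ldeg e = r + s" using assms by (simp add: ldeg_add lhomog_def)
qed

lemma lhomog_emb: "lhomog r (emb f) \<longleftrightarrow> (\<forall>m\<in>keys f. int (mdeg m) = r)"
  by (simp add: lhomog_def keys_emb)

lemma lhomog_emb_homog: "lhomog (int d) (emb f) \<longleftrightarrow> homog d f"
  by (simp add: lhomog_emb homog_def)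

lemma lhomog_1: "lhomog 0 1"
  by (simp add: lhomog_def)

lemma lhomog_power: "lhomog r f \<Longrightarrow> lhomog (int k * r) (f ^ k)"
  by (induction k) (auto simp: algebra_simps lhomog_1 dest: lhomog_mult)

lemma lhomog_lvar_power: "lhomog (int k) (lvar j ^ k)"
  by (simp add: lvar_power lhomog_def)

section \<open>Localization at products of variables\<close>

definition lprod :: "'n set \<Rightarrow> ('n::finite, 'k::field) laurent" where
  "lprod S = (\<Prod>i\<in>S. lvar i)"

definition linv :: "'n set \<Rightarrow> ('n::finite, 'k::field) laurent" where
  "linv S = single (- (\<Sum>i\<in>S. single i 1)) 1"

lemma lprod_single: "lprod S = single (\<Sum>i\<in>S. single i 1) 1"
  by (simp add: lprod_def lvar_def prod_single_one)

lemma emb_var_prod: "emb (var_prod S) = lprod S"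
  by (simp add: var_prod_def lprod_def emb_prod emb_mvar)

lemma lprod_linv: "lprod S * linv S = 1"
  by (simp add: lprod_single linv_def mult_single)

lemma lprod_linv_power: "lprod S ^ a * linv S ^ a = 1"
  by (simp add: lprod_linv flip: power_mult_distrib)

lemma lprod_power_cancel: "lprod S ^ a * (linv S ^ a * u) = u" "linv S ^ a * (lprod S ^ a * u) = u"
proof -
  show "lprod S ^ a * (linv S ^ a * u) = u"
    by (simp add: lprod_linv_power flip: mult.assoc)
  then show "linv S ^ a * (lprod S ^ a * u) = u"
    by (simp add: mult.left_commute)
qed

lemma lprod_power_inject: "lprod S ^ a * u = lprod S ^ a * v \<longleftrightarrow> u = v"
  by (metis lprod_power_cancel(2))

lemma lprod_subset: "S \<subseteq> T \<Longrightarrow> lprod T = lprod (T - S) * lprod S"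
  unfolding lprod_def by (rule prod.subset_diff) auto

lemma lhomog_lprod_power: "lhomog (int a * int (card S)) (lprod S ^ a)"
proof -
  have "ldeg (\<Sum>i\<in>S. single i 1) = int (card S)"
    by (induction S rule: infinite_finite_induct) (auto simp: ldeg_add)
  then have "lhomog (int (card S)) (lprod S :: ('a, 'b) laurent)"
    by (simp add: lprod_single lhomog_def)
  then show ?thesis by (rule lhomog_power)
qed

lemma lhomog_linv_power: "lhomog (- (int a * int (card S))) (linv S ^ a)"
proof -
  have "ldeg (\<Sum>i\<in>S. single i 1) = int (card S)"
    by (induction S rule: infinite_finite_induct) (auto simp: ldeg_add)
  then have "lhomog (- int (card S)) (linv S :: ('a, 'b) laurent)"
    by (simp add: linv_def lhomog_def ldeg_uminus)
  then have "lhomog (int a * - int (card S)) (linv S ^ a :: ('a, 'b) laurent)"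
    by (rule lhomog_power)
  then show ?thesis unfolding mult_minus_right .
qed

text \<open>The part of degree \<open>r\<close> of the localization of the ideal \<open>J\<close> at \<open>x\<^sub>S\<close>.\<close>

definition Loc :: "('n::finite, 'k::field) mpoly set \<Rightarrow> 'n set \<Rightarrow> int \<Rightarrow> ('n, 'k) laurent set" where
  "Loc J S r = {u. lhomog r u \<and> (\<exists>a. lprod S ^ a * u \<in> emb ` J)}"

lemma LocE:
  assumes "u \<in> Loc J S r"
  obtains a f where "lprod S ^ a * u = emb f" "f \<in> J" "lhomog r u"
  using assms unfolding Loc_def by blast

lemma LocI: "lprod S ^ a * u = emb f \<Longrightarrow> f \<in> J \<Longrightarrow> lhomog r u \<Longrightarrow> u \<in> Loc J S r"
  unfolding Loc_def by blast

lemma Loc_raise: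
  assumes "is_ideal J" "lprod S ^ a * u = emb f" "f \<in> J" "a \<le> b"
  shows "\<exists>f\<in>J. lprod S ^ b * u = emb f"
proof
  have "lprod S ^ b = (lprod S ^ (b - a) * lprod S ^ a :: ('a, 'b) laurent)"
    using assms(4) by (simp flip: power_add)
  then show "lprod S ^ b * u = emb (var_prod S ^ (b - a) * f)"
    by (simp add: emb_mult emb_power emb_var_prod mult.assoc assms(2))
  show "var_prod S ^ (b - a) * f \<in> J" by (rule ideal_mult[OF assms(1,3)])
qed

lemma Loc_0: "is_ideal J \<Longrightarrow> 0 \<in> Loc J S r"
  by (rule LocI[of S 0 0 0]) (auto simp: emb_0 ideal_0)

lemma Loc_add:
  assumes J: "is_ideal J" and u: "u \<in> Loc J S r" and v: "v \<in> Loc J S r"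
  shows "u + v \<in> Loc J S r"
proof -
  obtain a f where f: "lprod S ^ a * u = emb f" "f \<in> J" "lhomog r u" using u by (rule LocE)
  obtain b g where g: "lprod S ^ b * v = emb g" "g \<in> J" "lhomog r v" using v by (rule LocE)
  obtain f' where f': "f' \<in> J" "lprod S ^ max a b * u = emb f'"
    using Loc_raise[OF J f(1,2), of "max a b"] by auto
  obtain g' where g': "g' \<in> J" "lprod S ^ max a b * v = emb g'"
    using Loc_raise[OF J g(1,2), of "max a b"] by auto
  show ?thesis
  proof (rule LocI)
    show "lprod S ^ max a b * (u + v) = emb (f' + g')"
      by (simp add: distrib_left f' g' emb_add)
    show "f' + g' \<in> J" using f' g' by (intro ideal_add[OF J])
    show "lhomog r (u + v)" by (rule lhomog_add[OF f(3) g(3)])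
  qed
qed

lemma Loc_mult:
  assumes J: "is_ideal J" and u: "u \<in> Loc J S r" and h: "lhomog d (emb h)"
  shows "emb h * u \<in> Loc J S (d + r)"
proof -
  obtain a f where f: "lprod S ^ a * u = emb f" "f \<in> J" "lhomog r u" using u by (rule LocE)
  show ?thesis
  proof (rule LocI)
    show "lprod S ^ a * (emb h * u) = emb (h * f)"
      by (simp add: mult.left_commute f(1) emb_mult)
    show "h * f \<in> J" by (rule ideal_mult[OF J f(2)])
    show "lhomog (d + r) (emb h * u)" by (rule lhomog_mult[OF h f(3)])
  qed
qed

lemma Loc_uminus: "is_ideal J \<Longrightarrow> u \<in> Loc J S r \<Longrightarrow> - u \<in> Loc J S r"
  using Loc_mult[of J u S r 0 "- 1"] by (simp add: emb_uminus emb_1 lhomog_uminus lhomog_1)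

lemma Loc_diff: "is_ideal J \<Longrightarrow> u \<in> Loc J S r \<Longrightarrow> v \<in> Loc J S r \<Longrightarrow> u - v \<in> Loc J S r"
  using Loc_add[of J u S r "- v"] by (simp add: Loc_uminus)

lemma Loc_sum: "is_ideal J \<Longrightarrow> (\<And>x. x \<in> A \<Longrightarrow> F x \<in> Loc J S r) \<Longrightarrow> sum F A \<in> Loc J S r"
  by (induction A rule: infinite_finite_induct) (auto intro: Loc_0 Loc_add)

lemma Loc_mono_ideal: "J \<subseteq> K \<Longrightarrow> Loc J S r \<subseteq> Loc K S r"
  unfolding Loc_def by blast

lemma Loc_mono:
  assumes J: "is_ideal J" and "S \<subseteq> T" and u: "u \<in> Loc J S r"
  shows "u \<in> Loc J T r"
proof -
  obtain a f where f: "lprod S ^ a * u = emb f" "f \<in> J" "lhomog r u" using u by (rule LocE)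
  show ?thesis
  proof (rule LocI)
    show "lprod T ^ a * u = emb (var_prod (T - S) ^ a * f)"
      by (simp add: lprod_subset[OF assms(2)] power_mult_distrib mult.assoc f(1) emb_mult emb_power emb_var_prod)
    show "var_prod (T - S) ^ a * f \<in> J" by (rule ideal_mult[OF J f(2)])
  qed (rule f(3))
qed

text \<open>A power of \<open>lvar j\<close> clears the denominators in that variable. The claim for
  all large \<open>N\<close> allows a common exponent for finitely many index sets.\<close>

lemma Loc_drop:
  assumes J: "is_ideal J" and u: "u \<in> Loc J (insert j S) r"
  shows "\<exists>N0. \<forall>N\<ge>N0. lvar j ^ N * u \<in> Loc J S (int N + r)"
proof -
  obtain a f where f: "lprod (insert j S) ^ a * u = emb f" "f \<in> J" "lhomog r u" using u by (rule LocE)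
  have "lvar j ^ N * u \<in> Loc J S (int N + r)" if N: "N \<ge> a" for N
  proof (cases "j \<in> S")
    case True
    then have "u \<in> Loc J S r" using u by (simp add: insert_absorb)
    then have "emb (mvar j ^ N) * u \<in> Loc J S (int N + r)"
      by (intro Loc_mult[OF J]) (simp_all add: emb_power emb_mvar lhomog_lvar_power)
    then show ?thesis by (simp add: emb_power emb_mvar)
  next
    case False
    show ?thesis
    proof (rule LocI)
      have "lprod (insert j S) = lvar j * (lprod S :: ('a, 'b) laurent)"
        using False by (simp add: lprod_def)
      then have "lvar j ^ (N - a) * (lprod (insert j S) ^ a * u) =
          (lvar j ^ (N - a) * lvar j ^ a) * (lprod S ^ a * u)"
        by (simp add: power_mult_distrib mult_ac)
      also have "\<dots> = lprod S ^ a * (lvar j ^ N * u)"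
        using N by (simp add: mult_ac flip: power_add)
      finally show "lprod S ^ a * (lvar j ^ N * u) = emb (mvar j ^ (N - a) * f)"
        by (simp add: f(1) emb_mult emb_power emb_mvar)
      show "mvar j ^ (N - a) * f \<in> J" by (rule ideal_mult[OF J f(2)])
      show "lhomog (int N + r) (lvar j ^ N * u)" by (rule lhomog_mult[OF lhomog_lvar_power f(3)])
    qed
  qed
  then show ?thesis by blast
qed

lemma Loc_empty: "Loc J {} r = {emb f | f. f \<in> J \<and> lhomog r (emb f)}"
  by (auto simp: Loc_def lprod_def)

lemma lprod_power_single: "lprod S ^ a = single (\<Sum>i\<in>S. single i (int a)) 1"
proof -
  have "lprod S ^ a = (\<Prod>i\<in>S. lvar i ^ a)" by (simp add: lprod_def prod_power_distrib)
  then show ?thesis by (simp add: lvar_power prod_single_one)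
qed

lemma Loc_UNIV_iff:
  "u \<in> Loc UNIV S r \<longleftrightarrow> lhomog r u \<and> (\<forall>e\<in>keys u. \<forall>i. i \<notin> S \<longrightarrow> lookup e i \<ge> 0)"
proof
  assume "u \<in> Loc UNIV S r"
  then obtain a f where f: "lprod S ^ a * u = emb f" "lhomog r u" by (rule LocE)
  have "lookup e i \<ge> 0" if e: "e \<in> keys u" "i \<notin> S" for e i
  proof -
    have "(\<Sum>i\<in>S. single i (int a)) + e \<in> keys (lprod S ^ a * u)"
      using e(1) by (auto simp: lprod_power_single keys_single_mult)
    then obtain m where "(\<Sum>i\<in>S. single i (int a)) + e = iexp m"
      by (auto simp: f(1) keys_emb)
    from arg_cong[OF this, of "\<lambda>e. lookup e i"] show ?thesis
      using e(2) by (simp add: lookup_add lookup_sum lookup_single when_def)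
  qed
  then show "lhomog r u \<and> (\<forall>e\<in>keys u. \<forall>i. i \<notin> S \<longrightarrow> lookup e i \<ge> 0)" using f(2) by blast
next
  assume u: "lhomog r u \<and> (\<forall>e\<in>keys u. \<forall>i. i \<notin> S \<longrightarrow> lookup e i \<ge> 0)"
  \<comment> \<open>A bound for the absolute values of all exponents in \<open>u\<close>, hence
    enough to clear every negative one.\<close>
  define a where "a = (\<Sum>e\<in>keys u. \<Sum>i\<in>UNIV. nat \<bar>lookup e i\<bar>)"
  have a: "nat \<bar>lookup e i\<bar> \<le> a" if "e \<in> keys u" for e i
  proof -
    have "nat \<bar>lookup e i\<bar> \<le> (\<Sum>i\<in>UNIV. nat \<bar>lookup e i\<bar>)" by (intro member_le_sum) auto
    also have "\<dots> \<le> a" unfolding a_def using that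
      by (intro member_le_sum[of e "keys u" "\<lambda>e. \<Sum>i\<in>UNIV. nat \<bar>lookup e i\<bar>"]) auto
    finally show ?thesis .
  qed
  have "lprod S ^ a * u \<in> range emb"
  proof (rule emb_surj_nonneg)
    fix e i assume "e \<in> keys (lprod S ^ a * u)"
    then obtain e' where e': "e = (\<Sum>i\<in>S. single i (int a)) + e'" "e' \<in> keys u"
      by (auto simp: lprod_power_single keys_single_mult)
    show "lookup e i \<ge> 0"
      using u e'(2) a[OF e'(2), of i]
      by (cases "i \<in> S") (auto simp: e'(1) lookup_add lookup_sum lookup_single when_def)
  qed
  then show "u \<in> Loc UNIV S r" using u by (auto simp: Loc_def)
qed

text \<open>Away from the irrelevant ideal a filter-regular element is a nonzerodivisor.\<close>

lemma Loc_filter_regular: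
  assumes J: "is_ideal J" and z: "filter_regular z J" and S: "S \<noteq> {}"
    and u: "u \<in> Loc UNIV S r" and zu: "emb z * u \<in> Loc J S r'"
  shows "u \<in> Loc J S r"
proof -
  obtain a f where f: "lprod S ^ a * u = emb f" "lhomog r u" using u by (rule LocE)
  obtain b g where g: "lprod S ^ b * (emb z * u) = emb g" "g \<in> J" using zu by (rule LocE)
  obtain f' where f': "lprod S ^ max a b * u = emb f'"
    using Loc_raise[OF is_ideal_UNIV f(1), of "max a b"] by auto
  obtain g' where g': "g' \<in> J" "lprod S ^ max a b * (emb z * u) = emb g'"
    using Loc_raise[OF J g, of "max a b"] by auto
  have "emb (z * f') = emb g'"
    unfolding emb_mult f'[symmetric] g'(2)[symmetric] by (simp add: mult.left_commute)
  then have "z * f' \<in> J" using g'(1) by simp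
  obtain j where j: "j \<in> S" using S by blast
  obtain N where N: "mvar j ^ N * f' \<in> J"
    using z \<open>z * f' \<in> J\<close> by (auto simp: filter_regular_def)
  show ?thesis
  proof (rule LocI)
    have "lprod S = lprod (S - {j}) * (lvar j :: ('a, 'b) laurent)"
      using lprod_subset[of "{j}" S] j by (simp add: lprod_def)
    then have "lprod S ^ N = lprod (S - {j}) ^ N * (lvar j ^ N :: ('a, 'b) laurent)"
      by (simp add: power_mult_distrib)
    then show "lprod S ^ (N + max a b) * u = emb (var_prod (S - {j}) ^ N * (mvar j ^ N * f'))"
      by (simp add: power_add mult.assoc f' emb_mult emb_power emb_var_prod emb_mvar)
    show "var_prod (S - {j}) ^ N * (mvar j ^ N * f') \<in> J" by (rule ideal_mult[OF J N])
  qed (rule f(2))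
qed

text \<open>After clearing denominators the splitting of the numerator is replaced by its
  homogeneous component, so that both summands have the required degree; \<open>u\<close> sits one
  degree lower because \<open>z\<close> is linear.\<close>

lemma Loc_ideal_plus:
  assumes J: "homogeneous_ideal J" and z: "homog 1 z"
    and v: "v \<in> Loc (ideal_plus J z) S r"
  shows "\<exists>w\<in>Loc J S r. \<exists>u\<in>Loc UNIV S (r - 1). v = w + emb z * u"
proof -
  note id = homogeneous_imp_ideal[OF J]
  obtain a f where f: "lprod S ^ a * v = emb f" "f \<in> ideal_plus J z" "lhomog r v" using v by (rule LocE)
  obtain j h where jh: "f = j + z * h" "j \<in> J" using f(2) unfolding ideal_plus_def by blast
  \<comment> \<open>The degree of the numerator \<open>f\<close>. It may be negative, but then
    \<open>f = 0\<close>.\<close>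
  define D where "D = r + int a * int (card S)"
  have "lhomog D (emb f)"
    using lhomog_mult[OF lhomog_lprod_power f(3), of a S] by (simp add: f(1) D_def add.commute)
  then have fD: "\<forall>m\<in>keys f. int (mdeg m) = D" by (simp add: lhomog_emb)
  have "\<exists>j'\<in>J. \<exists>h'. f = j' + z * h' \<and> lhomog D (emb j') \<and> lhomog (D - 1) (emb h')"
  proof (cases "f = 0")
    case True
    then show ?thesis using ideal_0[OF id] by (auto simp: emb_0 intro!: bexI[of _ 0] exI[of _ 0])
  next
    case False
    then obtain d where D: "D = int d" using fD by (metis ex_in_conv keys_eq_empty)
    have "homog d f" using fD by (auto simp: D homog_def)
    then have eq: "f = homog_comp d j + homog_comp d (z * h)"
      by (metis homog_comp_add homog_comp_homog jh(1))
    have "\<exists>h'. homog_comp d (z * h) = z * h' \<and> lhomog (D - 1) (emb h')"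
    proof (cases d)
      case 0
      then show ?thesis
        using homog_comp_mult_low[OF z, of d h] by (intro exI[of _ 0]) (auto simp: emb_0)
    next
      case (Suc e)
      then show ?thesis
        using homog_comp_mult[OF z, of e h] homog_homog_comp[of e h]
        by (intro exI[of _ "homog_comp e h"]) (auto simp: D lhomog_emb_homog)
    qed
    then show ?thesis
      using eq J jh(2) by (intro bexI[of _ "homog_comp d j"])
        (auto simp: homogeneous_ideal_iff D lhomog_emb_homog homog_homog_comp)
  qed
  then obtain j' h' where *: "j' \<in> J" "f = j' + z * h'" "lhomog D (emb j')" "lhomog (D - 1) (emb h')" by blast
  have "linv S ^ a * emb j' \<in> Loc J S r"
    using *(1) lhomog_mult[OF lhomog_linv_power *(3), of a S]
    by (intro LocI[of S a _ j']) (auto simp: lprod_power_cancel D_def)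
  moreover have "linv S ^ a * emb h' \<in> Loc UNIV S (r - 1)"
    using lhomog_mult[OF lhomog_linv_power *(4), of a S]
    by (intro LocI[of S a _ h']) (auto simp: lprod_power_cancel D_def)
  moreover have "v = linv S ^ a * emb j' + emb z * (linv S ^ a * emb h')"
  proof -
    have "v = linv S ^ a * emb f" using f(1) by (metis lprod_power_cancel(2))
    then show ?thesis by (simp add: *(2) emb_add emb_mult algebra_simps)
  qed
  ultimately show ?thesis by blast
qed

section \<open>The Cech complex of Laurent polynomials\<close>

type_synonym ('n, 'k) cochain = "'n set \<Rightarrow> ('n, 'k) laurent"

text \<open>Integer cohomological degrees make the cochains of degree \<open>-1\<close> vanish without a case distinction.\<close>

definition cochains :: "('n::finite, 'k::field) mpoly set \<Rightarrow> int \<Rightarrow> int \<Rightarrow> ('n, 'k) cochain set" where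
  "cochains J p r = {u. \<forall>S. if int (card S) = p then u S \<in> Loc J S r else u S = 0}"

definition cech_sign :: "'n::linorder set \<Rightarrow> 'n \<Rightarrow> ('n, 'k::field) laurent" where
  "cech_sign T i = (- 1) ^ card {j \<in> T. j < i}"

definition delta :: "('n::{finite,linorder}, 'k::field) cochain \<Rightarrow> ('n, 'k) cochain" where
  "delta u = (\<lambda>T. \<Sum>i\<in>T. cech_sign T i * u (T - {i}))"

definition scale_cochain :: "('n::finite, 'k::field) laurent \<Rightarrow> ('n, 'k) cochain \<Rightarrow> ('n, 'k) cochain" where
  "scale_cochain c u = (\<lambda>S. c * u S)"

lemma cochainsI:
  "(\<And>S. int (card S) = p \<Longrightarrow> u S \<in> Loc J S r) \<Longrightarrow> (\<And>S. int (card S) \<noteq> p \<Longrightarrow> u S = 0) \<Longrightarrow> u \<in> cochains J p r"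
  by (simp add: cochains_def)

lemma cochainsD: "u \<in> cochains J p r \<Longrightarrow> int (card S) = p \<Longrightarrow> u S \<in> Loc J S r"
  by (auto simp: cochains_def dest: spec[of _ S])

lemma cochains_0D: "u \<in> cochains J p r \<Longrightarrow> int (card S) \<noteq> p \<Longrightarrow> u S = 0"
  by (auto simp: cochains_def dest: spec[of _ S])

lemma delta_add: "delta (u + v) = delta u + delta v"
  by (rule ext) (simp add: delta_def algebra_simps sum.distrib)

lemma delta_diff: "delta (u - v) = delta u - delta v"
  by (rule ext) (simp add: delta_def algebra_simps sum_subtractf)

lemma delta_0: "delta 0 = 0"
  by (rule ext) (simp add: delta_def)

lemma delta_scale: "delta (scale_cochain c u) = scale_cochain c (delta u)"
  by (rule ext) (simp add: delta_def scale_cochain_def sum_distrib_left mult.left_commute)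

lemma delta_sum: "delta (sum F A) = (\<Sum>x\<in>A. delta (F x))"
  by (induction A rule: infinite_finite_induct)
    (simp_all only: delta_add delta_0 sum.infinite sum.empty sum.insert not_False_eq_True)

lemma scale_cochain_simps:
  shows scale_cochain_add: "scale_cochain c (u + v) = scale_cochain c u + scale_cochain c v"
    and scale_cochain_diff: "scale_cochain c (u - v) = scale_cochain c u - scale_cochain c v"
    and scale_cochain_scale: "scale_cochain c (scale_cochain d u) = scale_cochain (c * d) u"
    and scale_cochain_1: "scale_cochain 1 u = u"
  by (auto simp: scale_cochain_def algebra_simps)

lemma cech_sign_square: "cech_sign T i * (cech_sign T i * x) = x"
  by (cases "even (card {j \<in> T. j < i})") (simp_all add: cech_sign_def)

lemma cech_sign_remove_lower:
  fixes T :: "'n::{finite,linorder} set"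
  assumes "i \<in> T" "i < j"
  shows "cech_sign (T - {i}) j = - (cech_sign T j :: ('n, 'k::field) laurent)"
proof -
  have "{k \<in> T. k < j} = insert i {k \<in> T - {i}. k < j}" using assms by auto
  then have "card {k \<in> T. k < j} = Suc (card {k \<in> T - {i}. k < j})" by simp
  then show ?thesis by (simp add: cech_sign_def)
qed

lemma cech_sign_remove_upper:
  assumes "i \<le> j"
  shows "cech_sign (T - {j}) i = cech_sign T i"
proof -
  have "{k \<in> T - {j}. k < i} = {k \<in> T. k < i}" using assms by auto
  then show ?thesis by (simp add: cech_sign_def)
qed

lemma Loc_cech_sign: "is_ideal J \<Longrightarrow> u \<in> Loc J S r \<Longrightarrow> cech_sign T i * u \<in> Loc J S r"
  by (cases "even (card {j \<in> T. j < i})") (simp_all add: cech_sign_def Loc_uminus)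

lemma cochains_zero: "is_ideal J \<Longrightarrow> 0 \<in> cochains J p r"
  by (rule cochainsI) (auto simp: Loc_0)

lemma cochains_add: "is_ideal J \<Longrightarrow> u \<in> cochains J p r \<Longrightarrow> v \<in> cochains J p r \<Longrightarrow> u + v \<in> cochains J p r"
  by (rule cochainsI) (auto simp: Loc_add cochainsD cochains_0D)

lemma cochains_diff: "is_ideal J \<Longrightarrow> u \<in> cochains J p r \<Longrightarrow> v \<in> cochains J p r \<Longrightarrow> u - v \<in> cochains J p r"
  by (rule cochainsI) (auto simp: Loc_diff cochainsD cochains_0D)

lemma cochains_sum: "is_ideal J \<Longrightarrow> (\<And>x. x \<in> A \<Longrightarrow> F x \<in> cochains J p r) \<Longrightarrow> sum F A \<in> cochains J p r"
  by (induction A rule: infinite_finite_induct) (auto intro: cochains_zero cochains_add)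

lemma cochains_scale:
  "is_ideal J \<Longrightarrow> u \<in> cochains J p r \<Longrightarrow> lhomog d (emb h) \<Longrightarrow> scale_cochain (emb h) u \<in> cochains J p (d + r)"
  by (rule cochainsI) (auto simp: scale_cochain_def Loc_mult cochainsD cochains_0D)

lemma cochains_mono: "J \<subseteq> K \<Longrightarrow> u \<in> cochains J p r \<Longrightarrow> u \<in> cochains K p r"
  by (rule cochainsI) (auto dest: cochainsD cochains_0D intro: subsetD[OF Loc_mono_ideal])

lemma cochains_minus_1: "u \<in> cochains K (- 1) r \<Longrightarrow> u = 0"
  by (rule ext) (auto dest: cochains_0D)

lemma cochains_delta:
  assumes J: "is_ideal J" and u: "u \<in> cochains J p r"
  shows "delta u \<in> cochains J (p + 1) r"
proof (rule cochainsI)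
  fix T :: "'a set"
  have card: "int (card (T - {i})) = int (card T) - 1" if "i \<in> T" for i
    using that card_gt_0_iff[of T] by (subst card_Diff_singleton) (auto simp: of_nat_diff Suc_leI)
  show "delta u T \<in> Loc J T r" if T: "int (card T) = p + 1"
  proof -
    have "cech_sign T i * u (T - {i}) \<in> Loc J T r" if i: "i \<in> T" for i
    proof -
      have "u (T - {i}) \<in> Loc J (T - {i}) r"
        by (rule cochainsD[OF u]) (simp add: card[OF i] T)
      then have "u (T - {i}) \<in> Loc J T r" by (rule Loc_mono[OF J, rotated]) blast
      then show ?thesis by (rule Loc_cech_sign[OF J])
    qed
    then show ?thesis
      unfolding delta_def by (rule Loc_sum[OF J])
  qed
  show "delta u T = 0" if T: "int (card T) \<noteq> p + 1"
  proof -
    have "u (T - {i}) = 0" if i: "i \<in> T" for i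
      by (rule cochains_0D[OF u]) (use card[OF i] T in simp)
    then show ?thesis
      unfolding delta_def by (simp add: sum.neutral)
  qed
qed

text \<open>The two orders of removing a pair of indices cancel: without the smaller index the sign
  of the larger one flips, without the larger index the sign of the smaller one is
  unchanged.\<close>

lemma delta_delta: "delta (delta u) = (0 :: ('n::{finite,linorder}, 'k::field) cochain)"
proof
  fix T :: "'n set"
  define a where "a i j = cech_sign T i * (cech_sign (T - {i}) j * u (T - {i} - {j}))" for i j
  have swap: "a j i = - a i j" if "i \<in> T" "j \<in> T" "i < j" for i j
  proof -
    have "T - {j} - {i} = T - {i} - {j}" by blast
    then show ?thesis
      using that cech_sign_remove_lower[of i T j, where 'k = 'k] cech_sign_remove_upper[of i j T, where 'b = 'k]
      by (simp add: a_def mult_ac)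
  qed
  have "delta (delta u) T = (\<Sum>i\<in>T. \<Sum>j\<in>T - {i}. a i j)"
    by (simp add: delta_def a_def sum_distrib_left)
  also have "\<dots> = (\<Sum>i\<in>T. (\<Sum>j\<in>{j. j \<in> T \<and> i < j}. a i j) + (\<Sum>j\<in>{j. j \<in> T \<and> j < i}. a i j))"
  proof (rule sum.cong[OF refl])
    fix i assume "i \<in> T"
    have "T - {i} = {j. j \<in> T \<and> i < j} \<union> {j. j \<in> T \<and> j < i}" by auto
    then have "sum (a i) (T - {i}) = sum (a i) ({j. j \<in> T \<and> i < j} \<union> {j. j \<in> T \<and> j < i})"
      by (rule arg_cong)
    also have "\<dots> = (\<Sum>j\<in>{j. j \<in> T \<and> i < j}. a i j) + (\<Sum>j\<in>{j. j \<in> T \<and> j < i}. a i j)"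
      by (rule sum.union_disjoint[OF finite finite]) auto
    finally show "(\<Sum>j\<in>T - {i}. a i j) = (\<Sum>j\<in>{j. j \<in> T \<and> i < j}. a i j) + (\<Sum>j\<in>{j. j \<in> T \<and> j < i}. a i j)" .
  qed
  also have "\<dots> = (\<Sum>i\<in>T. \<Sum>j\<in>{j. j \<in> T \<and> i < j}. a i j) + (\<Sum>i\<in>T. \<Sum>j\<in>{j. j \<in> T \<and> j < i}. a i j)"
    by (rule sum.distrib)
  also have "(\<Sum>i\<in>T. \<Sum>j\<in>{j. j \<in> T \<and> j < i}. a i j) = (\<Sum>j\<in>T. \<Sum>i\<in>{i. i \<in> T \<and> j < i}. a i j)"
    by (rule sum.swap_restrict) auto
  also have "\<dots> = (\<Sum>j\<in>T. \<Sum>i\<in>{i. i \<in> T \<and> j < i}. - a j i)"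
    by (intro sum.cong refl) (use swap in auto)
  finally show "delta (delta u) T = 0 T" by (simp add: sum_negf)
qed

text \<open>The contracting homotopy available once variable \<open>j\<close> is inverted. It is
  defined on all Laurent cochains, but its values may have denominators in \<open>lvar j\<close>
  that the index set does not permit.\<close>

definition homotopy :: "'n::{finite,linorder} \<Rightarrow> ('n, 'k::field) cochain \<Rightarrow> ('n, 'k) cochain" where
  "homotopy j u = (\<lambda>S. if j \<in> S then 0 else cech_sign (insert j S) j * u (insert j S))"

lemma homotopy_0: "homotopy j 0 = 0"
  by (rule ext) (simp add: homotopy_def)

text \<open>For \<open>j\<close> in \<open>T\<close> only the summand that removes \<open>j\<close>
  survives; for \<open>j\<close> outside \<open>T\<close> all terms but \<open>u T\<close> cancel in
  pairs.\<close>

lemma delta_homotopy: "delta (homotopy j u) + homotopy j (delta u) = (u :: ('n::{finite,linorder}, 'k::field) cochain)"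
proof
  fix T :: "'n set"
  show "(delta (homotopy j u) + homotopy j (delta u)) T = u T"
  proof (cases "j \<in> T")
    case True
    have "delta (homotopy j u) T = (\<Sum>i\<in>T. if i = j then u T else 0)"
      unfolding delta_def
    proof (rule sum.cong[OF refl])
      fix i assume "i \<in> T"
      then show "cech_sign T i * homotopy j u (T - {i}) = (if i = j then u T else 0)"
        using True by (cases "i = j") (auto simp: homotopy_def insert_absorb cech_sign_square)
    qed
    then show ?thesis using True by (simp add: homotopy_def)
  next
    case False
    define W where "W = insert j T"
    have h: "homotopy j (delta u) T =
        u T + (\<Sum>i\<in>T. cech_sign W j * (cech_sign W i * u (W - {i})))"
      using False by (simp add: homotopy_def delta_def W_def sum_distrib_left distrib_left cech_sign_square)
    have "cech_sign T i * homotopy j u (T - {i}) = - (cech_sign W j * (cech_sign W i * u (W - {i})))"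
      if i: "i \<in> T" for i
    proof -
      have "i \<noteq> j" using i False by auto
      have "insert j (T - {i}) = W - {i}" using \<open>i \<noteq> j\<close> by (auto simp: W_def)
      then have 1: "homotopy j u (T - {i}) = cech_sign (W - {i}) j * u (W - {i})"
        using False by (simp add: homotopy_def)
      have T: "T = W - {j}" using False by (auto simp: W_def)
      have 2: "cech_sign T i * cech_sign (W - {i}) j = - (cech_sign W j * (cech_sign W i :: ('n, 'k) laurent))"
      proof (cases "i < j")
        case True
        then show ?thesis
          using cech_sign_remove_lower[of i W j, where 'k = 'k] cech_sign_remove_upper[of i j W, where 'b = 'k] i
          by (simp add: T mult.commute)
      next
        case False
        then have "j < i" using \<open>i \<noteq> j\<close> by simp
        moreover have "j \<in> W" by (simp add: W_def)
        ultimately show ?thesis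
          using cech_sign_remove_lower[of j W i, where 'k = 'k] cech_sign_remove_upper[of j i W, where 'b = 'k]
          by (simp add: T mult.commute)
      qed
      show ?thesis unfolding 1 by (simp add: 2 flip: mult.assoc)
    qed
    then have "delta (homotopy j u) T = - (\<Sum>i\<in>T. cech_sign W j * (cech_sign W i * u (W - {i})))"
      unfolding delta_def by (simp add: sum_negf)
    then show ?thesis using h by simp
  qed
qed

text \<open>A power of the variable repairs the denominators; the sum of the exponents over all
  index sets serves for every component.\<close>

lemma cochains_homotopy:
  assumes J: "is_ideal J" and u: "u \<in> cochains J p r"
  shows "\<exists>N. scale_cochain (emb (mvar j ^ N)) (homotopy j u) \<in> cochains J (p - 1) (int N + r)"
proof -
  have "\<exists>N0. \<forall>N\<ge>N0. lvar j ^ N * u (insert j S) \<in> Loc J S (int N + r)"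
    if "j \<notin> S" "int (card S) = p - 1" for S
    using that by (intro Loc_drop[OF J] cochainsD[OF u]) auto
  then obtain N0 where N0: "\<And>S N. j \<notin> S \<Longrightarrow> int (card S) = p - 1 \<Longrightarrow> N \<ge> N0 S \<Longrightarrow>
      lvar j ^ N * u (insert j S) \<in> Loc J S (int N + r)"
    by metis
  define N where "N = (\<Sum>S\<in>UNIV. N0 S)"
  have N: "N \<ge> N0 S" for S
    unfolding N_def by (intro member_le_sum) auto
  have "scale_cochain (emb (mvar j ^ N)) (homotopy j u) \<in> cochains J (p - 1) (int N + r)"
  proof (rule cochainsI)
    fix S :: "'a set" assume S: "int (card S) = p - 1"
    show "scale_cochain (emb (mvar j ^ N)) (homotopy j u) S \<in> Loc J S (int N + r)"
    proof (cases "j \<in> S")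
      case False
      have "cech_sign (insert j S) j * (lvar j ^ N * u (insert j S)) \<in> Loc J S (int N + r)"
        by (intro Loc_cech_sign J N0 False S N)
      then show ?thesis
        using False by (simp add: scale_cochain_def homotopy_def emb_power emb_mvar mult.left_commute)
    qed (simp add: scale_cochain_def homotopy_def Loc_0 J)
  next
    fix S :: "'a set" assume "int (card S) \<noteq> p - 1"
    then show "scale_cochain (emb (mvar j ^ N)) (homotopy j u) S = 0"
      using cochains_0D[OF u, of "insert j S"] by (auto simp: scale_cochain_def homotopy_def)
  qed
  then show ?thesis ..
qed

section \<open>Cohomology of subquotients\<close>

text \<open>
  \<open>nontrivial_cohomology A B p r\<close> says that the local cohomology of \<open>B/A\<close> in cohomological degree
  \<open>p\<close> and internal degree \<open>r\<close> does not vanish.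
\<close>

definition nontrivial_cohomology ::
    "('n::{finite,linorder}, 'k::field) mpoly set \<Rightarrow> ('n, 'k) mpoly set \<Rightarrow> int \<Rightarrow> int \<Rightarrow> bool" where
  "nontrivial_cohomology A B p r \<longleftrightarrow>
     (\<exists>u\<in>cochains B p r. delta u \<in> cochains A (p + 1) r \<and>
        (\<forall>v\<in>cochains B (p - 1) r. u - delta v \<notin> cochains A p r))"

text \<open>The cochains representing zero in the cohomology of \<open>R/J\<close>: coboundaries of
  the polynomial ring up to cochains of \<open>J\<close>.\<close>

definition boundaries ::
    "('n::{finite,linorder}, 'k::field) mpoly set \<Rightarrow> int \<Rightarrow> int \<Rightarrow> ('n, 'k) cochain set" where
  "boundaries J p r = {u. \<exists>v\<in>cochains UNIV (p - 1) r. u - delta v \<in> cochains J p r}"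

lemma nontrivial_quotient_iff:
  "nontrivial_cohomology J UNIV p r \<longleftrightarrow>
     (\<exists>u\<in>cochains UNIV p r. delta u \<in> cochains J (p + 1) r \<and> u \<notin> boundaries J p r)"
  by (auto simp: nontrivial_cohomology_def boundaries_def)

lemma boundaries_zero: "is_ideal J \<Longrightarrow> 0 \<in> boundaries J p r"
  unfolding boundaries_def
  by (auto intro!: bexI[of _ 0] cochains_zero is_ideal_UNIV simp: delta_0)

lemma boundaries_add:
  assumes "is_ideal J" "u \<in> boundaries J p r" "w \<in> boundaries J p r"
  shows "u + w \<in> boundaries J p r"
proof -
  obtain v x where "v \<in> cochains UNIV (p - 1) r" "u - delta v \<in> cochains J p r"
    "x \<in> cochains UNIV (p - 1) r" "w - delta x \<in> cochains J p r"
    using assms(2,3) unfolding boundaries_def by blast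
  moreover have "u + w - delta (v + x) = (u - delta v) + (w - delta x)"
    by (simp add: delta_add)
  ultimately show ?thesis
    unfolding boundaries_def using cochains_add[OF assms(1)] cochains_add[OF is_ideal_UNIV]
    by (metis (mono_tags, lifting) mem_Collect_eq)
qed

lemma boundaries_scale:
  assumes "is_ideal J" "u \<in> boundaries J p r" "lhomog d (emb h)"
  shows "scale_cochain (emb h) u \<in> boundaries J p (d + r)"
proof -
  obtain v where "v \<in> cochains UNIV (p - 1) r" "u - delta v \<in> cochains J p r"
    using assms(2) unfolding boundaries_def by blast
  moreover have "scale_cochain (emb h) u - delta (scale_cochain (emb h) v) = scale_cochain (emb h) (u - delta v)"
    by (simp add: delta_scale scale_cochain_diff)
  ultimately show ?thesis
    unfolding boundaries_def using cochains_scale[OF assms(1) _ assms(3)] cochains_scale[OF is_ideal_UNIV _ assms(3)]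
    by (metis (mono_tags, lifting) mem_Collect_eq)
qed

text \<open>Multiplied by a power of variable \<open>j\<close>, the homotopy becomes a map of the
  complexes involved and exhibits that multiple of the cocycle as a boundary. The passage from
  variables to a linear form is \<open>lform_power_in_graded\<close>.\<close>

lemma cohomology_torsion:
  fixes J :: "('n::{finite,linorder}, 'k::field) mpoly set"
  assumes J: "is_ideal J" and u: "u \<in> cochains UNIV p r" and du: "delta u \<in> cochains J (p + 1) r"
  shows "\<exists>M. scale_cochain (emb (lform c ^ M)) u \<in> boundaries J p (int M + r)"
proof -
  define T where "T d = {f :: ('n, 'k) mpoly. homog d f \<and> scale_cochain (emb f) u \<in> boundaries J p (int d + r)}" for d
  have "\<exists>M. lform c ^ M \<in> T M"
  proof (rule lform_power_in_graded)
    fix d f g assume "f \<in> T d" "g \<in> T d"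
    moreover have "scale_cochain (emb (f + g)) u = scale_cochain (emb f) u + scale_cochain (emb g) u"
      by (auto simp: scale_cochain_def emb_add algebra_simps)
    ultimately show "f + g \<in> T d" by (simp add: T_def homog_add boundaries_add J)
  next
    fix d e and f h :: "('n, 'k) mpoly" assume f: "f \<in> T d" and h: "homog e h"
    have "scale_cochain (emb h) (scale_cochain (emb f) u) \<in> boundaries J p (int e + (int d + r))"
      using f h by (intro boundaries_scale[OF J, of _ p "int d + r"]) (simp_all add: T_def lhomog_emb_homog)
    then show "h * f \<in> T (e + d)"
      using f h by (simp add: T_def homog_mult scale_cochain_scale emb_mult add.assoc)
  next
    fix d
    have "scale_cochain (emb 0) u = 0" by (auto simp: scale_cochain_def emb_0)
    then show "0 \<in> T d" by (simp add: T_def boundaries_zero J)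
  next
    fix j
    obtain N1 where N1: "scale_cochain (emb (mvar j ^ N1)) (homotopy j u) \<in> cochains UNIV (p - 1) (int N1 + r)"
      using cochains_homotopy[OF is_ideal_UNIV u] by blast
    obtain N2 where N2: "scale_cochain (emb (mvar j ^ N2)) (homotopy j (delta u)) \<in> cochains J p (int N2 + r)"
      using cochains_homotopy[OF J du] by auto
    have hp: "lhomog (int N) (emb (mvar j ^ N))" for N
      by (simp add: emb_power emb_mvar lhomog_lvar_power)
    define N where "N = N1 + N2"
    have 1: "scale_cochain (emb (mvar j ^ N)) (homotopy j u) \<in> cochains UNIV (p - 1) (int N + r)"
      using cochains_scale[OF is_ideal_UNIV N1 hp, of N2]
      by (simp add: scale_cochain_scale emb_mult[symmetric] power_add[symmetric] N_def add_ac)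
    have 2: "scale_cochain (emb (mvar j ^ N)) (homotopy j (delta u)) \<in> cochains J p (int N + r)"
      using cochains_scale[OF J N2 hp, of N1]
      by (simp add: scale_cochain_scale emb_mult[symmetric] power_add[symmetric] N_def add_ac)
    have "scale_cochain (emb (mvar j ^ N)) u - delta (scale_cochain (emb (mvar j ^ N)) (homotopy j u)) =
        scale_cochain (emb (mvar j ^ N)) (homotopy j (delta u))"
      using arg_cong[OF delta_homotopy[of j u], of "scale_cochain (emb (mvar j ^ N))"]
      by (simp add: delta_scale scale_cochain_add algebra_simps)
    then have "scale_cochain (emb (mvar j ^ N)) u \<in> boundaries J p (int N + r)"
      unfolding boundaries_def using 1 2 by (metis (mono_tags, lifting) mem_Collect_eq)
    then have "mvar j ^ N \<in> T N"
      using homog_power[OF homog_mvar, of N j] by (simp add: T_def)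
    then show "\<exists>N. mvar j ^ N \<in> T N" ..
  qed
  then show ?thesis by (auto simp: T_def)
qed

section \<open>Cutting down by a filter-regular linear form\<close>

context
  fixes J :: "('n::{finite,linorder}, 'k::field) mpoly set" and z :: "('n, 'k) mpoly" and c
  assumes J: "homogeneous_ideal J" and z: "z = lform c" and reg: "filter_regular z J"
begin

lemma cut_ideal: "is_ideal J"
  using J by (rule homogeneous_imp_ideal)

lemma cut_ideal': "is_ideal (ideal_plus J z)"
  by (rule is_ideal_ideal_plus[OF cut_ideal])

lemma cut_lhomog: "lhomog 1 (emb z)"
  using lhomog_emb_homog[of 1 z] homog_lform[of c] by (simp add: z)

text \<open>For \<open>p \<ge> 1\<close> all index sets are nonempty, where \<open>z\<close> is a
  nonzerodivisor modulo \<open>J\<close>. In degree 0 the torsion of \<open>R/J\<close> is an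
  obstruction.\<close>

lemma cochains_filter_regular:
  assumes "p \<ge> 1" "u \<in> cochains UNIV p r" "scale_cochain (emb z) u \<in> cochains J p r'"
  shows "u \<in> cochains J p r"
proof (rule cochainsI)
  fix S :: "'n set" assume S: "int (card S) = p"
  have "S \<noteq> {}" using S assms(1) by auto
  moreover have "emb z * u S \<in> Loc J S r'"
    using cochainsD[OF assms(3) S] by (simp add: scale_cochain_def)
  ultimately show "u S \<in> Loc J S r"
    by (intro Loc_filter_regular[OF cut_ideal reg _ cochainsD[OF assms(2) S]])
qed (rule cochains_0D[OF assms(2)])

lemma cochains_ideal_plus:
  assumes "v \<in> cochains (ideal_plus J z) p r"
  obtains w u where "w \<in> cochains J p r" "u \<in> cochains UNIV p (r - 1)" "v = w + scale_cochain (emb z) u"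
proof -
  have "\<exists>w u. w \<in> Loc J S r \<and> u \<in> Loc UNIV S (r - 1) \<and> v S = w + emb z * u" if "int (card S) = p" for S
    using Loc_ideal_plus[OF J _ cochainsD[OF assms that]] homog_lform[of c] z by blast
  then obtain w u where wu: "\<And>S. int (card S) = p \<Longrightarrow>
      w S \<in> Loc J S r \<and> u S \<in> Loc UNIV S (r - 1) \<and> v S = w S + emb z * u S"
    by metis
  show ?thesis
  proof (rule that)
    show "(\<lambda>S. if int (card S) = p then w S else 0) \<in> cochains J p r"
      "(\<lambda>S. if int (card S) = p then u S else 0) \<in> cochains UNIV p (r - 1)"
      using wu by (auto intro!: cochainsI)
    show "v = (\<lambda>S. if int (card S) = p then w S else 0) +
        scale_cochain (emb z) (\<lambda>S. if int (card S) = p then u S else 0)"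
      using wu cochains_0D[OF assms] by (auto simp: scale_cochain_def)
  qed
qed

lemma cochains_scale_ideal_plus:
  assumes "u \<in> cochains UNIV p r"
  shows "scale_cochain (emb z) u \<in> cochains (ideal_plus J z) p (1 + r)"
proof (rule cochainsI)
  fix S :: "'n set" assume S: "int (card S) = p"
  obtain a f where f: "lprod S ^ a * u S = emb f" "lhomog r (u S)"
    using cochainsD[OF assms S] by (rule LocE)
  show "scale_cochain (emb z) u S \<in> Loc (ideal_plus J z) S (1 + r)"
    unfolding scale_cochain_def
  proof (rule LocI)
    show "lprod S ^ a * (emb z * u S) = emb (z * f)"
      by (simp add: emb_mult mult.left_commute f(1))
    show "z * f \<in> ideal_plus J z" by (rule ideal_plus_gen[OF cut_ideal])
    show "lhomog (1 + r) (emb z * u S)" by (rule lhomog_mult[OF cut_lhomog f(2)])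
  qed
qed (simp add: scale_cochain_def cochains_0D[OF assms])

text \<open>The last nonzero multiple of the class by a power of \<open>z\<close>; it exists since
  some power kills the class, and it is killed by \<open>z\<close>.\<close>

lemma torsion_top:
  assumes u: "u \<in> cochains UNIV p r" "delta u \<in> cochains J (p + 1) r" "u \<notin> boundaries J p r"
  obtains k where "scale_cochain (emb (z ^ k)) u \<notin> boundaries J p (int k + r)"
    "scale_cochain (emb z) (scale_cochain (emb (z ^ k)) u) \<in> boundaries J p (1 + (int k + r))"
proof -
  define P where "P k = (scale_cochain (emb (z ^ k)) u \<in> boundaries J p (int k + r))" for k
  have "\<exists>M. P M" using cohomology_torsion[OF cut_ideal u(1,2), of c] by (simp add: P_def z)
  moreover have "\<not> P 0" using u(3) by (simp add: P_def emb_1 scale_cochain_1)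
  ultimately obtain k where "\<not> P k" "P (Suc k)"
    using nat_induct[of "\<lambda>k. \<not> P k"] by blast
  then show ?thesis
    using that[of k] by (simp add: P_def scale_cochain_scale emb_mult add_ac)
qed

text \<open>A nonzero class killed by \<open>z\<close> is the image of a nonzero class under the
  connecting map. The preimage is the cochain \<open>v\<close> whose coboundary agrees with
  \<open>z * u\<close> modulo \<open>J\<close>.\<close>

lemma nontrivial_cut_lower:
  assumes p: "p \<ge> 0" and nz: "nontrivial_cohomology J UNIV (p + 1) r"
  shows "\<exists>k. nontrivial_cohomology (ideal_plus J z) UNIV p (r + int k + 1)"
proof -
  obtain u0 where u0: "u0 \<in> cochains UNIV (p + 1) r" "delta u0 \<in> cochains J (p + 1 + 1) r"
    "u0 \<notin> boundaries J (p + 1) r"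
    using nz unfolding nontrivial_quotient_iff by blast
  obtain k where k: "scale_cochain (emb (z ^ k)) u0 \<notin> boundaries J (p + 1) (int k + r)"
    "scale_cochain (emb z) (scale_cochain (emb (z ^ k)) u0) \<in> boundaries J (p + 1) (1 + (int k + r))"
    using u0 by (rule torsion_top)
  define u where "u = scale_cochain (emb (z ^ k)) u0"
  define s where "s = int k + r"
  have "lhomog (int k) (emb (z ^ k))"
    using lhomog_power[OF cut_lhomog, of k] by (simp add: emb_power)
  then have u: "u \<in> cochains UNIV (p + 1) s"
    unfolding u_def s_def by (intro cochains_scale is_ideal_UNIV u0)
  obtain v where v: "v \<in> cochains UNIV p (1 + s)"
    "scale_cochain (emb z) u - delta v \<in> cochains J (p + 1) (1 + s)"
    using k(2) by (auto simp: boundaries_def u_def s_def)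
  define w where "w = scale_cochain (emb z) u - delta v"
  have "delta v = scale_cochain (emb z) u - w" by (simp add: w_def)
  also have "\<dots> \<in> cochains (ideal_plus J z) (p + 1) (1 + s)"
    using v(2) ideal_plus_superset
    by (intro cochains_diff cut_ideal' cochains_scale_ideal_plus u) (auto simp: w_def intro: cochains_mono)
  finally have dv: "delta v \<in> cochains (ideal_plus J z) (p + 1) (1 + s)" .
  \<comment> \<open>If \<open>v\<close> bounds modulo \<open>(J,z)\<close>, its coboundary becomes
    that of an element of \<open>J\<close> plus \<open>z\<close> times a coboundary; cancelling
    \<open>z\<close> shows that \<open>u\<close> bounds modulo \<open>J\<close>.\<close>
  have "v \<notin> boundaries (ideal_plus J z) p (1 + s)"
  proof
    assume "v \<in> boundaries (ideal_plus J z) p (1 + s)"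
    then obtain x where x: "x \<in> cochains UNIV (p - 1) (1 + s)" "v - delta x \<in> cochains (ideal_plus J z) p (1 + s)"
      unfolding boundaries_def by blast
    obtain j y where jy: "j \<in> cochains J p (1 + s)" "y \<in> cochains UNIV p (1 + s - 1)"
      "v - delta x = j + scale_cochain (emb z) y"
      using x(2) by (rule cochains_ideal_plus)
    have y: "y \<in> cochains UNIV p s" using jy(2) by simp
    have "delta (v - delta x) = delta (j + scale_cochain (emb z) y)"
      by (simp only: jy(3))
    then have dv': "delta v = delta j + scale_cochain (emb z) (delta y)"
      by (simp add: delta_diff delta_add delta_delta delta_scale)
    then have "scale_cochain (emb z) (u - delta y) = w + delta j"
      by (simp add: w_def scale_cochain_diff)
    moreover have "w + delta j \<in> cochains J (p + 1) (1 + s)"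
      unfolding w_def by (intro cochains_add cut_ideal v(2) cochains_delta jy(1))
    ultimately have zu: "scale_cochain (emb z) (u - delta y) \<in> cochains J (p + 1) (1 + s)"
      by simp
    have "u - delta y \<in> cochains UNIV (p + 1) s"
      by (intro cochains_diff is_ideal_UNIV u cochains_delta y)
    from cochains_filter_regular[OF _ this zu]
    have "u - delta y \<in> cochains J (p + 1) s" using p by simp
    then have "u \<in> boundaries J (p + 1) s"
      using y by (auto simp: boundaries_def)
    then show False using k(1) by (simp add: u_def s_def)
  qed
  then have "nontrivial_cohomology (ideal_plus J z) UNIV p (1 + s)"
    unfolding nontrivial_quotient_iff using v(1) dv by blast
  then show ?thesis by (intro exI[of _ k]) (simp add: s_def add_ac)
qed

text \<open>Exactness at the cohomology of \<open>R/(J,z)\<close>: if the image \<open>u\<close> of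
  \<open>v\<close> under the connecting map bounds, \<open>v\<close> can be corrected to a cocycle
  modulo \<open>J\<close>, and if that one bounds too, \<open>v\<close> bounds.\<close>

lemma nontrivial_cut_upper:
  assumes p: "p \<ge> 0" and nz: "nontrivial_cohomology (ideal_plus J z) UNIV p r"
  shows "nontrivial_cohomology J UNIV p r \<or> nontrivial_cohomology J UNIV (p + 1) (r - 1)"
proof (rule ccontr)
  assume not: "\<not> ?thesis"
  obtain v where v: "v \<in> cochains UNIV p r" "delta v \<in> cochains (ideal_plus J z) (p + 1) r"
    "v \<notin> boundaries (ideal_plus J z) p r"
    using nz unfolding nontrivial_quotient_iff by blast
  obtain w u where wu: "w \<in> cochains J (p + 1) r" "u \<in> cochains UNIV (p + 1) (r - 1)"
    "delta v = w + scale_cochain (emb z) u"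
    using v(2) by (rule cochains_ideal_plus)
  have "scale_cochain (emb z) (delta u) = - delta w"
    using arg_cong[OF wu(3), of delta] by (simp add: delta_delta delta_add delta_scale add_eq_0_iff2)
  moreover have "- delta w \<in> cochains J (p + 1 + 1) r"
    using cochains_diff[OF cut_ideal cochains_zero[OF cut_ideal] cochains_delta[OF cut_ideal wu(1)]] by simp
  \<comment> \<open>Since \<open>delta (delta v) = 0\<close>, the multiple by \<open>z\<close> of
    \<open>delta u\<close> lies in \<open>J\<close>; cancelling \<open>z\<close> makes
    \<open>u\<close> a cocycle modulo \<open>J\<close>.\<close>
  ultimately have zdu: "scale_cochain (emb z) (delta u) \<in> cochains J (p + 1 + 1) r"
    by simp
  from cochains_filter_regular[OF _ cochains_delta[OF is_ideal_UNIV wu(2)] zdu]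
  have "delta u \<in> cochains J (p + 1 + 1) (r - 1)" using p by simp
  then obtain y where y: "y \<in> cochains UNIV p (r - 1)" "u - delta y \<in> cochains J (p + 1) (r - 1)"
    using not wu(2) unfolding nontrivial_quotient_iff by (auto simp: boundaries_def)
  define v' where "v' = v - scale_cochain (emb z) y"
  have zy: "scale_cochain (emb z) y \<in> cochains UNIV p r"
    using cochains_scale[OF is_ideal_UNIV y(1) cut_lhomog] by simp
  have "delta v' = w + scale_cochain (emb z) (u - delta y)"
    by (simp add: v'_def delta_diff delta_scale scale_cochain_diff wu(3))
  also have "\<dots> \<in> cochains J (p + 1) r"
    using cochains_scale[OF cut_ideal y(2) cut_lhomog] by (intro cochains_add cut_ideal wu(1)) simp
  finally have "delta v' \<in> cochains J (p + 1) r" .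
  moreover have "v' \<in> cochains UNIV p r"
    unfolding v'_def by (intro cochains_diff is_ideal_UNIV v(1) zy)
  ultimately obtain x where x: "x \<in> cochains UNIV (p - 1) r" "v' - delta x \<in> cochains J p r"
    using not unfolding nontrivial_quotient_iff by (auto simp: boundaries_def)
  have "v - delta x = (v' - delta x) + scale_cochain (emb z) y" by (simp add: v'_def)
  also have "\<dots> \<in> cochains (ideal_plus J z) p r"
    using cochains_scale_ideal_plus[OF y(1)] x(2) ideal_plus_superset
    by (intro cochains_add cut_ideal') (auto intro: cochains_mono)
  finally show False using v(3) x(1) by (auto simp: boundaries_def)
qed

lemma boundaries_degree_0: "boundaries J 0 r = cochains J 0 r"
proof (intro equalityI subsetI)
  fix u assume "u \<in> boundaries J 0 r"
  then obtain v where v: "v \<in> cochains UNIV (- 1) r" "u - delta v \<in> cochains J 0 r"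
    by (auto simp: boundaries_def)
  have "v = 0" by (rule cochains_minus_1[OF v(1)])
  then show "u \<in> cochains J 0 r" using v(2) by (simp add: delta_0)
next
  fix u assume "u \<in> cochains J 0 r"
  then show "u \<in> boundaries J 0 r"
    by (auto simp: boundaries_def delta_0 intro!: bexI[of _ 0] cochains_zero is_ideal_UNIV)
qed

text \<open>By filter-regularity an element of the colon ideal falls into \<open>J\<close> after
  localizing at any one variable, so it is a class in cohomological degree 0.\<close>

lemma nontrivial_of_degs:
  assumes "d \<in> degs J z"
  shows "nontrivial_cohomology J UNIV 0 (int d)"
proof -
  obtain f where f: "homog d f" "z * f \<in> J" "f \<notin> J"
    using assms by (auto simp: degs_def)
  have hf: "lhomog (int d) (emb f)" using f(1) by (simp add: lhomog_emb_homog)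
  define u :: "('n, 'k) cochain" where "u = (\<lambda>S. if S = {} then emb f else 0)"
  have "u \<in> cochains UNIV 0 (int d)"
    by (rule cochainsI) (use hf in \<open>auto simp: u_def Loc_empty\<close>)
  moreover have "delta u \<in> cochains J (0 + 1) (int d)"
  proof (rule cochainsI)
    fix T :: "'n set" assume "int (card T) = 0 + 1"
    then have "card T = 1" by simp
    then obtain i where T: "T = {i}" by (auto simp: card_1_singleton_iff)
    obtain N where N: "mvar i ^ N * f \<in> J" using reg f(2) by (auto simp: filter_regular_def)
    have "emb f \<in> Loc J {i} (int d)"
    proof (rule LocI)
      show "lprod {i} ^ N * emb f = emb (mvar i ^ N * f)"
        by (simp add: lprod_def emb_mult emb_power emb_mvar)
    qed (use N hf in auto)
    then show "delta u T \<in> Loc J T (int d)"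
      by (simp add: T delta_def u_def Loc_cech_sign cut_ideal)
  next
    fix T :: "'n set" assume T: "int (card T) \<noteq> 0 + 1"
    have "T - {i} \<noteq> {}" if "i \<in> T" for i
      using T that by (metis card_1_singleton_iff Diff_eq_empty_iff One_nat_def add_0 insert_absorb of_nat_1 subset_singletonD empty_iff)
    then show "delta u T = 0" by (auto simp: delta_def u_def intro!: sum.neutral)
  qed
  moreover have "u \<notin> boundaries J 0 (int d)"
  proof
    assume "u \<in> boundaries J 0 (int d)"
    then have "u {} \<in> Loc J {} (int d)"
      unfolding boundaries_degree_0 by (rule cochainsD) simp
    then show False using f(3) by (auto simp: u_def Loc_empty)
  qed
  ultimately show ?thesis unfolding nontrivial_quotient_iff by blast
qed

text \<open>The last multiple of a torsion element by a power of \<open>z\<close> that stays outside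
  \<open>J\<close> lies in the colon ideal. Its degree is at least \<open>r\<close>, hence an
  inequality in the conclusion.\<close>

lemma degs_of_nontrivial:
  assumes "nontrivial_cohomology J UNIV 0 r"
  shows "\<exists>d\<in>degs J z. r \<le> int d"
proof -
  obtain u where u: "u \<in> cochains UNIV 0 r" "delta u \<in> cochains J (0 + 1) r" "u \<notin> boundaries J 0 r"
    using assms unfolding nontrivial_quotient_iff by blast
  obtain f where f: "u {} = emb f" "lhomog r (emb f)"
    using cochainsD[OF u(1), of "{}"] by (auto simp: Loc_empty)
  have hom: "lhomog (int k) (emb (z ^ k))" for k
    using lhomog_power[OF cut_lhomog, of k] by (simp add: emb_power)
  have iff: "scale_cochain (emb g) u \<in> boundaries J 0 s \<longleftrightarrow> g * f \<in> J" if "lhomog s (emb (g * f))" for g s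
  proof
    assume "scale_cochain (emb g) u \<in> boundaries J 0 s"
    then have "emb g * u {} \<in> Loc J {} s"
      unfolding boundaries_degree_0 by (drule_tac cochainsD[of _ _ _ _ "{}"]) (simp_all add: scale_cochain_def)
    then show "g * f \<in> J" by (auto simp: f Loc_empty simp flip: emb_mult)
  next
    assume g: "g * f \<in> J"
    show "scale_cochain (emb g) u \<in> boundaries J 0 s"
      unfolding boundaries_degree_0
    proof (rule cochainsI)
      fix S :: "'n set" assume "int (card S) = 0"
      then have "S = {}" by simp
      then show "scale_cochain (emb g) u S \<in> Loc J S s"
        using g that by (auto simp: scale_cochain_def f Loc_empty simp flip: emb_mult)
    next
      fix S :: "'n set" assume "int (card S) \<noteq> 0"
      then show "scale_cochain (emb g) u S = 0"
        using cochains_0D[OF u(1)] by (simp add: scale_cochain_def)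
    qed
  qed
  have hz: "lhomog (int k + r) (emb (z ^ k * f))" for k
    unfolding emb_mult by (rule lhomog_mult[OF hom f(2)])
  obtain k where k: "scale_cochain (emb (z ^ k)) u \<notin> boundaries J 0 (int k + r)"
    "scale_cochain (emb z) (scale_cochain (emb (z ^ k)) u) \<in> boundaries J 0 (1 + (int k + r))"
    using u by (rule torsion_top)
  have nJ: "z ^ k * f \<notin> J" using k(1) iff[OF hz] by blast
  moreover have "z * (z ^ k * f) \<in> J"
    using k(2) iff[of "1 + (int k + r)" "z * z ^ k"] hz[of "Suc k"]
    by (simp add: scale_cochain_scale emb_mult[symmetric] mult.assoc add.assoc)
  moreover have "z ^ k * f \<noteq> 0" using nJ ideal_0[OF cut_ideal] by metis
  then obtain m where m: "m \<in> keys (z ^ k * f)" by (metis ex_in_conv keys_eq_empty)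
  then have d: "int (mdeg m) = int k + r" using hz[of k] by (simp add: lhomog_emb)
  then have "homog (mdeg m) (z ^ k * f)" using hz[of k] by (simp flip: lhomog_emb_homog)
  ultimately have "mdeg m \<in> degs J z" by (auto simp: degs_def)
  then show ?thesis using d by (intro bexI[of _ "mdeg m"]) auto
qed

end

section \<open>Comparison of weighted degree sets\<close>

text \<open>Domination in both directions gives equal suprema, and no case distinction between
  empty, bounded and unbounded sets arises.\<close>

definition cofinal_le :: "real set \<Rightarrow> real set \<Rightarrow> bool" where
  "cofinal_le A B \<longleftrightarrow> (\<forall>a\<in>A. \<exists>b\<in>B. a \<le> b)"

text \<open>The supremum of this set is \<open>reg\<^sub>t\<close> for \<open>c = 1\<close> and \<open>a\<^sup>*\<^sub>t\<close> for \<open>c = 0\<close>.\<close>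

definition weighted_degrees ::
    "('n::{finite,linorder}, 'k::field) mpoly set \<Rightarrow> ('n, 'k) mpoly set \<Rightarrow> real \<Rightarrow> nat \<Rightarrow> real set" where
  "weighted_degrees A B c t =
     {real_of_int r + c * real i | i r. i \<le> t \<and> nontrivial_cohomology A B (int i) r}"

lemma weighted_degreesI:
  "i \<le> t \<Longrightarrow> nontrivial_cohomology A B (int i) r \<Longrightarrow> real_of_int r + c * real i \<in> weighted_degrees A B c t"
  unfolding weighted_degrees_def by blast

text \<open>Two filter-regular sequences of linear forms whose colon quotients have the same degrees
  at every stage. The relation is symmetric, so a one-sided comparison is enough.\<close>

inductive matching ::
    "('n::{finite,linorder}, 'k::field) mpoly set \<Rightarrow> ('n, 'k) mpoly list \<Rightarrow>
     ('n, 'k) mpoly set \<Rightarrow> ('n, 'k) mpoly list \<Rightarrow> bool" where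
  Nil: "matching J [] J' []"
| Cons: "homogeneous_ideal J \<Longrightarrow> homogeneous_ideal J' \<Longrightarrow> z = lform a \<Longrightarrow> z' = lform a' \<Longrightarrow>
    filter_regular z J \<Longrightarrow> filter_regular z' J' \<Longrightarrow> degs J z = degs J' z' \<Longrightarrow>
    matching (ideal_plus J z) zs (ideal_plus J' z') zs' \<Longrightarrow> matching J (z # zs) J' (z' # zs')"

lemma matching_sym: "matching J zs J' zs' \<Longrightarrow> matching J' zs' J zs"
  by (induction rule: matching.induct) (auto intro: matching.intros)

text \<open>Each cut consumes one linear form and lowers the bound \<open>t\<close> by one, which
  explains \<open>t < length zs\<close>. Cohomological degree 0 is read off from the common degrees,
  higher degrees by going down to the cut on one side and back up on the other.\<close>

lemma weighted_degrees_matching: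
  assumes "matching J zs J' zs'" "t < length zs" "c \<le> 1"
  shows "cofinal_le (weighted_degrees J UNIV c t) (weighted_degrees J' UNIV c t)"
  using assms(1,2)
proof (induction arbitrary: t rule: matching.induct)
  case (Cons J J' z a z' a' zs zs')
  have "\<exists>y\<in>weighted_degrees J' UNIV c t. real_of_int r + c * real i \<le> y"
    if i: "i \<le> t" "nontrivial_cohomology J UNIV (int i) r" for i r
  proof (cases i)
    case 0
    then obtain d where d: "d \<in> degs J z" "r \<le> int d"
      using degs_of_nontrivial[OF Cons(1,3,5)] i(2) by auto
    then have "nontrivial_cohomology J' UNIV (int 0) (int d)"
      using nontrivial_of_degs[OF Cons(2,4,6), of d] Cons(7) by simp
    then have "real_of_int (int d) + c * real 0 \<in> weighted_degrees J' UNIV c t"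
      by (intro weighted_degreesI) auto
    then show ?thesis using d(2) 0 by (intro bexI) auto
  next
    case (Suc i')
    then obtain t' where t: "t = Suc t'" using i(1) by (cases t) auto
    have "nontrivial_cohomology J UNIV (int i' + 1) r" using i(2) Suc by (simp add: add.commute)
    then obtain k where k: "nontrivial_cohomology (ideal_plus J z) UNIV (int i') (r + int k + 1)"
      using nontrivial_cut_lower[OF Cons(1,3,5), of "int i'" r] by auto
    have "t' < length zs" using Cons.prems t by simp
    moreover have "real_of_int (r + int k + 1) + c * real i' \<in> weighted_degrees (ideal_plus J z) UNIV c t'"
      using k i(1) Suc t by (intro weighted_degreesI) auto
    ultimately obtain y where "y \<in> weighted_degrees (ideal_plus J' z') UNIV c t'"
      "real_of_int (r + int k + 1) + c * real i' \<le> y"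
      using Cons.IH unfolding cofinal_le_def by blast
    then obtain i2 r2 where 2: "i2 \<le> t'" "nontrivial_cohomology (ideal_plus J' z') UNIV (int i2) r2"
      "real_of_int (r + int k + 1) + c * real i' \<le> real_of_int r2 + c * real i2"
      by (auto simp: weighted_degrees_def)
    have "nontrivial_cohomology J' UNIV (int i2) r2 \<or> nontrivial_cohomology J' UNIV (int i2 + 1) (r2 - 1)"
      using nontrivial_cut_upper[OF Cons(2,4,6) _ 2(2)] by simp
    then show ?thesis
    proof
      assume "nontrivial_cohomology J' UNIV (int i2) r2"
      then have "real_of_int r2 + c * real i2 \<in> weighted_degrees J' UNIV c t"
        using 2(1) t by (intro weighted_degreesI) auto
      \<comment> \<open>Going down lowers the index by one, a loss of \<open>c\<close>, and raises
        the degree by \<open>k + 1\<close>, which is at least \<open>c\<close>.\<close>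
      moreover have "real_of_int r + c * real i \<le> real_of_int r2 + c * real i2"
        using 2(3) \<open>c \<le> 1\<close> Suc by (simp add: algebra_simps)
      ultimately show ?thesis by blast
    next
      assume "nontrivial_cohomology J' UNIV (int i2 + 1) (r2 - 1)"
      then have "real_of_int (r2 - 1) + c * real (Suc i2) \<in> weighted_degrees J' UNIV c t"
        using 2(1) t by (intro weighted_degreesI) (auto simp: add.commute)
      \<comment> \<open>Going back up costs \<open>1 - c\<close>, covered by the gain
        \<open>k + 1 - c\<close> from going down.\<close>
      moreover have "real_of_int r + c * real i \<le> real_of_int (r2 - 1) + c * real (Suc i2)"
        using 2(3) \<open>c \<le> 1\<close> Suc by (simp add: algebra_simps)
      ultimately show ?thesis by blast
    qed
  qed
  then show ?case unfolding cofinal_le_def weighted_degrees_def by blast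
qed auto

section \<open>From an ideal to its quotient\<close>

text \<open>The signs are constants, so the differential respects the grading by exponent
  vectors.\<close>

lemma delta_restrict_keys:
  fixes u :: "('n::{finite,linorder}, 'k::field) cochain"
  shows "delta (\<lambda>S. restrict_keys P (u S)) = (\<lambda>T. restrict_keys P (delta u T))"
proof (intro ext poly_mapping_eqI)
  fix T e
  have "lookup (cech_sign T i * restrict_keys P f) e = lookup (restrict_keys P (cech_sign T i * f)) e"
    for i and f :: "('n, 'k) laurent"
    by (cases "even (card {j \<in> T. j < i})") (simp_all add: cech_sign_def lookup_restrict_keys when_def)
  then show "lookup (delta (\<lambda>S. restrict_keys P (u S)) T) e = lookup (restrict_keys P (delta u T)) e"
    by (simp add: delta_def lookup_sum lookup_restrict_keys when_def)
qed

text \<open>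
  Contracting a monomial \<open>x\<^sup>e\<close> along a variable with nonnegative exponent keeps it inside the
  complex, so only monomials with all exponents negative contribute to the cohomology of the
  polynomial ring.
\<close>

lemma polynomial_ring_exact:
  fixes u :: "('n::{finite,linorder}, 'k::field) cochain"
  assumes u: "u \<in> cochains UNIV p r" and du: "delta u = 0"
    and ex: "\<And>S e. e \<in> keys (u S) \<Longrightarrow> \<exists>i. lookup e i \<ge> 0"
  shows "\<exists>v\<in>cochains UNIV (p - 1) r. u = delta v"
proof -
  \<comment> \<open>The direction of contraction depends on the exponent alone and not on the index
    set, so each \<open>part j\<close> is again a cocycle.\<close>
  define sel where "sel e = (SOME i. lookup e i \<ge> 0)" for e :: "'n \<Rightarrow>\<^sub>0 int"
  have sel: "lookup e (sel e) \<ge> 0" if "e \<in> keys (u S)" for e S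
    unfolding sel_def using ex[OF that] by (rule someI_ex)
  define part where "part j S = restrict_keys (\<lambda>e. sel e = j) (u S)" for j S
  have "delta (part j) = 0" for j
    unfolding part_def[abs_def] delta_restrict_keys
    by (intro ext poly_mapping_eqI) (simp add: du lookup_restrict_keys)
  then have part: "part j = delta (homotopy j (part j))" for j
    using delta_homotopy[of j "part j"] by (simp only: homotopy_0 add_0_right)
  have h: "homotopy j (part j) \<in> cochains UNIV (p - 1) r" for j
  proof (rule cochainsI)
    fix S :: "'n set" assume S: "int (card S) = p - 1"
    show "homotopy j (part j) S \<in> Loc UNIV S r"
    proof (cases "j \<in> S")
      case True
      then show ?thesis by (simp add: homotopy_def Loc_0 is_ideal_UNIV)
    next
      case False
      then have "int (card (insert j S)) = p" using S by simp
      then have "u (insert j S) \<in> Loc UNIV (insert j S) r" by (rule cochainsD[OF u])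
      then have 1: "lhomog r (u (insert j S))"
        "\<And>e i. e \<in> keys (u (insert j S)) \<Longrightarrow> i \<notin> insert j S \<Longrightarrow> lookup e i \<ge> 0"
        by (auto simp: Loc_UNIV_iff)
      have "lookup e i \<ge> 0" if "e \<in> keys (part j (insert j S))" "i \<notin> S" for e i
        using that 1(2)[of e i] sel[of e "insert j S"] by (cases "i = j") (auto simp: part_def keys_restrict_keys)
      then have "part j (insert j S) \<in> Loc UNIV S r"
        using 1(1) by (auto simp: Loc_UNIV_iff part_def keys_restrict_keys lhomog_def)
      then show ?thesis
        using False by (simp add: homotopy_def Loc_cech_sign is_ideal_UNIV)
    qed
  next
    fix S :: "'n set" assume "int (card S) \<noteq> p - 1"
    then show "homotopy j (part j) S = 0"
      using cochains_0D[OF u, of "insert j S"] by (auto simp: homotopy_def part_def restrict_keys_def)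
  qed
  have "u = (\<Sum>j\<in>UNIV. part j)"
  proof (intro ext poly_mapping_eqI)
    fix S e
    have ap: "(\<Sum>j\<in>A. part j) S = (\<Sum>j\<in>A. part j S)" for A
      by (induction A rule: infinite_finite_induct) auto
    show "lookup (u S) e = lookup ((\<Sum>j\<in>UNIV. part j) S) e"
      by (simp add: ap lookup_sum part_def lookup_restrict_keys when_def)
  qed
  also have "\<dots> = delta (\<Sum>j\<in>UNIV. homotopy j (part j))"
    unfolding delta_sum by (rule sum.cong[OF refl]) (rule part)
  finally show ?thesis
    using cochains_sum[OF is_ideal_UNIV h] by (intro bexI[of _ "\<Sum>j\<in>UNIV. homotopy j (part j)"]) auto
qed

text \<open>Below the top an exponent is nonnegative at any index outside \<open>S\<close>; in the
  top degree a vector with all entries negative has degree at most \<open>-n\<close>.\<close>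

lemma polynomial_ring_exact':
  fixes u :: "('n::{finite,linorder}, 'k::field) cochain"
  assumes u: "u \<in> cochains UNIV p r" and du: "delta u = 0"
    and p: "p < int CARD('n) \<or> (p = int CARD('n) \<and> r > - int CARD('n))"
  shows "\<exists>v\<in>cochains UNIV (p - 1) r. u = delta v"
proof (rule polynomial_ring_exact[OF u du])
  fix S e assume e: "e \<in> keys (u S)"
  then have S: "int (card S) = p" using cochains_0D[OF u, of S] by (cases "int (card S) = p") auto
  then have uS: "u S \<in> Loc UNIV S r" by (rule cochainsD[OF u])
  show "\<exists>i. lookup e i \<ge> 0"
    using p
  proof
    assume "p < int CARD('n)"
    then have "S \<noteq> UNIV" using S by auto
    then show ?thesis using uS e by (auto simp: Loc_UNIV_iff)
  next
    assume r: "p = int CARD('n) \<and> r > - int CARD('n)"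
    show ?thesis
    proof (rule ccontr)
      assume "\<not> ?thesis"
      then have neg: "lookup e i \<le> - 1" for i by (simp add: not_le) (metis not_le zle_diff1_eq diff_0)
      have "r = ldeg e" using uS e by (auto simp: Loc_UNIV_iff lhomog_def)
      also have "\<dots> \<le> (\<Sum>i\<in>(UNIV :: 'n set). - 1)"
        unfolding ldeg_def by (rule sum_mono) (rule neg)
      finally show False using r by simp
    qed
  qed
qed

lemma cochains_zero_ideal: "u \<in> cochains {0} p r \<longleftrightarrow> u = 0"
proof
  assume u: "u \<in> cochains {0} p r"
  have "u S = 0" for S
  proof (cases "int (card S) = p")
    case True
    obtain a f where "lprod S ^ a * u S = emb f" "f \<in> {0}"
      using cochainsD[OF u True] by (rule LocE)
    then show ?thesis using lprod_power_inject[of S a "u S" 0] by (simp add: emb_0)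
  qed (rule cochains_0D[OF u])
  then show "u = 0" by (intro ext) simp
qed (simp add: cochains_zero is_ideal_sing_0)

text \<open>The ideal is treated as the subquotient of \<open>I\<close> by the zero ideal, so that
  one predicate serves ideals and quotients.\<close>

lemma nontrivial_ideal_iff:
  "nontrivial_cohomology {0} I p r \<longleftrightarrow>
    (\<exists>u\<in>cochains I p r. delta u = 0 \<and> (\<forall>v\<in>cochains I (p - 1) r. u \<noteq> delta v))"
  by (simp add: nontrivial_cohomology_def cochains_zero_ideal)

context
  fixes I :: "('n::{finite,linorder}, 'k::field) mpoly set"
  assumes I: "homogeneous_ideal I"
begin

lemma ideal_I: "is_ideal I"
  using I by (rule homogeneous_imp_ideal)

text \<open>The connecting map from the cohomology of \<open>R/I\<close> is injective because that
  of \<open>R\<close> vanishes in cohomological degree \<open>p - 1\<close>, below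
  \<open>n\<close>.\<close>

lemma nontrivial_ideal_of_quotient:
  assumes p: "p \<le> int CARD('n)" and nz: "nontrivial_cohomology I UNIV (p - 1) r"
  shows "nontrivial_cohomology {0} I p r"
proof -
  obtain v where v: "v \<in> cochains UNIV (p - 1) r" "delta v \<in> cochains I p r" "v \<notin> boundaries I (p - 1) r"
    using nz unfolding nontrivial_quotient_iff by auto
  have "delta v \<noteq> delta w" if w: "w \<in> cochains I (p - 1) r" for w
  proof
    assume eq: "delta v = delta w"
    have w': "w \<in> cochains UNIV (p - 1) r" using w by (rule cochains_mono[rotated]) simp
    have "\<exists>y\<in>cochains UNIV (p - 1 - 1) r. v - w = delta y"
      using p eq v(1) w' by (intro polynomial_ring_exact' cochains_diff is_ideal_UNIV) (auto simp: delta_diff)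
    then obtain y where y: "y \<in> cochains UNIV (p - 1 - 1) r" "v - w = delta y" by blast
    then have "v - delta y = w" by (simp add: algebra_simps)
    then show False using v(3) w y(1) by (auto simp: boundaries_def)
  qed
  then show ?thesis
    unfolding nontrivial_ideal_iff using v(2) by (auto simp: delta_delta intro!: bexI[of _ "delta v"])
qed

text \<open>Here the connecting map is surjective, since the cohomology of \<open>R\<close> vanishes
  at \<open>(p, r)\<close> itself.\<close>

lemma nontrivial_quotient_of_ideal:
  assumes p: "p < int CARD('n) \<or> (p = int CARD('n) \<and> r > - int CARD('n))"
    and nz: "nontrivial_cohomology {0} I p r"
  shows "nontrivial_cohomology I UNIV (p - 1) r"
proof -
  obtain u where u: "u \<in> cochains I p r" "delta u = 0" "\<And>v. v \<in> cochains I (p - 1) r \<Longrightarrow> u \<noteq> delta v"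
    using nz unfolding nontrivial_ideal_iff by blast
  have "u \<in> cochains UNIV p r" using u(1) by (rule cochains_mono[rotated]) simp
  then obtain v where v: "v \<in> cochains UNIV (p - 1) r" "u = delta v"
    using polynomial_ring_exact'[OF _ u(2) p] by blast
  have "v \<notin> boundaries I (p - 1) r"
  proof
    assume "v \<in> boundaries I (p - 1) r"
    then obtain y where y: "v - delta y \<in> cochains I (p - 1) r"
      unfolding boundaries_def by blast
    have "delta (v - delta y) = u" by (simp add: delta_diff delta_delta v(2))
    then show False using u(3)[OF y] by simp
  qed
  then show ?thesis
    unfolding nontrivial_quotient_iff using v u(1) by auto
qed

lemma nontrivial_ideal_range:
  assumes "nontrivial_cohomology {0} I (int p) r"
  shows "1 \<le> p" "p \<le> CARD('n)"
proof -
  obtain u where u: "u \<in> cochains I (int p) r" "delta u = 0"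
    "\<And>v. v \<in> cochains I (int p - 1) r \<Longrightarrow> u \<noteq> delta v"
    using assms unfolding nontrivial_ideal_iff by blast
  have nz: "u \<noteq> 0" using u(3)[OF cochains_zero[OF ideal_I]] by (simp add: delta_0)
  then obtain S where "u S \<noteq> 0" by (metis ext zero_fun_apply)
  then have "card S = p" using cochains_0D[OF u(1), of S] by auto
  then show "p \<le> CARD('n)" by (metis card_mono finite subset_UNIV)
  show "1 \<le> p"
  proof (rule ccontr)
    assume "\<not> 1 \<le> p"
    then have p: "p = 0" by simp
    have "u \<in> cochains UNIV 0 r" using u(1) p by (intro cochains_mono[of I UNIV]) auto
    then obtain v where "v \<in> cochains UNIV (0 - 1) r" "u = delta v"
      using polynomial_ring_exact'[of u 0 r] u(2) by auto
    then have "u = 0" using cochains_minus_1[of v UNIV r] by (simp add: delta_0)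
    then show False using nz by simp
  qed
qed

text \<open>A multiple of an element of \<open>I\<close> by a Laurent monomial is made to contain
  the monomial whose exponents are all \<open>-1\<close>, which no coboundary contains.\<close>

lemma nontrivial_ideal_top:
  assumes "I \<noteq> {0}"
  shows "nontrivial_cohomology {0} I (int CARD('n)) (- int CARD('n))"
proof -
  obtain f0 where f0: "f0 \<in> I" "f0 \<noteq> 0" using assms ideal_0[OF ideal_I] by auto
  then obtain m where "m \<in> keys f0" by (metis ex_in_conv keys_eq_empty)
  define f where "f = homog_comp (mdeg m) f0"
  have f: "f \<in> I" "homog (mdeg m) f" using f0(1) I by (auto simp: f_def homogeneous_ideal_iff homog_homog_comp)
  have m: "m \<in> keys f" using \<open>m \<in> keys f0\<close> by (simp add: f_def in_keys_iff lookup_homog_comp)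
  define e :: "'n \<Rightarrow>\<^sub>0 int" where "e = - (\<Sum>i\<in>UNIV. single i 1)"
  have e: "lookup e i = - 1" for i
    by (simp add: e_def lookup_sum lookup_single when_def)
  \<comment> \<open>The shift moves the term of \<open>f\<close> at \<open>m\<close> to the exponent
    \<open>e\<close>.\<close>
  define w where "w = single (e - iexp m) 1 * emb f"
  define u :: "('n, 'k) cochain" where "u = (\<lambda>S. if S = UNIV then w else 0)"
  define m' where "m' = (\<Sum>i\<in>UNIV. single i (mdeg m)) - m"
  have m': "lookup m' i = mdeg m - lookup m i" for i
    by (simp add: m'_def lookup_minus lookup_sum lookup_single when_def)
  \<comment> \<open>With this power the exponent in variable \<open>i\<close> becomes
    \<open>mdeg m - lookup m i\<close>, which is nonnegative.\<close>
  define a where "a = mdeg m + 1"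
  have exps: "(\<Sum>i\<in>UNIV. single i (int a)) + (e - iexp m) = iexp m'"
    by (rule poly_mapping_eqI)
      (simp add: a_def lookup_add lookup_minus e m' lookup_sum lookup_single when_def of_nat_diff mdeg_ge_lookup)
  have lw: "lhomog (- int CARD('n)) w"
  proof -
    have "ldeg (e - iexp m) = - int CARD('n) - int (mdeg m)"
      using ldeg_iexp[of m] by (simp add: ldeg_def lookup_minus e sum_subtractf sum_negf)
    then have "lhomog (- int CARD('n) - int (mdeg m)) (single (e - iexp m) 1 :: ('n, 'k) laurent)"
      by (simp add: lhomog_def)
    from lhomog_mult[OF this, of "int (mdeg m)" "emb f"] show ?thesis
      using f(2) by (simp add: w_def lhomog_emb_homog)
  qed
  have "w \<in> Loc I UNIV (- int CARD('n))"
  proof (rule LocI)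
    show "lprod UNIV ^ a * w = emb (single m' 1 * f)"
      by (simp add: w_def lprod_power_single mult_single emb_mult emb_single exps flip: mult.assoc)
    show "single m' 1 * f \<in> I" by (rule ideal_mult[OF ideal_I f(1)])
  qed (rule lw)
  then have u: "u \<in> cochains I (int CARD('n)) (- int CARD('n))"
    by (intro cochainsI) (auto simp: u_def dest: card_eq_UNIV_imp_eq_UNIV[OF finite])
  have "delta u = 0"
  proof
    fix T :: "'n set"
    have "T - {i} \<noteq> UNIV" for i by auto
    then show "delta u T = 0 T" by (simp add: delta_def u_def)
  qed
  moreover have "u \<noteq> delta v" if v: "v \<in> cochains I (int CARD('n) - 1) (- int CARD('n))" for v
  proof
    assume eq: "u = delta v"
    have v': "v \<in> cochains UNIV (int CARD('n) - 1) (- int CARD('n))"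
      using v by (rule cochains_mono[rotated]) simp
    \<comment> \<open>Variable \<open>i\<close> is not inverted in the component that omits
      \<open>i\<close>, so the exponent \<open>-1\<close> cannot occur there.\<close>
    have "lookup (cech_sign UNIV i * v (UNIV - {i})) e = 0" for i
    proof -
      have "int (card (UNIV - {i} :: 'n set)) = int CARD('n) - 1"
        by (simp add: card_Diff_singleton of_nat_diff Suc_leI)
      then have "v (UNIV - {i}) \<in> Loc UNIV (UNIV - {i}) (- int CARD('n))" by (rule cochainsD[OF v'])
      then have "cech_sign UNIV i * v (UNIV - {i}) \<in> Loc UNIV (UNIV - {i}) (- int CARD('n))"
        by (rule Loc_cech_sign[OF is_ideal_UNIV])
      then show ?thesis
        using e[of i] by (force simp: Loc_UNIV_iff in_keys_iff)
    qed
    then have "lookup (delta v UNIV) e = 0" by (simp add: delta_def lookup_sum)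
    moreover have "lookup (u UNIV) e = lookup f m"
      using lookup_single_mult[of "e - iexp m" 1 "emb f" "iexp m"] by (simp add: u_def w_def lookup_emb)
    ultimately show False using m eq by (simp add: in_keys_iff)
  qed
  ultimately show ?thesis unfolding nontrivial_ideal_iff using u by blast
qed

end

text \<open>Both passages between an ideal and its quotient shift the cohomological degree by one,
  so the weights change by the same \<open>c\<close>. Quotient degrees reach at most
  \<open>n - 1\<close>, within the length of the sequence.\<close>

lemma weighted_degrees_ideal:
  fixes I I' :: "('n::{finite,linorder}, 'k::field) mpoly set"
  assumes I: "homogeneous_ideal I" and I': "homogeneous_ideal I'" "I' \<noteq> {0}"
    and match: "matching I zs I' zs'" "length zs = CARD('n)" and c: "c \<le> 1"
  shows "cofinal_le (weighted_degrees {0} I c t) (weighted_degrees {0} I' c t)"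
proof -
  have "\<exists>y\<in>weighted_degrees {0} I' c t. real_of_int r + c * real p \<le> y"
    if p: "p \<le> t" "nontrivial_cohomology {0} I (int p) r" for p r
  \<comment> \<open>In the excluded range the class may come from the top cohomology of
    \<open>R\<close>; it is dominated by the class in degree \<open>-n\<close> that
    \<open>I'\<close> has because it is nonzero.\<close>
  proof (cases "p = CARD('n) \<and> r \<le> - int CARD('n)")
    case True
    have "real_of_int (- int CARD('n)) + c * real p \<in> weighted_degrees {0} I' c t"
      using nontrivial_ideal_top[OF I'] True p(1) by (intro weighted_degreesI) auto
    moreover have "real_of_int r \<le> real_of_int (- int CARD('n))"
      using True by (simp only: of_int_le_iff)
    ultimately show ?thesis by (meson add_right_mono)
  next
    case False
    note range = nontrivial_ideal_range[OF I p(2)]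
    obtain q where q: "p = Suc q" using range(1) by (cases p) auto
    have "nontrivial_cohomology I UNIV (int p - 1) r"
      using False range(2) by (intro nontrivial_quotient_of_ideal[OF I _ p(2)]) auto
    then have "real_of_int r + c * real q \<in> weighted_degrees I UNIV c q"
      using q by (intro weighted_degreesI) auto
    moreover have "q < length zs" using range(2) q match(2) by simp
    ultimately obtain y where "y \<in> weighted_degrees I' UNIV c q" "real_of_int r + c * real q \<le> y"
      using weighted_degrees_matching[OF match(1) _ c] unfolding cofinal_le_def by blast
    then obtain i s where ir: "i \<le> q" "nontrivial_cohomology I' UNIV (int i) s"
      "real_of_int r + c * real q \<le> real_of_int s + c * real i"
      by (auto simp: weighted_degrees_def)
    have "nontrivial_cohomology {0} I' (int (Suc i)) s"
      using ir(1,2) range(2) q by (intro nontrivial_ideal_of_quotient[OF I'(1)]) auto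
    then have "real_of_int s + c * real (Suc i) \<in> weighted_degrees {0} I' c t"
      using ir(1) q p(1) by (intro weighted_degreesI) auto
    moreover have "real_of_int r + c * real p \<le> real_of_int s + c * real (Suc i)"
      using ir(3) q by (simp add: algebra_simps)
    ultimately show ?thesis by blast
  qed
  then show ?thesis unfolding cofinal_le_def weighted_degrees_def by blast
qed

section \<open>Identification with the graded local cohomology of an ideal\<close>

definition frac_val :: "'n set \<Rightarrow> ('n::finite, 'k::field) mpoly \<Rightarrow> nat \<Rightarrow> ('n, 'k) laurent" where
  "frac_val S m a = linv S ^ a * emb m"

text \<open>The class of the pair \<open>(m, a)\<close> corresponds to the Laurent polynomial \<open>m / x\<^sub>S\<^sup>a\<close>.\<close>

definition frac_class ::
    "('n::finite, 'k::field) mpoly set \<Rightarrow> 'n set \<Rightarrow> ('n, 'k) laurent \<Rightarrow> (('n, 'k) mpoly \<times> nat) set" where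
  "frac_class I S x = {(m, a). m \<in> I \<and> frac_val S m a = x}"

text \<open>The localization without a grading: the carrier of the monoid in which the finite sums
  of the Cech differential are formed.\<close>

definition Loc_all :: "('n::finite, 'k::field) mpoly set \<Rightarrow> 'n set \<Rightarrow> ('n, 'k) laurent set" where
  "Loc_all I S = {frac_val S m a | m a. m \<in> I}"

lemma frac_val_iff: "frac_val S m a = x \<longleftrightarrow> lprod S ^ a * x = emb m"
  unfolding frac_val_def by (metis lprod_power_cancel)

lemma frac_val_add:
  "frac_val S (var_prod S ^ b * m + var_prod S ^ a * m') (a + b) = frac_val S m a + frac_val S m' b"
proof -
  have "lprod S ^ (a + b) * (frac_val S m a + frac_val S m' b) =
      lprod S ^ b * (lprod S ^ a * frac_val S m a) + lprod S ^ a * (lprod S ^ b * frac_val S m' b)"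
    by (simp add: power_add distrib_left mult_ac)
  also have "\<dots> = emb (var_prod S ^ b * m + var_prod S ^ a * m')"
    by (simp add: frac_val_def lprod_power_cancel emb_add emb_mult emb_power emb_var_prod)
  finally show ?thesis by (simp add: frac_val_iff)
qed

lemma frac_val_mult: "frac_val S (f * m) a = emb f * frac_val S m a"
  by (simp add: frac_val_def emb_mult mult.left_commute)

lemma frac_val_extend:
  assumes "S \<subseteq> T"
  shows "frac_val T (var_prod (T - S) ^ a * m) a = frac_val S m a"
  unfolding frac_val_iff
  by (simp add: lprod_subset[OF assms] power_mult_distrib mult.assoc frac_val_def lprod_power_cancel
      emb_mult emb_power emb_var_prod)

context
  fixes I :: "('n::{finite,linorder}, 'k::field) mpoly set"
  assumes I: "is_ideal I"
begin

abbreviation locI where "locI \<equiv> localization (ideal_module I)"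

lemma frac_class_inject:
  assumes "x \<in> Loc_all I S"
  shows "frac_class I S x = frac_class I S y \<longleftrightarrow> x = y"
proof
  obtain m a where "x = frac_val S m a" "m \<in> I" using assms by (auto simp: Loc_all_def)
  then have "(m, a) \<in> frac_class I S x" by (simp add: frac_class_def)
  moreover assume "frac_class I S x = frac_class I S y"
  ultimately show "x = y" by (auto simp: frac_class_def)
qed simp

lemma frac_class_nonempty: "x \<in> Loc_all I S \<Longrightarrow> frac_class I S x \<noteq> {}"
  by (auto simp: Loc_all_def frac_class_def)

lemma Loc_subset_Loc_all: "Loc I S r \<subseteq> Loc_all I S"
proof
  fix x assume "x \<in> Loc I S r"
  then obtain a f where "lprod S ^ a * x = emb f" "f \<in> I" by (rule LocE)
  then show "x \<in> Loc_all I S" by (auto simp: Loc_all_def simp flip: frac_val_iff)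
qed

lemma Loc_all_0: "0 \<in> Loc_all I S"
  using ideal_0[OF I] by (force simp: Loc_all_def frac_val_def emb_0)

lemma Loc_all_add: "x \<in> Loc_all I S \<Longrightarrow> y \<in> Loc_all I S \<Longrightarrow> x + y \<in> Loc_all I S"
proof -
  assume "x \<in> Loc_all I S" "y \<in> Loc_all I S"
  then obtain m a m' b where *: "x = frac_val S m a" "m \<in> I" "y = frac_val S m' b" "m' \<in> I"
    unfolding Loc_all_def by blast
  have "var_prod S ^ b * m + var_prod S ^ a * m' \<in> I"
    by (intro ideal_add[OF I] ideal_mult[OF I] *)
  then show "x + y \<in> Loc_all I S"
    unfolding Loc_all_def *(1,3) frac_val_add[symmetric] by blast
qed

text \<open>Multiplication by \<open>lprod S\<close> is injective on Laurent polynomials, so the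
  auxiliary exponent \<open>c\<close> in the relation cancels.\<close>

lemma frac_rel_iff:
  "((m, a), (m', b)) \<in> frac_rel (ideal_module I) S \<longleftrightarrow>
    m \<in> I \<and> m' \<in> I \<and> frac_val S m a = frac_val S m' b"
proof -
  have "var_prod S ^ (c + b) * m = var_prod S ^ (c + a) * m' \<longleftrightarrow> frac_val S m a = frac_val S m' b" for c
  proof -
    have "var_prod S ^ (c + b) * m = var_prod S ^ (c + a) * m' \<longleftrightarrow>
        lprod S ^ (c + b) * emb m = lprod S ^ (c + a) * emb m'"
      by (simp flip: emb_inject add: emb_mult emb_power emb_var_prod)
    also have "lprod S ^ (c + b) * emb m = lprod S ^ (a + b + c) * frac_val S m a"
      by (simp add: power_add mult_ac frac_val_def lprod_power_cancel)
    also have "lprod S ^ (c + a) * emb m' = lprod S ^ (a + b + c) * frac_val S m' b"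
      by (simp add: power_add mult_ac frac_val_def lprod_power_cancel)
    finally show ?thesis unfolding lprod_power_inject .
  qed
  then show ?thesis by (auto simp: frac_rel_def ideal_module_def)
qed

lemma loc_frac_eq: "m \<in> I \<Longrightarrow> loc_frac (ideal_module I) S m a = frac_class I S (frac_val S m a)"
  by (auto simp: loc_frac_def frac_rel_iff frac_class_def)

lemma localization_carrier: "carrier (locI S) = frac_class I S ` Loc_all I S"
proof -
  have "carrier (locI S) = {loc_frac (ideal_module I) S m a | m a. m \<in> I}"
    by (simp add: localization_def ideal_module_def)
  also have "\<dots> = frac_class I S ` Loc_all I S"
    by (auto simp: Loc_all_def loc_frac_eq image_iff) (metis loc_frac_eq)+
  finally show ?thesis .
qed

lemma localization_hpart: "hpart (locI S) r = frac_class I S ` Loc I S r"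
proof -
  have "hpart (locI S) r =
      {loc_frac (ideal_module I) S m a | m a. m \<in> I \<and> lhomog (r + int a * int (card S)) (emb m)}"
    by (simp add: localization_def ideal_module_def lhomog_emb)
  also have "\<dots> = frac_class I S ` Loc I S r"
  proof (intro equalityI subsetI)
    fix A assume "A \<in> {loc_frac (ideal_module I) S m a | m a. m \<in> I \<and> lhomog (r + int a * int (card S)) (emb m)}"
    then obtain m a where m: "A = loc_frac (ideal_module I) S m a" "m \<in> I"
      "lhomog (r + int a * int (card S)) (emb m)" by blast
    have "lhomog r (frac_val S m a)"
      using lhomog_mult[OF lhomog_linv_power m(3), of a S] by (simp add: frac_val_def)
    then have "frac_val S m a \<in> Loc I S r"
      using m(2) by (intro LocI[of S a _ m]) (simp_all add: frac_val_def lprod_power_cancel)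
    then show "A \<in> frac_class I S ` Loc I S r" using m(1,2) by (simp add: loc_frac_eq)
  next
    fix A assume "A \<in> frac_class I S ` Loc I S r"
    then obtain x where x: "A = frac_class I S x" "x \<in> Loc I S r" by blast
    obtain a f where f: "lprod S ^ a * x = emb f" "f \<in> I" "lhomog r x" using x(2) by (rule LocE)
    have "lhomog (r + int a * int (card S)) (emb f)"
      using lhomog_mult[OF lhomog_lprod_power f(3), of a S] by (simp add: f(1) add.commute)
    moreover have "A = loc_frac (ideal_module I) S f a"
      using f(1,2) x(1) by (simp add: loc_frac_eq flip: frac_val_iff)
    ultimately show "A \<in> {loc_frac (ideal_module I) S m a | m a. m \<in> I \<and> lhomog (r + int a * int (card S)) (emb m)}"
      using f(2) by blast
  qed
  finally show ?thesis .
qed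

lemma localization_zero: "\<zero>\<^bsub>locI S\<^esub> = frac_class I S 0"
  by (simp add: localization_def ideal_module_def loc_frac_eq[unfolded ideal_module_def] ideal_0[OF I]
      frac_val_def emb_0)

text \<open>Every pair of representatives contributes the same class to the union, and there is at
  least one pair.\<close>

lemma localization_add:
  assumes x: "x \<in> Loc_all I S" and y: "y \<in> Loc_all I S"
  shows "frac_class I S x \<oplus>\<^bsub>locI S\<^esub> frac_class I S y = frac_class I S (x + y)"
proof -
  have *: "loc_frac (ideal_module I) S (var_prod S ^ b * m + var_prod S ^ a * m') (a + b) =
      frac_class I S (x + y)" if "(m, a) \<in> frac_class I S x" "(m', b) \<in> frac_class I S y" for m a m' b
    using that by (subst loc_frac_eq)
      (auto simp: frac_class_def frac_val_add intro!: ideal_add[OF I] ideal_mult[OF I])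
  have "frac_class I S x \<oplus>\<^bsub>locI S\<^esub> frac_class I S y =
      (\<Union>(m, a)\<in>frac_class I S x. \<Union>(m', b)\<in>frac_class I S y.
        loc_frac (ideal_module I) S (var_prod S ^ b * m + var_prod S ^ a * m') (a + b))"
    by (simp add: localization_def ideal_module_def)
  also have "\<dots> = (\<Union>(m, a)\<in>frac_class I S x. \<Union>(m', b)\<in>frac_class I S y. frac_class I S (x + y))"
    using * by (intro SUP_cong refl) auto
  also have "\<dots> = frac_class I S (x + y)"
    using frac_class_nonempty[OF x] frac_class_nonempty[OF y] by auto
  finally show ?thesis .
qed

lemma localization_smult:
  assumes x: "x \<in> Loc_all I S"
  shows "f \<odot>\<^bsub>locI S\<^esub> frac_class I S x = frac_class I S (emb f * x)"
proof -
  have *: "loc_frac (ideal_module I) S (f * m) a = frac_class I S (emb f * x)"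
    if "(m, a) \<in> frac_class I S x" for m a
    using that by (subst loc_frac_eq) (auto simp: frac_class_def frac_val_mult intro!: ideal_mult[OF I])
  have "f \<odot>\<^bsub>locI S\<^esub> frac_class I S x =
      (\<Union>(m, a)\<in>frac_class I S x. loc_frac (ideal_module I) S (f * m) a)"
    by (simp add: localization_def ideal_module_def)
  also have "\<dots> = (\<Union>(m, a)\<in>frac_class I S x. frac_class I S (emb f * x))"
    using * by (intro SUP_cong refl) auto
  also have "\<dots> = frac_class I S (emb f * x)"
    using frac_class_nonempty[OF x] by auto
  finally show ?thesis .
qed

lemma localization_map_frac_class:
  assumes "S \<subseteq> T" and x: "x \<in> Loc_all I S"
  shows "localization_map (ideal_module I) S T (frac_class I S x) = frac_class I T x"
proof -
  have *: "loc_frac (ideal_module I) T (var_prod (T - S) ^ a * m) a = frac_class I T x"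
    if "(m, a) \<in> frac_class I S x" for m a
    using that by (subst loc_frac_eq)
      (auto simp: frac_class_def frac_val_extend[OF assms(1)] intro!: ideal_mult[OF I])
  have "localization_map (ideal_module I) S T (frac_class I S x) =
      (\<Union>(m, a)\<in>frac_class I S x. loc_frac (ideal_module I) T (var_prod (T - S) ^ a * m) a)"
    by (simp add: localization_map_def ideal_module_def)
  also have "\<dots> = (\<Union>(m, a)\<in>frac_class I S x. frac_class I T x)"
    using * by (intro SUP_cong refl) auto
  also have "\<dots> = frac_class I T x"
    using frac_class_nonempty[OF x] by auto
  finally show ?thesis .
qed

lemma Loc_all_mono: "S \<subseteq> T \<Longrightarrow> Loc_all I S \<subseteq> Loc_all I T"
proof
  fix x assume ST: "S \<subseteq> T" and "x \<in> Loc_all I S"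
  then obtain m a where "x = frac_val S m a" "m \<in> I" unfolding Loc_all_def by blast
  then have "x = frac_val T (var_prod (T - S) ^ a * m) a" "var_prod (T - S) ^ a * m \<in> I"
    by (simp_all add: frac_val_extend[OF ST] ideal_mult[OF I])
  then show "x \<in> Loc_all I T" unfolding Loc_all_def by blast
qed

lemma Loc_all_mult: "x \<in> Loc_all I S \<Longrightarrow> emb f * x \<in> Loc_all I S"
  unfolding Loc_all_def using frac_val_mult ideal_mult[OF I] by (smt (verit, best) mem_Collect_eq)

lemma localization_abelian_monoid: "abelian_monoid (locI S)"
proof (rule abelian_monoidI)
  fix A B C
  assume A: "A \<in> carrier (locI S)"
  then obtain x where x: "A = frac_class I S x" "x \<in> Loc_all I S" by (auto simp: localization_carrier)
  show "\<zero>\<^bsub>locI S\<^esub> \<oplus>\<^bsub>locI S\<^esub> A = A"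
    by (simp add: localization_zero x localization_add Loc_all_0)
  assume B: "B \<in> carrier (locI S)"
  then obtain y where y: "B = frac_class I S y" "y \<in> Loc_all I S" by (auto simp: localization_carrier)
  show "A \<oplus>\<^bsub>locI S\<^esub> B \<in> carrier (locI S)"
    by (auto simp: localization_carrier x y localization_add Loc_all_add)
  show "A \<oplus>\<^bsub>locI S\<^esub> B = B \<oplus>\<^bsub>locI S\<^esub> A"
    by (simp add: x y localization_add add.commute)
  assume C: "C \<in> carrier (locI S)"
  then obtain w where w: "C = frac_class I S w" "w \<in> Loc_all I S" by (auto simp: localization_carrier)
  show "A \<oplus>\<^bsub>locI S\<^esub> B \<oplus>\<^bsub>locI S\<^esub> C =
      A \<oplus>\<^bsub>locI S\<^esub> (B \<oplus>\<^bsub>locI S\<^esub> C)"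
    by (simp add: x y w localization_add Loc_all_add add.assoc)
qed (auto simp: localization_carrier localization_zero Loc_all_0)

lemma localization_finsum:
  assumes "finite A" "\<And>i. i \<in> A \<Longrightarrow> x i \<in> Loc_all I S"
  shows "finsum (locI S) (\<lambda>i. frac_class I S (x i)) A = frac_class I S (\<Sum>i\<in>A. x i)
    \<and> (\<Sum>i\<in>A. x i) \<in> Loc_all I S"
  using assms
proof (induction A)
  case empty
  interpret abelian_monoid "locI S" by (rule localization_abelian_monoid)
  show ?case by (simp add: localization_zero Loc_all_0)
next
  case (insert i A)
  interpret abelian_monoid "locI S" by (rule localization_abelian_monoid)
  have "(\<lambda>i. frac_class I S (x i)) \<in> A \<rightarrow> carrier (locI S)"
    "frac_class I S (x i) \<in> carrier (locI S)"
    using insert.prems by (auto simp: localization_carrier)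
  from finsum_insert[OF insert.hyps this] show ?case
    using insert by (simp add: localization_add Loc_all_add)
qed

text \<open>Translates the zero default outside index sets of size \<open>p\<close> into the
  undefined default of extensional functions; on cochains this is a bijection.\<close>

definition to_cech :: "nat \<Rightarrow> ('n, 'k) cochain \<Rightarrow> 'n set \<Rightarrow> (('n, 'k) mpoly \<times> nat) set" where
  "to_cech p u = (\<lambda>S\<in>{S. card S = p}. frac_class I S (u S))"

lemma cochains_Loc_all: "u \<in> cochains I (int p) r \<Longrightarrow> card S = p \<Longrightarrow> u S \<in> Loc_all I S"
  using cochainsD[of u I "int p" r S] Loc_subset_Loc_all by auto

lemma to_cech_carrier: "carrier (cech_cochains (ideal_module I) p r) = to_cech p ` cochains I (int p) r"
proof (intro equalityI subsetI)
  fix w assume "w \<in> carrier (cech_cochains (ideal_module I) p r)"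
  then have w: "w \<in> (\<Pi>\<^sub>E S\<in>{S. card S = p}. frac_class I S ` Loc I S r)"
    by (simp add: cech_cochains_def localization_hpart)
  then have "\<forall>S. card S = p \<longrightarrow> (\<exists>x. x \<in> Loc I S r \<and> w S = frac_class I S x)" by auto
  then obtain x where x: "\<And>S. card S = p \<Longrightarrow> x S \<in> Loc I S r \<and> w S = frac_class I S (x S)"
    by metis
  define u where "u = (\<lambda>S. if card S = p then x S else 0)"
  have "u \<in> cochains I (int p) r" by (rule cochainsI) (auto simp: u_def x)
  moreover have "w = to_cech p u"
  proof
    show "w S = to_cech p u S" for S
      using x[of S] PiE_arb[OF w, of S] by (cases "card S = p") (auto simp: to_cech_def u_def)
  qed
  ultimately show "w \<in> to_cech p ` cochains I (int p) r" by blast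
next
  fix w assume "w \<in> to_cech p ` cochains I (int p) r"
  then show "w \<in> carrier (cech_cochains (ideal_module I) p r)"
    by (auto simp: cech_cochains_def localization_hpart to_cech_def dest: cochainsD)
qed

lemma to_cech_inject:
  assumes u: "u \<in> cochains I (int p) r" and v: "v \<in> cochains I (int p) r"
  shows "to_cech p u = to_cech p v \<longleftrightarrow> u = v"
proof
  assume eq: "to_cech p u = to_cech p v"
  show "u = v"
  proof
    fix S
    show "u S = v S"
    proof (cases "card S = p")
      case True
      then have "frac_class I S (u S) = frac_class I S (v S)"
        using fun_cong[OF eq, of S] by (simp add: to_cech_def)
      then show ?thesis using frac_class_inject[OF cochains_Loc_all[OF u True]] by blast
    next
      case False
      then show ?thesis using cochains_0D[OF u, of S] cochains_0D[OF v, of S] by simp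
    qed
  qed
qed simp

lemma to_cech_one: "\<one>\<^bsub>cech_cochains (ideal_module I) p r\<^esub> = to_cech p 0"
  by (simp add: cech_cochains_def to_cech_def localization_zero)

lemma to_cech_mult:
  assumes u: "u \<in> cochains I (int p) r" and v: "v \<in> cochains I (int p) r"
  shows "to_cech p u \<otimes>\<^bsub>cech_cochains (ideal_module I) p r\<^esub> to_cech p v = to_cech p (u + v)"
proof -
  have "frac_class I S (u S) \<oplus>\<^bsub>locI S\<^esub> frac_class I S (v S) =
      frac_class I S (u S + v S)" if "card S = p" for S
    by (rule localization_add) (use cochains_Loc_all[OF u that] cochains_Loc_all[OF v that] in auto)
  then show ?thesis by (simp add: cech_cochains_def to_cech_def restrict_def fun_eq_iff)
qed

lemma cech_diff_to_cech:
  assumes u: "u \<in> cochains I (int p) r"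
  shows "cech_diff (ideal_module I) p (to_cech p u) = to_cech (Suc p) (delta u)"
proof -
  have "finsum (locI T) (\<lambda>i. ((- 1) ^ card {j \<in> T. j < i}) \<odot>\<^bsub>locI T\<^esub>
        localization_map (ideal_module I) (T - {i}) T (to_cech p u (T - {i}))) T = frac_class I T (delta u T)"
    if T: "card T = Suc p" for T :: "'n set"
  proof -
    have c: "card (T - {i}) = p" if "i \<in> T" for i using that T by simp
    have L: "u (T - {i}) \<in> Loc_all I (T - {i})" if "i \<in> T" for i
      by (rule cochains_Loc_all[OF u c[OF that]])
    have L': "u (T - {i}) \<in> Loc_all I T" if "i \<in> T" for i
      using L[OF that] Loc_all_mono[of "T - {i}" T] by blast
    have sign: "emb ((- 1) ^ k) = ((- 1) ^ k :: ('n, 'k) laurent)" for k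
      by (simp add: emb_power emb_uminus emb_1)
    have summand: "((- 1) ^ card {j \<in> T. j < i}) \<odot>\<^bsub>locI T\<^esub>
        localization_map (ideal_module I) (T - {i}) T (to_cech p u (T - {i})) =
        frac_class I T (cech_sign T i * u (T - {i}))" if i: "i \<in> T" for i
    proof -
      have "to_cech p u (T - {i}) = frac_class I (T - {i}) (u (T - {i}))"
        using c[OF i] by (simp add: to_cech_def)
      then show ?thesis
        using localization_map_frac_class[of "T - {i}" T, OF _ L[OF i]] localization_smult[OF L'[OF i]]
        by (simp add: sign cech_sign_def Diff_subset)
    qed
    have Ls: "cech_sign T i * u (T - {i}) \<in> Loc_all I T" if i: "i \<in> T" for i
      using Loc_all_mult[OF L'[OF i], of "(- 1) ^ card {j \<in> T. j < i}"] by (simp add: sign cech_sign_def)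
    interpret abelian_monoid "locI T" by (rule localization_abelian_monoid)
    have "finsum (locI T) (\<lambda>i. ((- 1) ^ card {j \<in> T. j < i}) \<odot>\<^bsub>locI T\<^esub>
        localization_map (ideal_module I) (T - {i}) T (to_cech p u (T - {i}))) T =
      finsum (locI T) (\<lambda>i. frac_class I T (cech_sign T i * u (T - {i}))) T"
      using Ls by (intro finsum_cong' refl summand) (auto simp: localization_carrier)
    then show ?thesis
      using localization_finsum[OF finite[of T] Ls] by (simp add: delta_def)
  qed
  then show ?thesis
    unfolding cech_diff_def to_cech_def[of "Suc p"] by (intro restrict_ext) simp
qed

lemma cech_cocycles_eq:
  "cech_cocycles (ideal_module I) p r = to_cech p ` {u \<in> cochains I (int p) r. delta u = 0}"
proof -
  have "to_cech (Suc p) (delta u) = to_cech (Suc p) 0 \<longleftrightarrow> delta u = 0" if "u \<in> cochains I (int p) r" for u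
    by (rule to_cech_inject[where r = r])
      (use cochains_delta[OF I that] cochains_zero[OF I, of "int (Suc p)" r] in \<open>simp_all add: add.commute\<close>)
  then show ?thesis
    by (auto simp: cech_cocycles_def kernel_def to_cech_carrier to_cech_one cech_diff_to_cech)
qed

lemma cech_coboundaries_eq:
  "cech_coboundaries (ideal_module I) p r = to_cech p ` delta ` cochains I (int p - 1) r"
proof (cases p)
  case 0
  have "cochains I (- 1) r = {0}"
    using cochains_minus_1 cochains_zero[OF I] by blast
  then show ?thesis by (simp add: 0 cech_coboundaries_def to_cech_one delta_0)
next
  case (Suc q)
  then show ?thesis
    by (auto simp: cech_coboundaries_def to_cech_carrier cech_diff_to_cech image_image intro!: image_cong)
qed

text \<open>Only the carrier and the identity of the quotient enter. Its cosets correspond to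
  translates of \<open>B\<close>, and the translate by \<open>a\<close> is \<open>B\<close> exactly
  for \<open>a\<close> in \<open>B\<close>.\<close>

lemma local_cohomology_nontrivial_iff:
  "carrier (local_cohomology (ideal_module I) p r) \<noteq> {\<one>\<^bsub>local_cohomology (ideal_module I) p r\<^esub>} \<longleftrightarrow>
    nontrivial_cohomology {0} I (int p) r"
proof -
  define Z where "Z = {u \<in> cochains I (int p) r. delta u = 0}"
  define B where "B = delta ` cochains I (int p - 1) r"
  define G where "G = (cech_cochains (ideal_module I) p r)\<lparr>carrier := cech_cocycles (ideal_module I) p r\<rparr>"
  have BI: "B \<subseteq> cochains I (int p) r"
    using cochains_delta[OF I, of _ "int p - 1" r] by (auto simp: B_def)
  have ZI: "Z \<subseteq> cochains I (int p) r" by (auto simp: Z_def)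
  have B0: "0 \<in> B" using cochains_zero[OF I] delta_0 by (metis B_def image_eqI)
  have Badd: "b + a \<in> B" "b - a \<in> B" if "b \<in> B" "a \<in> B" for a b
    using that cochains_add[OF I, of _ "int p - 1" r] cochains_diff[OF I, of _ "int p - 1" r]
    by (auto simp: B_def simp flip: delta_add delta_diff)
  have coset: "to_cech p ` B #>\<^bsub>G\<^esub> to_cech p a = to_cech p ` ((\<lambda>b. b + a) ` B)" if "a \<in> Z" for a
  proof -
    have "to_cech p b \<otimes>\<^bsub>G\<^esub> to_cech p a = to_cech p (b + a)" if "b \<in> B" for b
      using to_cech_mult[of b p r a] that \<open>a \<in> Z\<close> BI ZI by (auto simp: G_def)
    then show ?thesis by (auto simp: r_coset_def)
  qed
  have carrier: "carrier (local_cohomology (ideal_module I) p r) =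
    (\<lambda>a. to_cech p ` ((\<lambda>b. b + a) ` B)) ` Z"
  proof -
    have "carrier (local_cohomology (ideal_module I) p r) = rcosets\<^bsub>G\<^esub> (to_cech p ` B)"
      by (simp add: local_cohomology_def FactGroup_def G_def cech_coboundaries_eq B_def)
    also have "\<dots> = (\<lambda>a. to_cech p ` B #>\<^bsub>G\<^esub> to_cech p a) ` Z"
      by (auto simp: RCOSETS_def G_def cech_cocycles_eq Z_def)
    also have "\<dots> = (\<lambda>a. to_cech p ` ((\<lambda>b. b + a) ` B)) ` Z"
      by (rule image_cong[OF refl coset])
    finally show ?thesis .
  qed
  have one: "\<one>\<^bsub>local_cohomology (ideal_module I) p r\<^esub> = to_cech p ` B"
    by (simp add: local_cohomology_def FactGroup_def cech_coboundaries_eq B_def)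
  have eq_iff: "to_cech p ` ((\<lambda>b. b + a) ` B) = to_cech p ` B \<longleftrightarrow> a \<in> B" if a: "a \<in> Z" for a
  proof
    assume eq: "to_cech p ` ((\<lambda>b. b + a) ` B) = to_cech p ` B"
    have "to_cech p (0 + a) \<in> to_cech p ` ((\<lambda>b. b + a) ` B)" using B0 by blast
    then have "to_cech p (0 + a) \<in> to_cech p ` B" by (simp only: eq)
    then obtain b where b: "b \<in> B" "to_cech p a = to_cech p b" by auto
    then have "a = b" using to_cech_inject[of a p r b] a BI ZI by blast
    then show "a \<in> B" using b(1) by simp
  next
    assume aB: "a \<in> B"
    have "(\<lambda>b. b + a) ` B = B"
    proof (intro equalityI subsetI)
      fix b assume "b \<in> B"
      then have "b - a \<in> B" "b = (b - a) + a" using Badd aB by auto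
      then show "b \<in> (\<lambda>b. b + a) ` B" by (metis image_eqI)
    qed (use Badd(1) aB in auto)
    then show "to_cech p ` ((\<lambda>b. b + a) ` B) = to_cech p ` B" by simp
  qed
  have Z0: "0 \<in> Z" using cochains_zero[OF I] by (simp add: Z_def delta_0)
  define F where "F a = to_cech p ` ((\<lambda>b. b + a) ` B)" for a
  have "F ` Z \<noteq> {to_cech p ` B} \<longleftrightarrow> (\<exists>a\<in>Z. F a \<noteq> to_cech p ` B)"
    using Z0 by auto
  also have "\<dots> \<longleftrightarrow> (\<exists>a\<in>Z. a \<notin> B)"
    using eq_iff by (simp add: F_def)
  finally have "carrier (local_cohomology (ideal_module I) p r) \<noteq> {\<one>\<^bsub>local_cohomology (ideal_module I) p r\<^esub>} \<longleftrightarrow>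
      (\<exists>a\<in>Z. a \<notin> B)"
    unfolding carrier one F_def .
  also have "\<dots> \<longleftrightarrow> nontrivial_cohomology {0} I (int p) r"
    unfolding nontrivial_ideal_iff by (auto simp: Z_def B_def)
  finally show ?thesis .
qed

end

section \<open>Invariance under passing to the generic initial ideal\<close>

lemma Max_a_inv_eq_SUP:
  fixes I :: "('n::{finite,linorder}, 'k::field) mpoly set"
  assumes I: "is_ideal I"
  shows "Max {a_inv (ideal_module I) i + ereal (c * real i) | i. i \<le> t} =
    (SUP x\<in>weighted_degrees {0} I c t. ereal x)"
proof -
  define a where "a i = a_inv (ideal_module I) i" for i
  have a: "a i = (SUP r\<in>{r. nontrivial_cohomology {0} I (int i) r}. ereal (real_of_int r))" for i
    by (simp add: a_def a_inv_def local_cohomology_nontrivial_iff[OF I])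
  have eq: "{a i + ereal (c * real i) | i. i \<le> t} = (\<lambda>i. a i + ereal (c * real i)) ` {..t}"
    by auto
  have "a i + ereal (c * real i) \<le> (SUP x\<in>weighted_degrees {0} I c t. ereal x)" if i: "i \<le> t" for i
  \<comment> \<open>Without degrees the supremum is \<open>-\<infinity>\<close> and adding a finite
    number keeps it; for a nonempty set the constant can be moved under the supremum.\<close>
  proof (cases "{r. nontrivial_cohomology {0} I (int i) r} = {}")
    case True
    show ?thesis unfolding a True by (simp add: bot_ereal_def)
  next
    case False
    have "a i + ereal (c * real i) =
        (SUP r\<in>{r. nontrivial_cohomology {0} I (int i) r}. ereal (real_of_int r) + ereal (c * real i))"
      unfolding a by (rule SUP_ereal_add_left[symmetric]) (use False in auto)
    also have "\<dots> \<le> (SUP x\<in>weighted_degrees {0} I c t. ereal x)"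
    proof (rule SUP_least)
      fix r assume "r \<in> {r. nontrivial_cohomology {0} I (int i) r}"
      then have "real_of_int r + c * real i \<in> weighted_degrees {0} I c t"
        using i by (intro weighted_degreesI) auto
      from SUP_upper[OF this, of ereal]
      show "ereal (real_of_int r) + ereal (c * real i) \<le> (SUP x\<in>weighted_degrees {0} I c t. ereal x)"
        by simp
    qed
    finally show ?thesis .
  qed
  moreover have "ereal x \<le> Max ((\<lambda>i. a i + ereal (c * real i)) ` {..t})"
    if x: "x \<in> weighted_degrees {0} I c t" for x
  proof -
    obtain i r where ir: "x = real_of_int r + c * real i" "i \<le> t" "nontrivial_cohomology {0} I (int i) r"
      using x unfolding weighted_degrees_def by blast
    have "ereal (real_of_int r) \<le> a i" unfolding a using ir(3) by (intro SUP_upper) auto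
    then have "ereal x \<le> a i + ereal (c * real i)"
      using add_right_mono[of "ereal (real_of_int r)" "a i" "ereal (c * real i)"] by (simp add: ir(1))
    also have "\<dots> \<le> Max ((\<lambda>i. a i + ereal (c * real i)) ` {..t})"
      using ir(2) by (intro Max_ge) auto
    finally show ?thesis .
  qed
  ultimately show ?thesis
    unfolding a_def[symmetric] eq by (intro antisym Max.boundedI SUP_least) auto
qed

lemma SUP_cofinal_le:
  assumes "cofinal_le A B"
  shows "(SUP x\<in>A. ereal x) \<le> (SUP x\<in>B. ereal x)"
  using assms by (intro SUP_least) (fastforce simp: cofinal_le_def intro: SUP_upper2)

section \<open>Transport of the filter-regular sequence along the coordinate change\<close>

lemma homogeneous_adjoin:
  fixes J S :: "('n::{finite,linorder}, 'k::field) mpoly set"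
  assumes "homogeneous_ideal J" "finite S" "\<And>z. z \<in> S \<Longrightarrow> homog 1 z"
  shows "homogeneous_ideal (adjoin J S)"
  using assms(2,3)
proof (induction S)
  case empty
  then show ?case using assms(1) by (simp add: adjoin_empty homogeneous_imp_ideal)
next
  case (insert z S)
  then have "homogeneous_ideal (ideal_plus (adjoin J S) z)"
    by (intro homogeneous_ideal_plus) auto
  then show ?case unfolding ideal_plus_adjoin .
qed

lemma linear_change_mem_iff:
  assumes "g' ** g = mat 1"
  shows "linear_change g f \<in> linear_change g ` J \<longleftrightarrow> f \<in> J"
  using inj_image_mem_iff[OF inj_on_inverseI[of UNIV "linear_change g'"], of "linear_change g"]
    linear_change_inverse[OF assms] by blast

lemma degs_linear_change:
  assumes "invertible g"
  shows "degs (linear_change g ` J) (linear_change g z) = degs J z"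
proof -
  obtain g' where g': "invertible g'" "g ** g' = mat 1" "g' ** g = mat 1"
    using assms by (rule invertible_inverse_obtain)
  show ?thesis
  proof (intro equalityI subsetI)
    fix d assume "d \<in> degs (linear_change g ` J) (linear_change g z)"
    then obtain f where f: "homog d f" "linear_change g z * f \<in> linear_change g ` J" "f \<notin> linear_change g ` J"
      by (auto simp: degs_def)
    have f': "f = linear_change g (linear_change g' f)" by (simp add: linear_change_inverse g'(2))
    have "z * linear_change g' f \<in> J"
      using f(2) by (subst (asm) f') (simp add: linear_change_mem_iff[OF g'(3)] flip: linear_change_mult)
    moreover have "linear_change g' f \<notin> J" using f(3) f' by blast
    ultimately show "d \<in> degs J z" using homog_linear_change[OF f(1)] by (auto simp: degs_def)
  next
    fix d assume "d \<in> degs J z"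
    then obtain f where "homog d f" "z * f \<in> J" "f \<notin> J" by (auto simp: degs_def)
    then have "homog d (linear_change g f)" "linear_change g z * linear_change g f \<in> linear_change g ` J"
      "linear_change g f \<notin> linear_change g ` J"
      by (auto simp: homog_linear_change linear_change_mem_iff[OF g'(3)] simp flip: linear_change_mult)
    then show "d \<in> degs (linear_change g ` J) (linear_change g z)" by (auto simp: degs_def)
  qed
qed

text \<open>
  The variables, by decreasing index, are filter-regular on \<open>gI\<close>; pulled back along \<open>g\<close> they give a
  filter-regular sequence on \<open>I\<close> with the same degrees as the one on the initial ideal.
\<close>

lemma matching_initial_ideal:
  fixes I :: "('n::{finite,linorder}, 'k::field) mpoly set"
  assumes I: "homogeneous_ideal I" and g: "invertible g" "g' ** g = mat 1" "g ** g' = mat 1"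
    and reg: "\<And>l. filter_regular (mvar l) (adjoin (linear_change g ` I) (mvar ` {l<..}))"
    and vs: "sorted_wrt (>) vs" "set vs = - A" "\<And>x y. x \<in> A \<Longrightarrow> y \<in> set vs \<Longrightarrow> y < x"
  shows "matching (adjoin I (linear_change g' ` mvar ` A)) (map (linear_change g' \<circ> mvar) vs)
    (monomial_span (leads (adjoin (linear_change g ` I) (mvar ` A)))) (map mvar vs)"
  using vs
proof (induction vs arbitrary: A)
  case Nil
  then show ?case by (simp add: matching.Nil)
next
  case (Cons i ws)
  \<comment> \<open>The list is decreasing and everything outside it lies above its members, so
    exactly the variables after the head have been adjoined.\<close>
  have A: "A = {i<..}"
  proof (intro equalityI subsetI)
    show "x \<in> {i<..}" if "x \<in> A" for x using Cons.prems(3)[of x i] that by simp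
    show "x \<in> A" if x: "x \<in> {i<..}" for x
    proof (rule ccontr)
      assume "x \<notin> A"
      then have "x \<in> set (i # ws)" using Cons.prems(2) by blast
      then show False using Cons.prems(1) x by auto
    qed
  qed
  have g': "invertible g'" using g(2,3) by (auto simp: invertible_def)
  define J where "J = adjoin (linear_change g ` I) (mvar ` A)"
  have J: "homogeneous_ideal J"
    unfolding J_def using I g(1)
    by (intro homogeneous_adjoin homogeneous_ideal_linear_change) (auto simp: homog_mvar simp del: One_nat_def)
  have later: "mvar j \<in> J" if "i < j" for j
    using that A adjoin_superset(2)[of "mvar ` A" "linear_change g ` I"] by (auto simp: J_def)
  \<comment> \<open>The ideal on the left is the pullback of \<open>J\<close>. Filter-regularity and
    degrees come from \<open>J\<close>, while the cohomology remains that of quotients of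
    \<open>R\<close> by ideals containing \<open>I\<close> itself.\<close>
  have J0: "adjoin I (linear_change g' ` mvar ` A) = linear_change g' ` J"
    by (simp add: J_def linear_change_adjoin[OF g'] image_image linear_change_inverse[OF g(2)])
  have regJ: "filter_regular (mvar i) J" using reg[of i] by (simp add: J_def A)
  have span: "homogeneous_ideal (monomial_span (leads J) :: ('n, 'k) mpoly set)"
    by (intro homogeneous_monomial_span leads_add homogeneous_imp_ideal J)
  have plus1: "ideal_plus (adjoin I (linear_change g' ` mvar ` A)) (linear_change g' (mvar i)) =
      adjoin I (linear_change g' ` mvar ` insert i A)"
    by (simp add: ideal_plus_adjoin)
  have plus2: "ideal_plus (monomial_span (leads J)) (mvar i) =
      (monomial_span (leads (adjoin (linear_change g ` I) (mvar ` insert i A))) :: ('n, 'k) mpoly set)"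
    using ideal_plus_monomial_span[OF J later] by (simp add: J_def ideal_plus_adjoin)
  have IH: "matching (adjoin I (linear_change g' ` mvar ` insert i A)) (map (linear_change g' \<circ> mvar) ws)
    (monomial_span (leads (adjoin (linear_change g ` I) (mvar ` insert i A)))) (map mvar ws)"
  proof (rule Cons.IH)
    show "sorted_wrt (>) ws" using Cons.prems(1) by simp
    have "i \<notin> set ws" using Cons.prems(1) by auto
    then show "set ws = - insert i A" using Cons.prems(2) by auto
    show "y < x" if "x \<in> insert i A" "y \<in> set ws" for x y
      using that Cons.prems(1,3) by auto
  qed
  have "matching (adjoin I (linear_change g' ` mvar ` A))
      (linear_change g' (mvar i) # map (linear_change g' \<circ> mvar) ws)
      (monomial_span (leads J)) (mvar i # map mvar ws)"
  proof (rule matching.Cons)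
    show "homogeneous_ideal (adjoin I (linear_change g' ` mvar ` A))"
      unfolding J0 by (rule homogeneous_ideal_linear_change[OF J g'])
    show "filter_regular (linear_change g' (mvar i)) (adjoin I (linear_change g' ` mvar ` A))"
      unfolding J0 by (intro filter_regular_linear_change homogeneous_imp_ideal J g' regJ)
    show "filter_regular (mvar i) (monomial_span (leads J) :: ('n, 'k) mpoly set)"
      by (rule filter_regular_monomial_span[OF J later regJ])
    show "degs (adjoin I (linear_change g' ` mvar ` A)) (linear_change g' (mvar i)) =
        degs (monomial_span (leads J) :: ('n, 'k) mpoly set) (mvar i)"
      unfolding J0 by (simp add: degs_linear_change[OF g'] degs_monomial_span[OF J later])
    show "matching (ideal_plus (adjoin I (linear_change g' ` mvar ` A)) (linear_change g' (mvar i)))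
        (map (linear_change g' \<circ> mvar) ws) (ideal_plus (monomial_span (leads J)) (mvar i)) (map mvar ws)"
      unfolding plus1 plus2 by (rule IH)
  qed (fact span linear_change_mvar mvar_eq_lform)+
  then show ?case by (simp add: J_def comp_def)
qed

theorem corollary6p3:
  fixes I :: "('n::{finite,linorder}, 'k::field) mpoly set" and t :: nat
  assumes "infinite (UNIV :: 'k set)"
    and "homogeneous_ideal I"
  shows "reg_upto t (ideal_module I) = reg_upto t (ideal_module (Gin I)) \<and>
         a_star t (ideal_module I) = a_star t (ideal_module (Gin I))"
proof -
  have I: "is_ideal I" using assms(2) by (rule homogeneous_imp_ideal)
  obtain F a where F: "polyfun F" "F a \<noteq> 0"
    and leads: "\<And>g. invertible g \<Longrightarrow> F g \<noteq> 0 \<Longrightarrow> leads (linear_change g ` I) = generic_leads I"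
    using generic_leads_open[OF assms(1) I] by blast
  obtain g0 where g0: "invertible g0" "F g0 \<noteq> 0"
    using polyfun_invertible_nonzero[OF assms(1) F F] by blast
  \<comment> \<open>One matrix has to lie where the leading monomials are generic, so that
    \<open>Gin I\<close> is the initial ideal of the transformed \<open>I\<close>, and to make the
    variables filter-regular.\<close>
  obtain g where g: "invertible g" "F g \<noteq> 0"
    "\<And>l. filter_regular (mvar l) (adjoin (linear_change g ` I) (mvar ` {l<..}))"
    using generic_filter_regular[OF assms(1) I F(1) g0] by blast
  obtain g' where g': "g ** g' = mat 1" "g' ** g = mat 1"
    using g(1) by (rule invertible_inverse_obtain)
  have gI: "is_ideal (linear_change g ` I)" by (rule is_ideal_linear_change[OF I g(1)])
  have Gin: "Gin I = monomial_span (leads (linear_change g ` I))"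
    by (simp add: Gin_eq[OF assms(1) I] leads g(1,2))
  have GinI: "homogeneous_ideal (Gin I)"
    unfolding Gin by (intro homogeneous_monomial_span leads_add gI)
  define vs :: "'n list" where "vs = rev (sorted_list_of_set UNIV)"
  have vs: "sorted_wrt (>) vs" "set vs = UNIV" "length vs = CARD('n)"
    by (simp_all add: vs_def sorted_wrt_rev)
  define zs where "zs = map (linear_change g' \<circ> mvar) vs"
  have "matching (adjoin I (linear_change g' ` mvar ` {})) zs
      (monomial_span (leads (adjoin (linear_change g ` I) (mvar ` {})))) (map mvar vs)"
    unfolding zs_def by (rule matching_initial_ideal[OF assms(2) g(1) g'(2,1) g(3) vs(1)]) (use vs in auto)
  then have match: "matching I zs (Gin I) (map mvar vs)"
    by (simp add: adjoin_empty I gI Gin)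
  have len: "length zs = CARD('n)" "length (map mvar vs) = CARD('n)"
    by (simp_all add: zs_def vs)
  \<comment> \<open>The comparison needs a nonzero target ideal for the class in degree
    \<open>-n\<close>, so the zero ideal is split off, simultaneously on both sides.\<close>
  have zero: "I = {0} \<longleftrightarrow> Gin I = {0}"
  proof
    assume "I = {0}"
    then have "leads (linear_change g ` I) = {}" by (simp add: linear_change_0 leads_def)
    then show "Gin I = {0}" unfolding Gin by (auto simp: monomial_span_def)
  next
    assume Gin0: "Gin I = {0}"
    have "f = 0" if f: "f \<in> I" for f
    proof (rule ccontr)
      assume "f \<noteq> 0"
      then have "linear_change g f \<noteq> 0"
        using linear_change_inverse[OF g'(2), of f] by (auto simp: linear_change_0)
      then have "lead_mon (linear_change g f) \<in> leads (linear_change g ` I)"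
        using f by (auto simp: leads_def)
      then have "leads (Gin I) \<noteq> {}" unfolding Gin leads_monomial_span by blast
      then show False by (simp add: Gin0 leads_def)
    qed
    then show "I = {0}" using ideal_0[OF I] by blast
  qed
  have main: "(SUP x\<in>weighted_degrees {0} I c t. ereal x) = (SUP x\<in>weighted_degrees {0} (Gin I) c t. ereal x)"
    if "c \<le> 1" for c
  proof (cases "I = {0}")
    case True
    then show ?thesis using zero by simp
  next
    case False
    then show ?thesis
      using zero len that match assms(2) GinI
      by (intro antisym SUP_cofinal_le weighted_degrees_ideal[OF _ _ _ match]
          weighted_degrees_ideal[OF _ _ _ matching_sym[OF match]]) auto
  qed
  \<comment> \<open>The weight \<open>c = 1\<close> gives the regularities, \<open>c = 0\<close> the
    invariants without shift.\<close>
  note max = Max_a_inv_eq_SUP[OF I] Max_a_inv_eq_SUP[OF homogeneous_imp_ideal[OF GinI]]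
  show ?thesis
    using max[of 1 t] main[of 1] max[of 0 t] main[of 0] by (simp add: reg_upto_def a_star_def)
qed

end
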